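(* Let $n\geq 3$, $0<\alpha\leq 1$, and $u\in C^2(\mathbb{B}^n,\mathbb{R}^n)\cap C(\overline{\mathbb{B}^n},\mathbb{R}^n)$. Suppose that (a) there are $x_0\in\mathbb{S}^{n-1}$ and a constant $M$ such that $|u(x)-u(x_0)|\leq M|x-x_0|^\alpha$ for all $x\in\mathbb{S}^{n-1}$; (b) $(1-|y|^2)^{-1-\alpha}\Delta_h u\in L^p(\mathbb{B}^n,d\nu)$ for some $p>n$. If $u$ is $\alpha$-Hölder on $\mathbb{S}^{n-1}$, then $u$ is $\alpha$-Hölder on $\overline{\mathbb{B}^n}$.
   Context: $\mathbb{B}^n$ is the open unit ball and $\mathbb{S}^{n-1}$ the unit sphere of $\mathbb{R}^n$; $\nu$ is Lebesgue measure on $\mathbb{B}^n$ normalized so that $\nu(\mathbb{B}^n)=1$. The hyperbolic Laplacian is $$\Delta_h u(x)=(1-|x|^2)^2\Delta u(x)+2(n-2)(1-|x|^2)\sum_{i=1}^n x_i\frac{\partial u}{\partial x_i}(x),$$ applied componentwise. A function $f$ on a set $D\subset\mathbb{R}^n$ is $\alpha$-Hölder on $D$ if there is a constant $C$ with $|f(x)-f(y)|\leq C|x-y|^\alpha$ for all $x,y\in D$ (Lipschitz if $\alpha=1$). *)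

theory Defs
  imports "HOL-Analysis.Analysis"
begin

definition partial_deriv :: "'n \<Rightarrow> (real ^ 'n \<Rightarrow> 'b::real_normed_vector) \<Rightarrow> real ^ 'n \<Rightarrow> 'b" where
  "partial_deriv i f x = frechet_derivative f (at x) (axis i 1)"

text \<open>The next two notions are meant for open sets \<open>S\<close>, where the derivative \<open>at x\<close>
  depends only on the values of the function in \<open>S\<close>.\<close>

definition C1_on :: "(real ^ 'n) set \<Rightarrow> (real ^ 'n \<Rightarrow> 'b::real_normed_vector) \<Rightarrow> bool" where
  "C1_on S f \<longleftrightarrow>
     (\<forall>x\<in>S. f differentiable (at x)) \<and> (\<forall>i. continuous_on S (partial_deriv i f))"

definition C2_on :: "(real ^ 'n) set \<Rightarrow> (real ^ 'n \<Rightarrow> 'b::real_normed_vector) \<Rightarrow> bool" where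
  "C2_on S f \<longleftrightarrow> C1_on S f \<and> (\<forall>i. C1_on S (partial_deriv i f))"

definition laplacian :: "(real ^ 'n \<Rightarrow> real) \<Rightarrow> real ^ 'n \<Rightarrow> real" where
  "laplacian f x = (\<Sum>i\<in>UNIV. partial_deriv i (partial_deriv i f) x)"

definition hyp_laplacian :: "(real ^ 'n \<Rightarrow> real) \<Rightarrow> real ^ 'n \<Rightarrow> real" where
  "hyp_laplacian f x =
     (1 - (norm x)\<^sup>2)\<^sup>2 * laplacian f x
     + 2 * (real CARD('n) - 2) * (1 - (norm x)\<^sup>2) * (\<Sum>i\<in>UNIV. x $ i * partial_deriv i f x)"

definition vec_hyp_laplacian :: "(real ^ 'n \<Rightarrow> real ^ 'm) \<Rightarrow> real ^ 'n \<Rightarrow> real ^ 'm" where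
  "vec_hyp_laplacian u x = (\<chi> j. hyp_laplacian (\<lambda>y. u y $ j) x)"

text \<open>The underlying space of \<open>ball_measure\<close> is the open ball itself, so measurability with
  respect to it says nothing about the values of a function outside the ball.\<close>

definition ball_measure :: "(real ^ 'n) measure" where
  "ball_measure = uniform_measure (lebesgue_on (ball 0 1)) (ball 0 1)"

definition in_Lp :: "real \<Rightarrow> 'a measure \<Rightarrow> ('a \<Rightarrow> 'b::euclidean_space) \<Rightarrow> bool" where
  "in_Lp p M f \<longleftrightarrow> f \<in> borel_measurable M \<and> integrable M (\<lambda>x. norm (f x) powr p)"

definition holder_on ::
  "real \<Rightarrow> 'a::real_normed_vector set \<Rightarrow> ('a \<Rightarrow> 'b::real_normed_vector) \<Rightarrow> bool" where
  "holder_on \<alpha> D f \<longleftrightarrow> (\<exists>C. \<forall>x\<in>D. \<forall>y\<in>D. norm (f x - f y) \<le> C * norm (x - y) powr \<alpha>)"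

end

theory Submission
  imports Defs
begin

text \<open>Write \<open>w(y) = 1 - |y|\<^sup>2\<close>, \<open>f = \<Delta>\<^sub>h u\<close> and \<open>d\<tau> = w^(-n) dy\<close>, the hyperbolic volume. The
  integrability hypothesis says \<open>f = w^(1+\<alpha>) h\<close> with \<open>h\<close> in \<open>L^p\<close>, \<open>p > n\<close>. Such an \<open>f\<close> need not be
  \<open>O(w^\<alpha>)\<close> pointwise, but its averages over hyperbolic balls of a fixed radius are \<open>O(w^\<alpha>)\<close>. So
  pointwise information on \<open>\<Delta>\<^sub>h u\<close> is replaced throughout by a mean value formula at that scale;
  the hyperbolic ball about \<open>x\<close> used here lies in the Euclidean ball of radius \<open>w(x)/4\<close>.

  The mean value formula. Let \<open>\<rho>(x,y) = |x-y|\<^sup>2 / (w(x) w(y))\<close>, which is \<open>sinh\<^sup>2\<close> of the hyperbolic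
  distance. As \<open>\<Delta>\<^sub>h\<close> is invariant, \<open>\<Delta>\<^sub>h e(\<rho>(x,y))\<close>, taken in \<open>y\<close>, is again a function of \<open>\<rho>\<close>, namely
  \<open>4\<rho>(1+\<rho>) e'' + 2n(1+2\<rho>) e'\<close> (\<open>hyp_laplacian_radial\<close>). A potential with
  \<open>e' = - \<chi>(\<rho>) (\<rho>(1+\<rho>) + s)^(-n/2)\<close>, where \<open>\<chi>\<close> is a decreasing cutoff and \<open>s > 0\<close> a regularisation
  of the fundamental solution, gives \<open>\<Delta>\<^sub>h e = k - k'\<close> with an outer kernel \<open>k \<ge> 0\<close> and an inner
  kernel \<open>k' \<ge> 0\<close> which concentrates at \<open>x\<close> as \<open>s \<rightarrow> 0\<close>. Green's formula then yields
  \<open>\<integral> u k d\<tau> - \<integral> u k' d\<tau> = \<integral> e f d\<tau>\<close> (\<open>mean_value_formula\<close>), in which \<open>u(x)\<close> appears in the limit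
  (\<open>inner_kernel_limit\<close>). All other bounds are uniform in \<open>s\<close>, so that the limit is only taken
  in inequalities between numbers.

  The kernels \<open>e\<close> and \<open>k\<close> are both \<open>O((w/|x-y|)^(n-1))\<close>, and their change from \<open>x\<close> to a nearby
  \<open>x'\<close> is of the same size times \<open>|x-x'|/w\<close> (\<open>hyp_kernel_le\<close>, \<open>hyp_kernel_diff_le\<close>). The power
  \<open>|z|^(1-n)\<close> is locally in \<open>L^q\<close>, \<open>1/p + 1/q = 1\<close>, exactly because \<open>p > n\<close>; hence
  \<open>\<integral> e |f| d\<tau> = O(w^\<alpha>)\<close> (\<open>riesz_potential_Lp_bounded\<close>).

  Towards the boundary. For \<open>\<xi>\<close> on the sphere, \<open>b = |x-\<xi>|^\<alpha> + (n+1) w^\<alpha>\<close> satisfies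
  \<open>\<Delta>\<^sub>h b \<le> - 4 \<alpha> w^\<alpha>\<close>; this is where \<open>n \<ge> 3\<close> and \<open>\<alpha> \<le> 1\<close> are needed, since \<open>\<Delta>\<^sub>h w^\<alpha>\<close> behaves
  like \<open>- 4 \<alpha> (n-1-\<alpha>) w^\<alpha>\<close> near the sphere. For large \<open>K\<close> the function \<open>u - K b\<close> has no interior
  maximum: at such a point the mean value formula would give
  \<open>0 \<ge> \<integral> e \<Delta>\<^sub>h(u - K b) d\<tau> \<ge> (cK - C) w^\<alpha> > 0\<close> (\<open>no_interior_max\<close>). Comparison on the sphere gives
  \<open>|u(x) - u(\<xi>)| \<le> C |x-\<xi>|^\<alpha>\<close> (\<open>boundary_holder\<close>).

  In the interior. By the previous step \<open>u\<close> oscillates by \<open>O(w^\<alpha>)\<close> on the ball of radius \<open>w(x)\<close>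
  about \<open>x\<close>. Subtracting the mean value formulas at \<open>x\<close> and at \<open>x'\<close> with \<open>|x-x'| \<le> w(x)/16\<close>
  gives \<open>|u(x) - u(x')| \<le> C (|x-x'|/w) w^\<alpha> \<le> C |x-x'|^\<alpha>\<close> (\<open>interior_holder\<close>). Points that are
  further apart are compared through a boundary point.\<close>

section \<open>Gradients and Hessians on open sets\<close>

text \<open>The gradient is carried as explicit data, because the chain and product rules below then
  produce formulas for it, whereas \<open>partial_deriv\<close> only selects a derivative by choice.\<close>

definition has_gradient_on ::
  "(real ^ 'n) set \<Rightarrow> (real ^ 'n \<Rightarrow> real) \<Rightarrow> ('n \<Rightarrow> real ^ 'n \<Rightarrow> real) \<Rightarrow> bool" where
  "has_gradient_on S f G \<longleftrightarrow>
     (\<forall>x\<in>S. (f has_derivative (\<lambda>h. \<Sum>i\<in>UNIV. h $ i * G i x)) (at x)) \<and>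
     (\<forall>i. continuous_on S (G i))"

lemma partial_deriv_eq:
  assumes "(f has_derivative D) (at x)"
  shows "partial_deriv i f x = D (axis i 1)"
  using frechet_derivative_at[OF assms] by (simp add: partial_deriv_def)

lemma partial_deriv_cong:
  assumes "open S" "x \<in> S" "\<And>y. y \<in> S \<Longrightarrow> f y = g y"
  shows "partial_deriv i f x = partial_deriv i g x"
proof -
  have "(f has_derivative D) (at x) \<longleftrightarrow> (g has_derivative D) (at x)" for D
    using has_derivative_transform_within_open[of f D x UNIV S g]
      has_derivative_transform_within_open[of g D x UNIV S f] assms by auto
  then show ?thesis by (simp add: partial_deriv_def frechet_derivative_def)
qed

lemma C1_on_cong:
  assumes "open S" "\<And>y. y \<in> S \<Longrightarrow> f y = g y" "C1_on S f"
  shows "C1_on S g"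
proof -
  have "g differentiable (at x)" if "x \<in> S" for x
    using assms that has_derivative_transform_within_open[of f _ x UNIV S g]
    unfolding C1_on_def differentiable_def by blast
  moreover have "continuous_on S (partial_deriv i g)" for i
    using assms partial_deriv_cong[of S _ f g i]
    unfolding C1_on_def by (metis (no_types, lifting) continuous_on_eq)
  ultimately show ?thesis by (simp add: C1_on_def)
qed

lemma has_gradient_on_partial_deriv:
  assumes "has_gradient_on S f G" "x \<in> S"
  shows "partial_deriv i f x = G i x"
proof -
  have "partial_deriv i f x = (\<Sum>j\<in>UNIV. axis i 1 $ j * G j x)"
    using assms by (intro partial_deriv_eq) (auto simp: has_gradient_on_def)
  also have "\<dots> = (\<Sum>j\<in>UNIV. if j = i then G j x else 0)"
    by (intro sum.cong) (auto simp: axis_def)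
  finally show ?thesis by simp
qed

text \<open>Together with the converse below this identifies \<open>C1_on\<close> with the existence of a gradient: a linear
  map is determined by its values on the basis vectors.\<close>

lemma C1_on_has_gradient_on:
  assumes "C1_on S f"
  shows "has_gradient_on S f (\<lambda>i. partial_deriv i f)"
proof -
  have "(f has_derivative (\<lambda>h. \<Sum>i\<in>UNIV. h $ i * partial_deriv i f x)) (at x)" if "x \<in> S" for x
  proof -
    have D: "(f has_derivative frechet_derivative f (at x)) (at x)"
      using assms that frechet_derivative_works by (auto simp: C1_on_def)
    then interpret linear "frechet_derivative f (at x)"
      by (simp add: has_derivative_linear)
    have "frechet_derivative f (at x) h = (\<Sum>i\<in>UNIV. h $ i * partial_deriv i f x)" for h
    proof -
      have "frechet_derivative f (at x) h
          = frechet_derivative f (at x) (\<Sum>i\<in>UNIV. h $ i *\<^sub>R axis i 1)"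
        using basis_expansion[of h] by (simp add: scalar_mult_eq_scaleR)
      also have "\<dots> = (\<Sum>i\<in>UNIV. h $ i * partial_deriv i f x)"
        by (simp add: sum scale partial_deriv_def)
      finally show ?thesis .
    qed
    then show ?thesis using D by (metis (no_types, lifting) ext)
  qed
  then show ?thesis using assms by (auto simp: has_gradient_on_def C1_on_def)
qed

lemma has_gradient_on_C1_on:
  assumes "has_gradient_on S f G"
  shows "C1_on S f"
proof -
  have "continuous_on S (partial_deriv i f)" for i
    using assms has_gradient_on_partial_deriv[OF assms]
    unfolding has_gradient_on_def by (metis (no_types, lifting) continuous_on_eq)
  then show ?thesis
    using assms by (auto simp: has_gradient_on_def C1_on_def differentiable_def)
qed

lemma has_gradient_on_continuous: "has_gradient_on S f G \<Longrightarrow> continuous_on S f"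
  unfolding has_gradient_on_def
  by (meson continuous_at_imp_continuous_on has_derivative_continuous)

lemma has_gradient_on_const: "has_gradient_on S (\<lambda>_. c) (\<lambda>i _. 0)"
  by (simp add: has_gradient_on_def)

lemma has_gradient_on_nth:
  "has_gradient_on S (\<lambda>x. x $ j) (\<lambda>i _. if i = j then 1 else 0)"
proof -
  have "((\<lambda>x. x $ j) has_derivative (\<lambda>h. h $ j)) (at x)" for x :: "real ^ 'a"
    by (intro bounded_linear_imp_has_derivative bounded_linear_vec_nth)
  moreover have "(\<Sum>i\<in>UNIV. h $ i * (if i = j then 1 else 0)) = h $ j" for h :: "real ^ 'a"
    by (simp add: if_distrib cong: if_cong)
  ultimately show ?thesis by (simp add: has_gradient_on_def)
qed

lemma has_gradient_on_add:
  assumes "has_gradient_on S f F" "has_gradient_on S g G"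
  shows "has_gradient_on S (\<lambda>x. f x + g x) (\<lambda>i x. F i x + G i x)"
  using assms unfolding has_gradient_on_def
  by (auto intro!: continuous_intros derivative_eq_intros simp: sum.distrib algebra_simps)

lemma has_gradient_on_mult:
  assumes "has_gradient_on S f F" "has_gradient_on S g G"
  shows "has_gradient_on S (\<lambda>x. f x * g x) (\<lambda>i x. f x * G i x + g x * F i x)"
proof -
  have "((\<lambda>x. f x * g x) has_derivative (\<lambda>h. \<Sum>i\<in>UNIV. h $ i * (f x * G i x + g x * F i x))) (at x)"
    if "x \<in> S" for x
  proof -
    have "((\<lambda>x. f x * g x) has_derivative (\<lambda>h. f x * (\<Sum>i\<in>UNIV. h $ i * G i x)
       + (\<Sum>i\<in>UNIV. h $ i * F i x) * g x)) (at x)"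
      using assms that unfolding has_gradient_on_def by (intro has_derivative_mult) auto
    moreover have "f x * (\<Sum>i\<in>UNIV. h $ i * G i x) + (\<Sum>i\<in>UNIV. h $ i * F i x) * g x
       = (\<Sum>i\<in>UNIV. h $ i * (f x * G i x + g x * F i x))" for h
      by (simp add: sum_distrib_left sum_distrib_right sum.distrib[symmetric] algebra_simps)
    ultimately show ?thesis by simp
  qed
  then show ?thesis
    using assms has_gradient_on_continuous[OF assms(1)] has_gradient_on_continuous[OF assms(2)]
    by (auto simp: has_gradient_on_def intro!: continuous_intros)
qed

lemma has_gradient_on_sum:
  assumes "\<And>j. j \<in> J \<Longrightarrow> has_gradient_on S (f j) (G j)"
  shows "has_gradient_on S (\<lambda>x. \<Sum>j\<in>J. f j x) (\<lambda>i x. \<Sum>j\<in>J. G j i x)"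
proof (cases "finite J")
  case True
  then show ?thesis using assms
    by (induction J) (auto intro: has_gradient_on_const has_gradient_on_add)
qed (simp add: has_gradient_on_const)

lemma has_gradient_on_compose:
  assumes "has_gradient_on S g G"
    and "\<And>x. x \<in> S \<Longrightarrow> (\<phi> has_real_derivative \<phi>' (g x)) (at (g x))"
    and "continuous_on S (\<lambda>x. \<phi>' (g x))"
  shows "has_gradient_on S (\<lambda>x. \<phi> (g x)) (\<lambda>i x. \<phi>' (g x) * G i x)"
proof -
  have "((\<lambda>x. \<phi> (g x)) has_derivative (\<lambda>h. \<Sum>i\<in>UNIV. h $ i * (\<phi>' (g x) * G i x))) (at x)"
    if "x \<in> S" for x
  proof -
    have "((\<lambda>x. \<phi> (g x)) has_derivative (\<lambda>h. \<phi>' (g x) * (\<Sum>i\<in>UNIV. h $ i * G i x))) (at x)"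
      using has_derivative_compose[of g "\<lambda>h. \<Sum>i\<in>UNIV. h $ i * G i x" x UNIV \<phi> "(*) (\<phi>' (g x))"]
        assms that by (auto simp: has_gradient_on_def has_field_derivative_def)
    then show ?thesis by (simp add: sum_distrib_left algebra_simps)
  qed
  then show ?thesis using assms by (auto simp: has_gradient_on_def intro!: continuous_intros)
qed

definition has_hessian_on ::
  "(real ^ 'n) set \<Rightarrow> (real ^ 'n \<Rightarrow> real) \<Rightarrow> ('n \<Rightarrow> real ^ 'n \<Rightarrow> real)
    \<Rightarrow> ('n \<Rightarrow> 'n \<Rightarrow> real ^ 'n \<Rightarrow> real) \<Rightarrow> bool" where
  "has_hessian_on S f G H \<longleftrightarrow> has_gradient_on S f G \<and> (\<forall>i. has_gradient_on S (G i) (H i))"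

lemma C2_on_has_hessian_on:
  "C2_on S f \<Longrightarrow> has_hessian_on S f (\<lambda>i. partial_deriv i f) (\<lambda>i j. partial_deriv j (partial_deriv i f))"
  by (simp add: C2_on_def has_hessian_on_def C1_on_has_gradient_on)

lemma has_hessian_on_second_partial:
  assumes "has_hessian_on S f G H" "open S" "x \<in> S"
  shows "partial_deriv j (partial_deriv i f) x = H i j x"
proof -
  have "partial_deriv j (partial_deriv i f) x = partial_deriv j (G i) x"
    using assms has_gradient_on_partial_deriv[of S f G]
    by (intro partial_deriv_cong[of S]) (auto simp: has_hessian_on_def)
  also have "\<dots> = H i j x"
    using assms has_gradient_on_partial_deriv[of S "G i" "H i"] by (auto simp: has_hessian_on_def)
  finally show ?thesis .
qed

lemma has_hessian_on_C2_on:
  assumes "has_hessian_on S f G H" "open S"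
  shows "C2_on S f"
proof -
  have "C1_on S (partial_deriv i f)" for i
  proof (rule C1_on_cong[of S "G i"])
    show "C1_on S (G i)" using assms has_gradient_on_C1_on unfolding has_hessian_on_def by blast
    show "G i y = partial_deriv i f y" if "y \<in> S" for y
      using has_gradient_on_partial_deriv[of S f G y i] assms that by (auto simp: has_hessian_on_def)
  qed (use assms in auto)
  then show ?thesis
    using assms has_gradient_on_C1_on unfolding C2_on_def has_hessian_on_def by blast
qed

lemma has_hessian_on_hyp_laplacian:
  fixes f :: "real ^ 'n \<Rightarrow> real"
  assumes "has_hessian_on S f G H" "open S" "x \<in> S"
  shows "hyp_laplacian f x = (1 - (norm x)\<^sup>2)\<^sup>2 * (\<Sum>i\<in>UNIV. H i i x)
     + 2 * (real CARD('n) - 2) * (1 - (norm x)\<^sup>2) * (\<Sum>i\<in>UNIV. x $ i * G i x)"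
  using has_hessian_on_second_partial[OF assms]
    has_gradient_on_partial_deriv[of S f G x] assms
  by (simp add: hyp_laplacian_def laplacian_def has_hessian_on_def)

lemma has_hessian_on_const: "has_hessian_on S (\<lambda>_. c) (\<lambda>i _. 0) (\<lambda>i j _. 0)"
  by (simp add: has_hessian_on_def has_gradient_on_const)

lemma has_hessian_on_add:
  assumes "has_hessian_on S f F F'" "has_hessian_on S g G G'"
  shows "has_hessian_on S (\<lambda>x. f x + g x) (\<lambda>i x. F i x + G i x) (\<lambda>i j x. F' i j x + G' i j x)"
  using assms by (simp add: has_hessian_on_def has_gradient_on_add)

lemma has_hessian_on_mult:
  assumes "has_hessian_on S f F F'" "has_hessian_on S g G G'"
  shows "has_hessian_on S (\<lambda>x. f x * g x) (\<lambda>i x. f x * G i x + g x * F i x)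
     (\<lambda>i j x. (f x * G' i j x + G i x * F j x) + (g x * F' i j x + F i x * G j x))"
  using assms by (simp add: has_hessian_on_def has_gradient_on_add has_gradient_on_mult)

lemma has_hessian_on_compose:
  assumes "has_hessian_on S g G H"
    and "\<And>x. x \<in> S \<Longrightarrow> (\<phi> has_real_derivative \<phi>' (g x)) (at (g x))"
    and "\<And>x. x \<in> S \<Longrightarrow> (\<phi>' has_real_derivative \<phi>'' (g x)) (at (g x))"
    and "continuous_on S (\<lambda>x. \<phi>'' (g x))"
  shows "has_hessian_on S (\<lambda>x. \<phi> (g x)) (\<lambda>i x. \<phi>' (g x) * G i x)
     (\<lambda>i j x. \<phi>' (g x) * H i j x + G i x * (\<phi>'' (g x) * G j x))"
proof -
  have g: "has_gradient_on S g G" using assms by (simp add: has_hessian_on_def)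
  have 2: "has_gradient_on S (\<lambda>x. \<phi>' (g x)) (\<lambda>i x. \<phi>'' (g x) * G i x)"
    by (rule has_gradient_on_compose[OF g assms(3,4)])
  have "has_gradient_on S (\<lambda>x. \<phi> (g x)) (\<lambda>i x. \<phi>' (g x) * G i x)"
    by (rule has_gradient_on_compose[OF g assms(2) has_gradient_on_continuous[OF 2]])
  moreover have "has_gradient_on S (\<lambda>x. \<phi>' (g x) * G i x)
      (\<lambda>j x. \<phi>' (g x) * H i j x + G i x * (\<phi>'' (g x) * G j x))" for i
    using has_gradient_on_mult[OF 2] assms(1) by (simp add: has_hessian_on_def)
  ultimately show ?thesis by (simp add: has_hessian_on_def)
qed

lemma has_hessian_on_sqdist:
  fixes a :: "real ^ 'n"
  shows "has_hessian_on S (\<lambda>y. (norm (y - a))\<^sup>2) (\<lambda>i y. 2 * (y $ i - a $ i))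
    (\<lambda>i j _. if i = j then 2 else 0)"
proof -
  have 1: "has_gradient_on S (\<lambda>y. y $ j + (- a $ j)) (\<lambda>i _. (if i = j then 1 else 0) + 0)" for j
    by (intro has_gradient_on_add has_gradient_on_nth has_gradient_on_const)
  have "has_gradient_on S (\<lambda>y. \<Sum>j\<in>UNIV. (y $ j + (- a $ j)) * (y $ j + (- a $ j)))
     (\<lambda>i y. \<Sum>j\<in>UNIV. (y $ j + (- a $ j)) * ((if i = j then 1 else 0) + 0)
        + (y $ j + (- a $ j)) * ((if i = j then 1 else 0) + 0))"
    by (intro has_gradient_on_sum has_gradient_on_mult 1)
  moreover have "(\<Sum>j\<in>UNIV. (y $ j + (- a $ j)) * (y $ j + (- a $ j))) = (norm (y - a))\<^sup>2" for y
    by (simp add: norm_vec_def L2_set_def sum_nonneg power2_eq_square)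
  moreover have "(\<Sum>j\<in>UNIV. (y $ j + (- a $ j)) * ((if i = j then 1 else 0) + 0)
        + (y $ j + (- a $ j)) * ((if i = j then 1 else 0) + 0)) = 2 * (y $ i - a $ i)" for i y
  proof -
    have "(\<Sum>j\<in>UNIV. (y $ j + (- a $ j)) * ((if i = j then 1 else 0) + 0)
        + (y $ j + (- a $ j)) * ((if i = j then 1 else 0) + 0))
      = (\<Sum>j\<in>UNIV. if i = j then 2 * (y $ j - a $ j) else 0)"
      by (intro sum.cong) auto
    then show ?thesis by simp
  qed
  ultimately have g: "has_gradient_on S (\<lambda>y. (norm (y - a))\<^sup>2) (\<lambda>i y. 2 * (y $ i - a $ i))"
    by simp
  have "has_gradient_on S (\<lambda>y. 2 * (y $ i + (- a $ i)))
      (\<lambda>j y. 2 * ((if j = i then 1 else 0) + 0) + (y $ i + (- a $ i)) * 0)" for i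
    by (intro has_gradient_on_mult has_gradient_on_const 1)
  moreover have "(\<lambda>j y. 2 * ((if j = i then 1 else 0) + 0) + (y $ i + (- a $ i)) * 0)
      = (\<lambda>j (y :: real ^ 'n). if i = j then 2 else (0 :: real))" for i
    by (intro ext) auto
  ultimately have "has_gradient_on S (\<lambda>y. 2 * (y $ i - a $ i)) (\<lambda>j y. if i = j then 2 else 0)" for i
    by simp
  then show ?thesis using g by (simp add: has_hessian_on_def)
qed

section \<open>The hyperbolic Laplacian of radial functions and Green's formula\<close>

text \<open>By polarisation \<open>y \<bullet> (y - x) = (|y-x|\<^sup>2 + |y|\<^sup>2 - |x|\<^sup>2) / 2\<close>. All traces and inner products in
  the computations of \<open>\<Delta>\<^sub>h\<close> are sums of this form.\<close>

lemma sum_quadratic: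
  fixes y x :: "real ^ 'n"
  shows "(\<Sum>i\<in>UNIV. p * (y $ i)\<^sup>2 + q * (y $ i * (y $ i - x $ i)) + r * (y $ i - x $ i)\<^sup>2 + t)
    = p * (norm y)\<^sup>2 + q * (((norm (y - x))\<^sup>2 + (norm y)\<^sup>2 - (norm x)\<^sup>2) / 2)
      + r * (norm (y - x))\<^sup>2 + real CARD('n) * t"
proof -
  have N: "(norm z)\<^sup>2 = (\<Sum>i\<in>UNIV. (z $ i)\<^sup>2)" for z :: "real ^ 'n"
    by (simp add: norm_vec_def L2_set_def sum_nonneg)
  have J: "((norm (y - x))\<^sup>2 + (norm y)\<^sup>2 - (norm x)\<^sup>2) / 2 = (\<Sum>i\<in>UNIV. y $ i * (y $ i - x $ i))"
    unfolding N sum.distrib[symmetric] sum_subtractf[symmetric] sum_divide_distrib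
    by (intro sum.cong) (auto simp: power2_eq_square field_simps)
  show ?thesis
    unfolding J unfolding N by (simp add: sum.distrib sum_distrib_left)
qed

text \<open>The hyperbolic metric is \<open>|dx| / wt\<close>. Hence \<open>wt x\<close> is, up to a constant, both the distance of
  \<open>x\<close> to the sphere and the Euclidean size of the hyperbolic unit ball about \<open>x\<close>.\<close>

definition wt :: "real ^ 'n \<Rightarrow> real" where
  "wt y = 1 - (norm y)\<^sup>2"

lemma wt_pos: "y \<in> ball 0 1 \<Longrightarrow> 0 < wt y"
  by (simp add: wt_def power_less_one_iff)

lemma wt_nonzero: "y \<in> ball 0 1 \<Longrightarrow> wt y \<noteq> 0"
  using wt_pos[of y] by simp

lemma wt_le_1: "wt y \<le> 1"
  by (simp add: wt_def)

lemma has_hessian_on_wt: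
  "has_hessian_on S (wt :: real ^ 'n \<Rightarrow> real) (\<lambda>i y. - 2 * y $ i) (\<lambda>i j y. if i = j then - 2 else 0)"
proof -
  have "has_hessian_on S (\<lambda>y :: real ^ 'n. 1 + (- 1) * (norm (y - 0))\<^sup>2)
     (\<lambda>i y. 0 + ((- 1) * (2 * (y $ i - 0 $ i)) + (norm (y - 0))\<^sup>2 * 0))
     (\<lambda>i j y. 0 + (((- 1) * (if i = j then 2 else 0) + 2 * (y $ i - 0 $ i) * 0)
        + ((norm (y - 0))\<^sup>2 * 0 + 0 * (2 * (y $ j - 0 $ j)))))"
    by (intro has_hessian_on_add has_hessian_on_mult has_hessian_on_const has_hessian_on_sqdist)
  moreover have "(\<lambda>i j (y :: real ^ 'n). 0 + (((- 1) * (if i = j then 2 else 0) + 2 * (y $ i - 0 $ i) * 0)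
        + ((norm (y - 0))\<^sup>2 * 0 + 0 * (2 * (y $ j - 0 $ j)))))
      = (\<lambda>i j y. if i = j then - 2 else (0::real))"
    by (intro ext) auto
  moreover have "wt = (\<lambda>y :: real ^ 'n. 1 + (- 1) * (norm (y - 0))\<^sup>2)"
    by (auto simp: wt_def)
  ultimately show ?thesis by simp
qed

lemma continuous_on_wt: "continuous_on S wt"
  unfolding wt_def by (intro continuous_intros)

text \<open>The square of \<open>sinh\<close> of the distance for the metric \<open>|dx| / wt\<close>: for \<open>x = 0\<close> that
  distance is \<open>artanh |y|\<close>. It is a rational function that is smooth at \<open>y = x\<close>.\<close>

definition sinh2_dist :: "real ^ 'n \<Rightarrow> real ^ 'n \<Rightarrow> real" where
  "sinh2_dist x y = (norm (y - x))\<^sup>2 / (wt x * wt y)"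

text \<open>The chain rule reduces the claim to \<open>wt\<^sup>2 |\<nabla>\<rho>|\<^sup>2 = 4\<rho>(1+\<rho>)\<close> and \<open>\<Delta>\<^sub>h \<rho> = 2n(1+2\<rho>)\<close> for
  \<open>\<rho> = sinh2_dist x\<close>, which are direct computations.\<close>

lemma hyp_laplacian_radial:
  fixes x :: "real ^ 'n" and e e' e'' :: "real \<Rightarrow> real"
  assumes x: "x \<in> ball 0 1"
    and e: "\<And>t. 0 \<le> t \<Longrightarrow> (e has_real_derivative e' t) (at t)"
    and e': "\<And>t. 0 \<le> t \<Longrightarrow> (e' has_real_derivative e'' t) (at t)"
    and e'': "continuous_on {0..} e''"
  shows "C2_on (ball 0 1) (\<lambda>y. e (sinh2_dist x y))"
    and "y \<in> ball 0 1 \<Longrightarrow> hyp_laplacian (\<lambda>y. e (sinh2_dist x y)) y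
      = 4 * (sinh2_dist x y * (1 + sinh2_dist x y)) * e'' (sinh2_dist x y)
        + 2 * real CARD('n) * (1 + 2 * sinh2_dist x y) * e' (sinh2_dist x y)"
proof -
  let ?B = "ball 0 1 :: (real ^ 'n) set"
  have inv: "has_hessian_on ?B (\<lambda>y. inverse (wt y)) (\<lambda>i y. - (1 / (wt y)\<^sup>2) * (- 2 * y $ i))
    (\<lambda>i j y. - (1 / (wt y)\<^sup>2) * (if i = j then - 2 else 0) + (- 2 * y $ i) * (2 / (wt y) ^ 3 * (- 2 * y $ j)))"
  proof (rule has_hessian_on_compose[OF has_hessian_on_wt])
    fix y :: "real ^ 'n" assume "y \<in> ?B"
    then have p: "wt y \<noteq> 0" using wt_pos[of y] by auto
    show "(inverse has_real_derivative - (1 / (wt y)\<^sup>2)) (at (wt y))"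
      using p by (auto intro!: derivative_eq_intros simp: power2_eq_square field_simps)
    show "((\<lambda>t. - (1 / t\<^sup>2)) has_real_derivative 2 / wt y ^ 3) (at (wt y))"
      using p by (auto intro!: derivative_eq_intros simp: power2_eq_square power3_eq_cube field_simps)
  next
    show "continuous_on ?B (\<lambda>x. 2 / wt x ^ 3)"
      by (intro continuous_intros continuous_on_wt) (auto dest: wt_nonzero)
  qed
  let ?G = "\<lambda>i y. 1 / wt x * ((norm (y - x))\<^sup>2 * (- (1 / (wt y)\<^sup>2) * (- 2 * y $ i))
      + inverse (wt y) * (2 * (y $ i - x $ i))) + ((norm (y - x))\<^sup>2 * inverse (wt y)) * 0"
  note rho1 = has_hessian_on_mult[OF has_hessian_on_const[of ?B "1 / wt x"]
      has_hessian_on_mult[OF has_hessian_on_sqdist[of ?B x] inv]]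
  moreover have eq: "(\<lambda>y. 1 / wt x * ((norm (y - x))\<^sup>2 * inverse (wt y))) = sinh2_dist x"
    by (auto simp: sinh2_dist_def fun_eq_iff divide_simps)
  ultimately obtain H where rho: "has_hessian_on ?B (sinh2_dist x) ?G H" and
     H: "H = (\<lambda>i j y. 1 / wt x *
         ((norm (y - x))\<^sup>2 *
          (- (1 / (wt y)\<^sup>2) * (if i = j then - 2 else 0) +
           - 2 * y $ i * (2 / wt y ^ 3 * (- 2 * y $ j))) +
          - (1 / (wt y)\<^sup>2) * (- 2 * y $ i) * (2 * (y $ j - x $ j)) +
          (inverse (wt y) * (if i = j then 2 else 0) +
           2 * (y $ i - x $ i) * (- (1 / (wt y)\<^sup>2) * (- 2 * y $ j)))) +
         ((norm (y - x))\<^sup>2 * (- (1 / (wt y)\<^sup>2) * (- 2 * y $ i)) +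
          inverse (wt y) * (2 * (y $ i - x $ i))) * 0 +
         ((norm (y - x))\<^sup>2 * inverse (wt y) * 0 +
          0 * ((norm (y - x))\<^sup>2 * (- (1 / (wt y)\<^sup>2) * (- 2 * y $ j)) +
           inverse (wt y) * (2 * (y $ j - x $ j)))))"
    by simp
  have nn: "0 \<le> sinh2_dist x y" if "y \<in> ?B" for y
    using wt_pos[OF that] wt_pos[OF x] by (simp add: sinh2_dist_def)
  have hess: "has_hessian_on ?B (\<lambda>y. e (sinh2_dist x y)) (\<lambda>i y. e' (sinh2_dist x y) * ?G i y)
     (\<lambda>i j y. e' (sinh2_dist x y) * H i j y + ?G i y * (e'' (sinh2_dist x y) * ?G j y))"
  proof (rule has_hessian_on_compose[OF rho])
    have "continuous_on ?B (sinh2_dist x)"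
      using rho has_gradient_on_continuous by (auto simp: has_hessian_on_def)
    then show "continuous_on ?B (\<lambda>y. e'' (sinh2_dist x y))"
      by (rule continuous_on_compose2[OF e'']) (use nn in auto)
  qed (use e e' nn in auto)
  then show "C2_on ?B (\<lambda>y. e (sinh2_dist x y))" using has_hessian_on_C2_on by blast
  show "hyp_laplacian (\<lambda>y. e (sinh2_dist x y)) y
      = 4 * (sinh2_dist x y * (1 + sinh2_dist x y)) * e'' (sinh2_dist x y)
        + 2 * real CARD('n) * (1 + 2 * sinh2_dist x y) * e' (sinh2_dist x y)" if y: "y \<in> ?B"
  proof -
    let ?t = "sinh2_dist x y"
    define w W D where d: "w = wt y" "W = wt x" "D = (norm (y - x))\<^sup>2"
    have pos: "w > 0" "W > 0" using wt_pos x y by (auto simp: d)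
    have ny: "(norm y)\<^sup>2 = 1 - w" and nx: "(norm x)\<^sup>2 = 1 - W" by (auto simp: d wt_def)
    have r: "?t = D / (W * w)" by (simp add: sinh2_dist_def d)
    have G: "?G i y = (2 * D / (W * w\<^sup>2)) * y $ i + (2 / (W * w)) * (y $ i - x $ i)" for i
      unfolding d[symmetric] using pos by (simp add: field_simps power2_eq_square)
    have sq: "(p * a + q * b)\<^sup>2 = p\<^sup>2 * a\<^sup>2 + (2 * p * q) * (a * b) + q\<^sup>2 * b\<^sup>2 + 0"
      and sq': "a * (p * a + q * b) = p * a\<^sup>2 + q * (a * b) + 0 * b\<^sup>2 + 0" for a b p q :: real
      by (auto simp: power2_eq_square algebra_simps)
    have GG: "(?G i y)\<^sup>2 = (2 * D / (W * w\<^sup>2))\<^sup>2 * (y $ i)\<^sup>2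
        + (2 * (2 * D / (W * w\<^sup>2)) * (2 / (W * w))) * (y $ i * (y $ i - x $ i))
        + (2 / (W * w))\<^sup>2 * (y $ i - x $ i)\<^sup>2 + 0" for i
      unfolding G by (rule sq)
    have sG: "(\<Sum>i\<in>UNIV. (?G i y)\<^sup>2) * w\<^sup>2 = 4 * (?t * (1 + ?t))"
    proof -
      have eq: "(\<Sum>i\<in>UNIV. (?G i y)\<^sup>2) = (2 * D / (W * w\<^sup>2))\<^sup>2 * (1 - w)
        + (2 * (2 * D / (W * w\<^sup>2)) * (2 / (W * w))) * ((D + (1 - w) - (1 - W)) / 2)
        + (2 / (W * w))\<^sup>2 * D"
        unfolding GG unfolding sum_quadratic ny nx d(3)[symmetric] by simp
      show ?thesis unfolding eq r using pos by (simp add: field_simps power2_eq_square)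
    qed
    have yG: "y $ i * ?G i y = (2 * D / (W * w\<^sup>2)) * (y $ i)\<^sup>2
        + (2 / (W * w)) * (y $ i * (y $ i - x $ i)) + 0 * (y $ i - x $ i)\<^sup>2 + 0" for i
      unfolding G by (rule sq')
    have syG: "(\<Sum>i\<in>UNIV. y $ i * ?G i y) = (2 * D / (W * w\<^sup>2)) * (1 - w)
        + (2 / (W * w)) * ((D + (1 - w) - (1 - W)) / 2)"
      unfolding yG unfolding sum_quadratic ny nx d(3)[symmetric] by simp
    have HH: "H i i y = (8 * D / (W * w ^ 3)) * (y $ i)\<^sup>2
        + (8 / (W * w\<^sup>2)) * (y $ i * (y $ i - x $ i)) + 0 * (y $ i - x $ i)\<^sup>2
        + (2 * D / (W * w\<^sup>2) + 2 / (W * w))" for i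
      unfolding H d[symmetric] using pos
      by (simp add: field_simps power2_eq_square power3_eq_cube)
    have sH: "(\<Sum>i\<in>UNIV. H i i y) = (8 * D / (W * w ^ 3)) * (1 - w)
        + (8 / (W * w\<^sup>2)) * ((D + (1 - w) - (1 - W)) / 2)
        + real CARD('n) * (2 * D / (W * w\<^sup>2) + 2 / (W * w))"
      unfolding HH unfolding sum_quadratic ny nx d(3)[symmetric] by simp
    have L: "w\<^sup>2 * (\<Sum>i\<in>UNIV. H i i y) + 2 * (real CARD('n) - 2) * w * (\<Sum>i\<in>UNIV. y $ i * ?G i y)
       = 2 * real CARD('n) * (1 + 2 * ?t)"
      unfolding sH syG r using pos
      by (simp add: field_simps power2_eq_square power3_eq_cube)
    let ?n = "2 * (real CARD('n) - 2)"
    have "hyp_laplacian (\<lambda>y. e (sinh2_dist x y)) y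
       = w\<^sup>2 * (\<Sum>i\<in>UNIV. e' ?t * H i i y + ?G i y * (e'' ?t * ?G i y))
        + ?n * w * (\<Sum>i\<in>UNIV. y $ i * (e' ?t * ?G i y))"
      using has_hessian_on_hyp_laplacian[OF hess _ y] by (simp add: d wt_def)
    also have "(\<Sum>i\<in>UNIV. e' ?t * H i i y + ?G i y * (e'' ?t * ?G i y))
       = e' ?t * (\<Sum>i\<in>UNIV. H i i y) + e'' ?t * (\<Sum>i\<in>UNIV. (?G i y)\<^sup>2)"
      unfolding sum_distrib_left sum.distrib[symmetric] power2_eq_square
      by (intro sum.cong refl) (simp only: ac_simps)
    also have "(\<Sum>i\<in>UNIV. y $ i * (e' ?t * ?G i y)) = e' ?t * (\<Sum>i\<in>UNIV. y $ i * ?G i y)"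
      unfolding sum_distrib_left by (intro sum.cong refl) (simp only: ac_simps)
    also have "w\<^sup>2 * (e' ?t * (\<Sum>i\<in>UNIV. H i i y) + e'' ?t * (\<Sum>i\<in>UNIV. (?G i y)\<^sup>2))
        + ?n * w * (e' ?t * (\<Sum>i\<in>UNIV. y $ i * ?G i y))
      = e' ?t * (w\<^sup>2 * (\<Sum>i\<in>UNIV. H i i y) + ?n * w * (\<Sum>i\<in>UNIV. y $ i * ?G i y))
        + e'' ?t * ((\<Sum>i\<in>UNIV. (?G i y)\<^sup>2) * w\<^sup>2)"
      by (simp only: algebra_simps)
    finally show ?thesis unfolding sG L by simp
  qed
qed

lemma integral_compact_continuous:
  fixes f :: "real ^ 'n \<Rightarrow> real"
  assumes "compact K" "K \<subseteq> S" "continuous_on S f" "\<And>y. y \<in> S - K \<Longrightarrow> f y = 0"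
  shows "integrable lborel (\<lambda>y. indicator S y * f y)"
proof -
  have "integrable lborel (\<lambda>y. indicator K y *\<^sub>R f y)"
    using assms continuous_on_subset by (intro borel_integrable_compact) auto
  moreover have "(\<lambda>y. indicator K y *\<^sub>R f y) = (\<lambda>y. indicator S y * f y)"
    using assms by (auto simp: fun_eq_iff indicator_def)
  ultimately show ?thesis by simp
qed

text \<open>The integral of \<open>F(y + t e\<^sub>i) - F(y)\<close> vanishes by translation invariance; divide by \<open>t\<close> and
  pass to the limit by dominated convergence.\<close>

lemma integral_gradient_zero:
  fixes F :: "real ^ 'n \<Rightarrow> real"
  assumes S: "open S" and K: "compact K" "K \<subseteq> S" and F: "has_gradient_on S F G"
    and zero: "\<And>y. y \<in> S - K \<Longrightarrow> F y = 0"
  shows "integrable lborel (\<lambda>y. indicator S y * G i y)"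
    and "integral\<^sup>L lborel (\<lambda>y. indicator S y * G i y) = 0"
proof -
  have op: "open (S - K)" using S K compact_imp_closed by blast
  have Gz: "G j y = 0" if "y \<in> S - K" for y j
  proof -
    have "G j y = partial_deriv j F y" using has_gradient_on_partial_deriv[OF F] that by auto
    also have "\<dots> = partial_deriv j (\<lambda>_. 0) y"
      by (rule partial_deriv_cong[OF op that]) (use zero in auto)
    also have "\<dots> = 0"
      using has_gradient_on_partial_deriv[OF has_gradient_on_const[of UNIV]] by simp
    finally show ?thesis .
  qed
  have Gc: "continuous_on S (G j)" for j using F by (simp add: has_gradient_on_def)
  show int: "integrable lborel (\<lambda>y. indicator S y * G i y)"
    by (rule integral_compact_continuous[OF K Gc]) (use Gz in auto)
  \<comment> \<open>The extension by zero is differentiable everywhere: near a point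
    outside \<open>S\<close> it vanishes, as \<open>K\<close> is closed.\<close>
  define f where "f y = (if y \<in> S then F y else 0)" for y
  define D where "D y = indicator S y * G i y" for y
  let ?e = "axis i 1 :: real ^ 'n"
  have fint: "integrable lborel f"
  proof -
    have "integrable lborel (\<lambda>y. indicator S y * F y)"
      by (rule integral_compact_continuous[OF K has_gradient_on_continuous[OF F]]) (use zero in auto)
    moreover have "(\<lambda>y. indicator S y * F y) = f" by (auto simp: f_def indicator_def)
    ultimately show ?thesis by simp
  qed
  have der: "((\<lambda>t. f (y + t *\<^sub>R ?e)) has_real_derivative D (y + t *\<^sub>R ?e)) (at t)" for y t
  proof -
    let ?z = "y + t *\<^sub>R ?e"
    have "\<exists>f'. (f has_derivative f') (at ?z) \<and> f' ?e = D ?z"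
    proof (cases "?z \<in> S")
      case True
      have d: "(F has_derivative (\<lambda>h. \<Sum>j\<in>UNIV. h $ j * G j ?z)) (at ?z)"
        using F True by (simp add: has_gradient_on_def)
      have "(f has_derivative (\<lambda>h. \<Sum>j\<in>UNIV. h $ j * G j ?z)) (at ?z)"
        by (rule has_derivative_transform_within_open[OF d S True]) (simp add: f_def)
      moreover have "(\<Sum>j\<in>UNIV. ?e $ j * G j ?z) = (\<Sum>j\<in>UNIV. if j = i then G j ?z else 0)"
        by (intro sum.cong) (auto simp: axis_def)
      ultimately show ?thesis using True
        by (intro exI[of _ "\<lambda>h. \<Sum>j\<in>UNIV. h $ j * G j ?z"]) (auto simp: D_def)
    next
      case False
      then have z: "?z \<in> - K" using K by auto
      have "((\<lambda>_. 0) has_derivative (\<lambda>_. 0)) (at ?z)" by simp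
      then have "(f has_derivative (\<lambda>_. 0)) (at ?z)"
        by (rule has_derivative_transform_within_open[where s="- K"])
          (use z K compact_imp_closed zero in \<open>auto simp: f_def\<close>)
      then show ?thesis using False by (intro exI[of _ "\<lambda>_. 0"]) (auto simp: D_def)
    qed
    then obtain f' where f': "(f has_derivative f') (at ?z)" "f' ?e = D ?z" by blast
    have "((\<lambda>t. f (y + t *\<^sub>R ?e)) has_derivative (\<lambda>h. f' (h *\<^sub>R ?e))) (at t)"
      by (rule has_derivative_compose[of "\<lambda>t. y + t *\<^sub>R ?e" "\<lambda>h. h *\<^sub>R ?e" t UNIV f f'])
        (use f' in \<open>auto intro!: derivative_eq_intros\<close>)
    moreover have "f' (h *\<^sub>R ?e) = D ?z * h" for h
      using f' has_derivative_linear[OF f'(1)] by (simp add: linear_cmul)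
    ultimately show ?thesis by (simp add: has_field_derivative_def)
  qed
  obtain B where B: "\<And>y. \<bar>D y\<bar> \<le> B" "0 \<le> B"
  proof -
    have "bounded (G i ` K)"
      using K(1) continuous_on_subset[OF Gc K(2)]
      by (intro compact_imp_bounded compact_continuous_image) auto
    then obtain B where B: "\<And>y. y \<in> K \<Longrightarrow> \<bar>G i y\<bar> \<le> B" by (auto simp: bounded_iff)
    have "\<bar>D y\<bar> \<le> max B 0" for y
      using B[of y] Gz[of y i] by (cases "y \<in> S"; cases "y \<in> K") (auto simp: D_def)
    then show ?thesis using that[of "max B 0"] by simp
  qed
  define q where "q m y = (f (y + (1 / real (Suc m)) *\<^sub>R ?e) - f y) * real (Suc m)" for m y
  have shift: "integrable lborel (\<lambda>y. f (y + c))" "integral\<^sup>L lborel (\<lambda>y. f (y + c)) = integral\<^sup>L lborel f" for c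
  proof -
    have l: "distr lborel borel ((+) c) = (lborel :: (real ^ 'n) measure)" by (rule lborel_distr_plus)
    show "integrable lborel (\<lambda>y. f (y + c))"
      using integrable_distr[of "(+) c" lborel borel f] fint l by (simp add: add.commute)
    have "integral\<^sup>L (distr lborel borel ((+) c)) f = integral\<^sup>L lborel (\<lambda>y. f (c + y))"
      by (rule integral_distr) (use fint in \<open>auto simp: borel_measurable_integrable\<close>)
    then show "integral\<^sup>L lborel (\<lambda>y. f (y + c)) = integral\<^sup>L lborel f"
      using l by (simp add: add.commute)
  qed
  have q0: "integral\<^sup>L lborel (q m) = 0" for m
    unfolding q_def using shift fint by simp
  have qlim: "(\<lambda>m. q m y) \<longlonglongrightarrow> D y" for y
  proof -
    have "((\<lambda>h. (f (y + h *\<^sub>R ?e) - f y) / h) \<longlongrightarrow> D y) (at 0)"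
      using der[of y 0] by (simp add: DERIV_def)
    moreover have "filterlim (\<lambda>m. 1 / real (Suc m)) (at 0) sequentially"
      unfolding filterlim_at using LIMSEQ_inverse_real_of_nat by (simp add: inverse_eq_divide)
    ultimately have "(\<lambda>m. (f (y + (1 / real (Suc m)) *\<^sub>R ?e) - f y) / (1 / real (Suc m))) \<longlonglongrightarrow> D y"
      by (rule filterlim_compose)
    then show ?thesis by (simp add: q_def)
  qed
  obtain R where R: "\<And>y. y \<in> K \<Longrightarrow> norm y \<le> R"
    using compact_imp_bounded[OF K(1)] by (auto simp: bounded_iff)
  have qb: "norm (q m y) \<le> B * indicator (cball 0 (R + 1)) y" for m y
  proof (cases "y \<in> cball 0 (R + 1)")
    case True
    let ?h = "1 / real (Suc m)"
    have "\<exists>t. 0 < t \<and> t < ?h \<and> f (y + ?h *\<^sub>R ?e) - f (y + 0 *\<^sub>R ?e) = (?h - 0) * D (y + t *\<^sub>R ?e)"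
      by (rule MVT2) (use der in auto)
    then obtain t where "f (y + ?h *\<^sub>R ?e) - f y = ?h * D (y + t *\<^sub>R ?e)" by auto
    then have "q m y = D (y + t *\<^sub>R ?e)" by (simp add: q_def)
    then show ?thesis using B True by simp
  next
    case False
    have nz: "f z = 0" if "R < norm z" for z
      using R[of z] zero[of z] that by (auto simp: f_def)
    have n1: "norm ((1 / real (Suc m)) *\<^sub>R ?e) \<le> 1" by (simp add: norm_axis_1)
    have "norm y \<le> norm (y + (1 / real (Suc m)) *\<^sub>R ?e) + norm ((1 / real (Suc m)) *\<^sub>R ?e)"
      by (metis add_diff_cancel_right' norm_triangle_ineq4)
    with n1 False have "R < norm y" "R < norm (y + (1 / real (Suc m)) *\<^sub>R ?e)"
      by (simp_all only: mem_cball dist_0_norm not_le)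
    then show ?thesis using nz False by (simp add: q_def)
  qed
  have "(\<lambda>m. integral\<^sup>L lborel (q m)) \<longlonglongrightarrow> integral\<^sup>L lborel D"
  proof (rule integral_dominated_convergence[where w="\<lambda>y. B * indicator (cball 0 (R + 1)) y"])
    show "D \<in> borel_measurable lborel"
      using borel_measurable_integrable[OF int] unfolding D_def[abs_def] by simp
    show "q m \<in> borel_measurable lborel" for m
      unfolding q_def[abs_def] using borel_measurable_integrable[OF shift(1)]
        borel_measurable_integrable[OF fint] by (intro borel_measurable_times borel_measurable_diff) auto
    have "integrable lborel (indicator (cball 0 (R + 1)) :: real ^ 'n \<Rightarrow> real)"
      using emeasure_lborel_cball_finite by (intro integrable_real_indicator) auto
    then show "integrable lborel (\<lambda>y :: real ^ 'n. B * indicator (cball 0 (R + 1)) y)" by simp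
    show "AE y in lborel. (\<lambda>m. q m y) \<longlonglongrightarrow> D y" using qlim by simp
    show "AE y in lborel. norm (q m y) \<le> B * indicator (cball 0 (R + 1)) y" for m
      using qb by simp
  qed
  then show "integral\<^sup>L lborel (\<lambda>y. indicator S y * G i y) = 0"
    using q0 LIMSEQ_unique[of "\<lambda>_. 0::real"] by (auto simp: D_def[abs_def])
qed

text \<open>\<open>\<Delta>\<^sub>h v = w^n div(w^(2-n) \<nabla>v)\<close>, so the integrand is the divergence of the compactly supported
  field \<open>w^(2-n) (u \<nabla>v - v \<nabla>u)\<close>.\<close>

lemma green_identity:
  fixes u v :: "real ^ 'n \<Rightarrow> real"
  assumes n: "CARD('n) \<ge> 3" and u: "C2_on (ball 0 1) u" and v: "C2_on (ball 0 1) v"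
    and K: "compact K" "K \<subseteq> ball 0 1" and zero: "\<And>y. y \<in> ball 0 1 - K \<Longrightarrow> v y = 0"
  shows "integral\<^sup>L lborel (\<lambda>y. indicator (ball 0 1) y *
      ((u y * hyp_laplacian v y - v y * hyp_laplacian u y) / wt y ^ CARD('n))) = 0"
proof -
  let ?B = "ball 0 1 :: (real ^ 'n) set"
  obtain m where m: "CARD('n) = m + 3" using n by (metis add.commute le_Suc_ex)
  let ?z = "\<lambda>y :: real ^ 'n. 1 / wt y ^ (m + 1)"
  let ?z' = "\<lambda>i (y :: real ^ 'n). - real (m + 1) / wt y ^ (m + 2) * (- 2 * y $ i)"
  have z: "has_gradient_on ?B ?z ?z'"
  proof (rule has_gradient_on_compose[where \<phi>="\<lambda>t. 1 / t ^ (m + 1)" and \<phi>'="\<lambda>t. - real (m + 1) / t ^ (m + 2)"])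
    show "has_gradient_on ?B wt (\<lambda>i y. - 2 * y $ i)"
      using has_hessian_on_wt by (auto simp: has_hessian_on_def)
    fix y :: "real ^ 'n" assume "y \<in> ?B"
    then have p: "wt y \<noteq> 0" using wt_pos[of y] by auto
    have "((\<lambda>t. inverse t ^ Suc m) has_real_derivative
       (1 + real m) * (- (inverse (wt y) ^ Suc (Suc 0)) * inverse (wt y) ^ m)) (at (wt y))"
      by (rule DERIV_power_Suc[OF DERIV_inverse[OF p]])
    moreover have "(1 + real m) * (- (inverse (wt y) ^ Suc (Suc 0)) * inverse (wt y) ^ m)
       = - real (m + 1) / wt y ^ (m + 2)"
      by (simp add: divide_inverse power_inverse algebra_simps)
    moreover have "(\<lambda>t. inverse t ^ Suc m) = (\<lambda>t :: real. 1 / t ^ (m + 1))"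
      by (simp add: fun_eq_iff divide_inverse power_inverse)
    ultimately show "((\<lambda>t. 1 / t ^ (m + 1)) has_real_derivative - real (m + 1) / wt y ^ (m + 2)) (at (wt y))"
      by metis
  next
    show "continuous_on ?B (\<lambda>y. - real (m + 1) / wt y ^ (m + 2))"
      by (intro continuous_intros continuous_on_wt) (auto dest: wt_nonzero)
  qed
  define U where "U i = partial_deriv i u" for i
  define V where "V i = partial_deriv i v" for i
  define U' where "U' i j = partial_deriv j (partial_deriv i u)" for i j
  define V' where "V' i j = partial_deriv j (partial_deriv i v)" for i j
  have hu: "has_hessian_on ?B u U U'" and hv: "has_hessian_on ?B v V V'"
    using C2_on_has_hessian_on[OF u] C2_on_has_hessian_on[OF v]
    by (simp_all add: U_def[abs_def] V_def[abs_def] U'_def[abs_def] V'_def[abs_def])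
  have gu: "has_gradient_on ?B u U" "has_gradient_on ?B (U i) (U' i)"
    and gv: "has_gradient_on ?B v V" "has_gradient_on ?B (V i) (V' i)" for i
    using hu hv by (auto simp: has_hessian_on_def)
  have Vz: "V i y = 0" if "y \<in> ?B - K" for i y
  proof -
    have "open (?B - K)" using K compact_imp_closed by blast
    then have "V i y = partial_deriv i (\<lambda>_. 0) y"
      unfolding V_def by (rule partial_deriv_cong[OF _ that]) (use zero in auto)
    also have "\<dots> = 0"
      using has_gradient_on_partial_deriv[OF has_gradient_on_const[of UNIV]] by simp
    finally show ?thesis .
  qed
  let ?F = "\<lambda>i y. ?z y * (u y * V i y + (- 1) * (v y * U i y))"
  let ?F' = "\<lambda>i j y. ?z y * ((u y * V' i j y + V i y * U j y)
      + ((- 1) * (v y * U' i j y + U i y * V j y) + (v y * U i y) * 0))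
      + (u y * V i y + (- 1) * (v y * U i y)) * ?z' j y"
  have F: "has_gradient_on ?B (?F i) (?F' i)" for i
    by (intro has_gradient_on_mult has_gradient_on_add has_gradient_on_const z gu gv)
  have Fz: "?F i y = 0" if "y \<in> ?B - K" for i y
    using zero[OF that] Vz[OF that] by simp
  note I = integral_gradient_zero[OF _ K F Fz]
  have "integral\<^sup>L lborel (\<lambda>y. \<Sum>i\<in>UNIV. indicator ?B y * ?F' i i y)
      = (\<Sum>i\<in>UNIV. integral\<^sup>L lborel (\<lambda>y. indicator ?B y * ?F' i i y))"
    by (rule Bochner_Integration.integral_sum) (rule I(1), simp)
  also have "\<dots> = (\<Sum>i\<in>(UNIV :: 'n set). 0)"
    by (rule sum.cong[OF refl]) (rule I(2), simp)
  finally have "integral\<^sup>L lborel (\<lambda>y. \<Sum>i\<in>UNIV. indicator ?B y * ?F' i i y) = 0"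
    by simp
  moreover have "(\<Sum>i\<in>UNIV. indicator ?B y * ?F' i i y) = indicator ?B y *
      ((u y * hyp_laplacian v y - v y * hyp_laplacian u y) / wt y ^ CARD('n))" for y
  proof (cases "y \<in> ?B")
    case True
    define w where "w = wt y"
    have w: "w > 0" using True wt_pos by (simp add: w_def)
    have F'eq: "?F' i i y = (1 / w ^ (m + 1)) * (u y * V' i i y - v y * U' i i y)
        + (2 * real (m + 1) / w ^ (m + 2)) * (u y * (y $ i * V i y) - v y * (y $ i * U i y))" for i
      unfolding w_def[symmetric] using w by (simp add: field_simps)
    have "(\<Sum>i\<in>UNIV. ?F' i i y) = (1 / w ^ (m + 1)) * (u y * (\<Sum>i\<in>UNIV. V' i i y) - v y * (\<Sum>i\<in>UNIV. U' i i y))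
        + (2 * real (m + 1) / w ^ (m + 2)) * (u y * (\<Sum>i\<in>UNIV. y $ i * V i y) - v y * (\<Sum>i\<in>UNIV. y $ i * U i y))"
      unfolding F'eq by (simp only: sum.distrib sum_subtractf sum_distrib_left[symmetric])
    also have "\<dots> = (u y * (w\<^sup>2 * (\<Sum>i\<in>UNIV. V' i i y) + 2 * real (m + 1) * w * (\<Sum>i\<in>UNIV. y $ i * V i y))
       - v y * (w\<^sup>2 * (\<Sum>i\<in>UNIV. U' i i y) + 2 * real (m + 1) * w * (\<Sum>i\<in>UNIV. y $ i * U i y))) / w ^ (m + 3)"
      using w by (simp add: field_simps power2_eq_square power3_eq_cube power_add)
    also have "\<dots> = (u y * hyp_laplacian v y - v y * hyp_laplacian u y) / w ^ CARD('n)"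
      using has_hessian_on_hyp_laplacian[OF hu _ True] has_hessian_on_hyp_laplacian[OF hv _ True]
      unfolding wt_def[symmetric] w_def[symmetric] m by simp
    finally show ?thesis using True by (simp add: w_def)
  qed simp
  ultimately show ?thesis by simp
qed

section \<open>Riesz potentials\<close>

lemma cball_in_sets_borel [measurable]: "cball (x :: 'a :: euclidean_space) R \<in> sets borel"
  by simp

lemma nn_integral_abs_powr_le:
  fixes c R :: real
  assumes "0 \<le> c" "c < 1" "0 < R"
  shows "(\<integral>\<^sup>+t. ennreal (indicator {- R..R} t * \<bar>t\<bar> powr (- c)) \<partial>lborel)
    = ennreal (2 * R powr (1 - c) / (1 - c))"
proof -
  define f where "f t = indicator {0..R} t * t powr (- c)" for t :: real
  have 1: "((\<lambda>t. t powr (- c)) has_integral (R powr (1 - c) / (1 - c))) {0..R}"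
    using has_integral_powr_from_0[of "- c" R] assms by (simp add: add.commute)
  have f: "(\<integral>\<^sup>+t. ennreal (f t) \<partial>lborel) = ennreal (R powr (1 - c) / (1 - c))"
    unfolding f_def by (rule nn_integral_has_integral_lebesgue[OF _ 1]) simp
  have f': "(\<integral>\<^sup>+t. ennreal (f (- t)) \<partial>lborel) = ennreal (R powr (1 - c) / (1 - c))"
    using nn_integral_real_affine[of "\<lambda>t. ennreal (f t)" "-1" 0] f by (simp add: f_def)
  have "(\<integral>\<^sup>+t. ennreal (indicator {- R..R} t * \<bar>t\<bar> powr (- c)) \<partial>lborel)
      = (\<integral>\<^sup>+t. ennreal (f t) + ennreal (f (- t)) \<partial>lborel)"
    by (intro nn_integral_cong) (auto simp: f_def indicator_def)
  also have "\<dots> = (\<integral>\<^sup>+t. ennreal (f t) \<partial>lborel) + (\<integral>\<^sup>+t. ennreal (f (- t)) \<partial>lborel)"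
    by (rule nn_integral_add) (auto simp: f_def)
  also have "\<dots> = ennreal (2 * R powr (1 - c) / (1 - c))"
    unfolding f f' using assms by (simp flip: ennreal_plus)
  finally show ?thesis .
qed

text \<open>\<open>|z| \<ge> |z\<^sub>i|\<close> gives \<open>|z|^(-b) \<le> \<Prod>\<^sub>i |z\<^sub>i|^(-b/n)\<close>, and the product separates into one-dimensional
  integrals, which converge because \<open>b/n < 1\<close>. This replaces polar coordinates and scales
  correctly in \<open>R\<close>.\<close>

lemma nn_integral_norm_powr_le:
  fixes x :: "real ^ 'n"
  assumes b: "0 \<le> b" "b < real CARD('n)" and R: "0 < R"
  shows "(\<integral>\<^sup>+y. ennreal (indicator (cball x R) y * norm (y - x) powr (- b)) \<partial>lborel)
    \<le> ennreal ((2 / (1 - b / real CARD('n))) ^ CARD('n) * R powr (real CARD('n) - b))"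
proof -
  define n where "n = CARD('n)"
  have n: "n > 0" "card (Basis :: (real ^ 'n) set) = n" by (simp_all add: n_def)
  define c where "c = b / real n"
  have c: "0 \<le> c" "c < 1" "b = c * real n" using b n by (auto simp: c_def n_def)
  let ?f = "\<lambda>t :: real. ennreal (indicator {- R..R} t * \<bar>t\<bar> powr (- c))"
  let ?g = "\<lambda>z :: real ^ 'n. ennreal (indicator (cball 0 R) z * norm z powr (- b))"
  have l: "distr lborel borel ((+) (- x)) = (lborel :: (real ^ 'n) measure)" by (rule lborel_distr_plus)
  have "(\<integral>\<^sup>+z. ?g z \<partial>lborel) = (\<integral>\<^sup>+z. ?g z \<partial>distr lborel borel ((+) (- x)))" by (simp add: l)
  also have "\<dots> = (\<integral>\<^sup>+y. ?g (- x + y) \<partial>lborel)"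
    by (rule nn_integral_distr) (simp, measurable)
  also have "\<dots> = (\<integral>\<^sup>+y. ennreal (indicator (cball x R) y * norm (y - x) powr (- b)) \<partial>lborel)"
    by (intro nn_integral_cong) (auto simp: indicator_def dist_norm norm_minus_commute)
  finally have "(\<integral>\<^sup>+y. ennreal (indicator (cball x R) y * norm (y - x) powr (- b)) \<partial>lborel)
     = (\<integral>\<^sup>+z. ?g z \<partial>lborel)" ..
  also have "\<dots> \<le> (\<integral>\<^sup>+(z :: real ^ 'n). (\<Prod>i\<in>Basis. ?f (z \<bullet> i)) \<partial>lborel)"
  proof (rule nn_integral_mono_AE)
    have "AE z :: real ^ 'n in lborel. z \<bullet> i \<noteq> 0" if i: "i \<in> Basis" for i
    proof (rule AE_I')
      have "negligible {z :: real ^ 'n. z \<bullet> i = 0}" by (rule negligible_standard_hyperplane[OF i])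
      moreover have "{z :: real ^ 'n. z \<bullet> i = 0} \<in> sets lborel"
        using closed_hyperplane[of i 0] by (simp add: inner_commute)
      ultimately show "{z :: real ^ 'n. z \<bullet> i = 0} \<in> null_sets lborel"
        by (simp add: negligible_iff_null_sets null_sets_completion_iff)
    qed auto
    then have "AE z :: real ^ 'n in lborel. \<forall>i\<in>Basis. z \<bullet> i \<noteq> 0"
      by (intro AE_finite_allI) auto
    then show "AE z in lborel. ?g z \<le> (\<Prod>i\<in>Basis. ?f (z \<bullet> i))"
    proof (rule AE_mp, intro AE_I2 impI)
      fix z :: "real ^ 'n" assume nz: "\<forall>i\<in>Basis. z \<bullet> i \<noteq> 0"
      show "?g z \<le> (\<Prod>i\<in>Basis. ?f (z \<bullet> i))"
      proof (cases "z \<in> cball 0 R")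
        case True
        have z: "\<bar>z \<bullet> i\<bar> \<le> norm z" if "i \<in> Basis" for i using Basis_le_norm[OF that] .
        have "z \<noteq> 0" using nz nonempty_Basis by force
        have "norm z powr (- b) = (norm z powr (- c)) ^ n"
          using \<open>z \<noteq> 0\<close> by (simp add: c(3) powr_power mult.commute)
        also have "\<dots> = (\<Prod>i\<in>(Basis :: (real ^ 'n) set). norm z powr (- c))"
          using n by simp
        also have "\<dots> \<le> (\<Prod>i\<in>Basis. \<bar>z \<bullet> i\<bar> powr (- c))"
          using nz z c by (intro prod_mono conjI powr_mono2') auto
        also have "\<dots> = (\<Prod>i\<in>Basis. indicator {- R..R} (z \<bullet> i) * \<bar>z \<bullet> i\<bar> powr (- c))"
        proof (rule prod.cong)
          fix i :: "real ^ 'n" assume "i \<in> Basis"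
          then have "z \<bullet> i \<in> {- R..R}" using z[of i] True by (auto simp: abs_le_iff)
          then show "\<bar>z \<bullet> i\<bar> powr (- c) = indicator {- R..R} (z \<bullet> i) * \<bar>z \<bullet> i\<bar> powr (- c)" by simp
        qed simp
        finally show ?thesis using True by (simp add: prod_ennreal ennreal_leI)
      qed simp
    qed
  qed
  also have "\<dots> = (\<Prod>i\<in>(Basis :: (real ^ 'n) set). (\<integral>\<^sup>+t. ?f t \<partial>lborel))"
    by (rule nn_integral_lborel_prod) auto
  also have "\<dots> = ennreal (2 * R powr (1 - c) / (1 - c)) ^ n"
    using nn_integral_abs_powr_le[OF c(1,2) R] n by simp
  also have "\<dots> = ennreal ((2 / (1 - c)) ^ n * R powr (real n - b))"
    using c R by (simp add: ennreal_power power_mult_distrib power_divide powr_power algebra_simps)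
  finally show ?thesis by (simp add: n_def c_def)
qed

lemma integrable_norm_powr:
  fixes x :: "real ^ 'n"
  assumes b: "0 \<le> b" "b < real CARD('n)" and R: "0 < R"
  shows "integrable lborel (\<lambda>y. indicator (cball x R) y * norm (y - x) powr (- b))"
    and "integral\<^sup>L lborel (\<lambda>y. indicator (cball x R) y * norm (y - x) powr (- b))
      \<le> (2 / (1 - b / real CARD('n))) ^ CARD('n) * R powr (real CARD('n) - b)"
proof -
  note le = nn_integral_norm_powr_le[OF b R, of x]
  show int: "integrable lborel (\<lambda>y. indicator (cball x R) y * norm (y - x) powr (- b))"
    by (rule integrableI_nonneg) (measurable, use le le_less_trans[OF le ennreal_less_top] in auto)
  show "integral\<^sup>L lborel (\<lambda>y. indicator (cball x R) y * norm (y - x) powr (- b))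
      \<le> (2 / (1 - b / real CARD('n))) ^ CARD('n) * R powr (real CARD('n) - b)"
    using le b by (subst (asm) nn_integral_eq_integral[OF int]) auto
qed

text \<open>The kernel is normalised to be at least 1 on the ball of radius \<open>W\<close>, so that the bounds below can
  be compared with the volume \<open>W^n\<close>.\<close>

definition riesz_le :: "(real ^ 'n \<Rightarrow> real) \<Rightarrow> real ^ 'n \<Rightarrow> real \<Rightarrow> real \<Rightarrow> bool" where
  "riesz_le h x W B \<longleftrightarrow>
     integrable lborel (\<lambda>y. indicator (cball x W) y * (\<bar>h y\<bar> * (W / norm (y - x)) ^ (CARD('n) - 1))) \<and>
     integral\<^sup>L lborel (\<lambda>y. indicator (cball x W) y * (\<bar>h y\<bar> * (W / norm (y - x)) ^ (CARD('n) - 1))) \<le> B"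

text \<open>This is the case \<open>h = 1\<close> of the estimate for \<open>L^p\<close> functions below, with the sharper power
  \<open>W^n\<close> that the bounded case allows.\<close>

lemma riesz_potential_bounded:
  obtains C where "0 \<le> C" and
    "\<And>(x :: real ^ 'n) W. 0 < W \<Longrightarrow> riesz_le (\<lambda>_. 1) x W (C * W ^ CARD('n))"
proof -
  define n where "n = CARD('n)"
  have n: "n > 0" by (simp add: n_def)
  define b where "b = real n - 1"
  have b: "0 \<le> b" "b < real CARD('n)" using n by (auto simp: b_def n_def)
  let ?C = "(2 / (1 - b / real n)) ^ n"
  show ?thesis
  proof (rule that[of ?C])
    show "0 \<le> ?C" using b by (simp add: n_def)
    fix x :: "real ^ 'n" and W :: real assume W: "0 < W"
    have eq: "indicator (cball x W) y * (W / norm (y - x)) ^ (n - 1)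
        = W powr b * (indicator (cball x W) y * norm (y - x) powr (- b))" if "y \<noteq> x" for y
    proof -
      have "(W / norm (y - x)) ^ (n - 1) = (W / norm (y - x)) powr b"
        using that W n by (subst powr_realpow[symmetric]) (auto simp: b_def of_nat_diff)
      also have "\<dots> = W powr b * norm (y - x) powr (- b)"
        using W by (simp add: powr_divide powr_minus_divide)
      finally show ?thesis by simp
    qed
    have ae: "AE y in lborel. indicator (cball x W) y * (W / norm (y - x)) ^ (n - 1)
        = W powr b * (indicator (cball x W) y * norm (y - x) powr (- b))"
      using AE_lborel_singleton[of x] by eventually_elim (rule eq)
    note I = integrable_norm_powr[OF b W, of x]
    have m1: "(\<lambda>y. indicator (cball x W) y * (W / norm (y - x)) ^ (n - 1)) \<in> borel_measurable borel"
      and m2: "(\<lambda>y. W powr b * (indicator (cball x W) y * norm (y - x) powr (- b))) \<in> borel_measurable borel"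
      by measurable
    have int: "integrable lborel (\<lambda>y. W powr b * (indicator (cball x W) y * norm (y - x) powr (- b)))"
      by (rule integrable_mult_right) (rule I(1))
    then have "integrable lborel (\<lambda>y. indicator (cball x W) y * (W / norm (y - x)) ^ (n - 1))"
      using iffD2[OF integrable_cong_AE[OF _ _ ae]] m1 m2 by simp
    moreover have "integral\<^sup>L lborel (\<lambda>y. indicator (cball x W) y * (W / norm (y - x)) ^ (n - 1))
       = W powr b * integral\<^sup>L lborel (\<lambda>y. indicator (cball x W) y * norm (y - x) powr (- b))"
      using integral_cong_AE[OF _ _ ae] m1 m2 by simp
    moreover have "\<dots> \<le> W powr b * (?C * W powr (real n - b))"
      using I(2) by (intro mult_left_mono) (auto simp: n_def)
    moreover have "W powr b * (?C * W powr (real n - b)) = ?C * W ^ n"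
      using W by (simp add: powr_add[symmetric] powr_realpow mult.left_commute)
    ultimately show "riesz_le (\<lambda>_. 1) x W (?C * W ^ CARD('n))"
      unfolding riesz_le_def n_def[symmetric] abs_one mult_1_left by (intro conjI) (assumption, linarith)
  qed
qed

text \<open>The power \<open>W^(n-1)\<close> is one less than the volume; the weight \<open>w^(1+\<alpha>)\<close> of \<open>\<Delta>\<^sub>h u\<close> makes up for the
  missing factor \<open>W\<close>.\<close>

definition bounded_riesz_potential :: "(real ^ 'n \<Rightarrow> real) \<Rightarrow> real \<Rightarrow> bool" where
  "bounded_riesz_potential h D \<longleftrightarrow>
     (\<forall>x W. 0 < W \<longrightarrow> W \<le> 1 \<longrightarrow> riesz_le h x W (D * W ^ (CARD('n) - 1)))"

text \<open>Young's inequality, applied to \<open>W^(1/p') |h|\<close> and \<open>W^(-1/p') (W/|y-x|)^(n-1)\<close> for the conjugate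
  exponent \<open>p'\<close>. The first term gives \<open>W^(p-1) \<integral>|h|^p\<close> with \<open>p - 1 > n - 1\<close>, the second
  \<open>W^(-1) \<integral> (W/|y-x|)^b = O(W^(n-1))\<close> with \<open>b = (n-1) p' < n\<close>.\<close>

lemma riesz_potential_Lp_bounded:
  fixes h :: "real ^ 'n \<Rightarrow> real"
  assumes h[measurable]: "h \<in> borel_measurable borel"
    and hp: "integrable lborel (\<lambda>y. \<bar>h y\<bar> powr p)" and p: "p > real CARD('n)"
    and card: "CARD('n) \<ge> 2"
  obtains C where "0 \<le> C" and "bounded_riesz_potential h C"
proof -
  define n where "n = CARD('n)"
  have n: "n > 1" using card by (simp add: n_def)
  have p1: "p > 1" "p > n" using p n by (auto simp: n_def)
  define p' where "p' = p / (p - 1)"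
  have p': "p' > 1" "1 / p + 1 / p' = 1" using p1 by (auto simp: p'_def field_simps)
  define b where "b = (real n - 1) * p'"
  have b: "0 \<le> b" "b < real CARD('n)"
    using n p1 by (auto simp: b_def p'_def n_def[symmetric] field_simps)
  define H where "H = integral\<^sup>L lborel (\<lambda>y. \<bar>h y\<bar> powr p)"
  have H: "0 \<le> H" unfolding H_def by simp
  let ?C = "H + (2 / (1 - b / real n)) ^ n"
  show ?thesis
  proof (rule that[of ?C])
    show "0 \<le> ?C" using b H by (simp add: n_def)
    show "bounded_riesz_potential h ?C"
      unfolding bounded_riesz_potential_def
    proof (intro allI impI)
      fix x :: "real ^ 'n" and W :: real assume W: "0 < W" "W \<le> 1"
      let ?F = "\<lambda>y. indicator (cball x W) y * (\<bar>h y\<bar> * (W / norm (y - x)) ^ (n - 1))"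
      let ?I = "\<lambda>y. indicator (cball x W) y * norm (y - x) powr (- b)"
      let ?G = "\<lambda>y. W powr (p - 1) * \<bar>h y\<bar> powr p + W powr (b - 1) * ?I y"
      have le: "?F y \<le> ?G y" for y
      proof (cases "y \<in> cball x W \<and> y \<noteq> x")
        case True
        define a where "a = W powr (1 / p') * \<bar>h y\<bar>"
        define r where "r = (W / norm (y - x)) ^ (n - 1)"
        define B where "B = W powr (- 1 / p') * r"
        have r: "r = (W / norm (y - x)) powr (real n - 1)"
          unfolding r_def using True W n by (subst powr_realpow[symmetric]) (auto simp: of_nat_diff)
        have nn: "0 \<le> a" "0 \<le> B" "0 \<le> r" using W by (auto simp: a_def B_def r_def)
        have "\<bar>h y\<bar> * r = a * B"
          using W by (simp add: a_def B_def powr_minus field_simps)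
        also have "\<dots> \<le> a powr p / p + B powr p' / p'"
          by (rule Youngs_inequality[OF p1(1) p'(1,2) nn(1,2)])
        also have "\<dots> \<le> a powr p + B powr p'"
          using p1 p' by (intro add_mono) (auto simp: divide_le_eq mult_le_cancel_left1)
        also have "a powr p = W powr (p - 1) * \<bar>h y\<bar> powr p"
          using W p1 by (simp add: a_def powr_mult powr_powr p'_def)
        also have "B powr p' = W powr (- 1) * (W / norm (y - x)) powr b"
          using W p' by (simp add: B_def r powr_mult powr_powr b_def)
        also have "\<dots> = W powr (b - 1) * norm (y - x) powr (- b)"
          using W by (simp add: powr_divide powr_minus_divide powr_diff)
        finally show ?thesis using True by (simp add: r_def)
      qed (use n p1 in \<open>auto simp: power_0_left\<close>)
      have "?F \<in> borel_measurable borel" by measurable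
      then have Fm: "?F \<in> borel_measurable lborel" by simp
      note I = integrable_norm_powr[OF b W(1), of x]
      have G: "integrable lborel ?G"
        using I(1) hp by (intro Bochner_Integration.integrable_add integrable_mult_right) auto
      have F: "integrable lborel ?F"
        by (rule Bochner_Integration.integrable_bound[OF G Fm])
          (use le W in \<open>auto intro!: AE_I2 order_trans[OF _ abs_ge_self] simp: abs_mult\<close>)
      have "integral\<^sup>L lborel ?F \<le> integral\<^sup>L lborel ?G"
        by (rule integral_mono[OF F G le])
      also have "\<dots> = W powr (p - 1) * H + W powr (b - 1) * integral\<^sup>L lborel ?I"
        using I(1) hp by (simp add: H_def)
      also have "\<dots> \<le> W powr (real n - 1) * H + W powr (b - 1) * ((2 / (1 - b / real n)) ^ n * W powr (real n - b))"
        using I(2) H W p1 by (intro add_mono mult_left_mono mult_right_mono powr_mono') (auto simp: n_def)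
      also have "\<dots> = ?C * W powr (real n - 1)"
        using W by (simp add: algebra_simps powr_add[symmetric])
      also have "W powr (real n - 1) = W ^ (n - 1)"
        using W n by (subst powr_realpow[symmetric]) (auto simp: of_nat_diff)
      finally show "riesz_le h x W (?C * W ^ (CARD('n) - 1))"
        using F by (simp add: riesz_le_def n_def)
    qed
  qed
qed

section \<open>Radial profiles of the kernels\<close>

text \<open>The properties shared by the outer kernel and the potential as functions of \<open>\<rho>\<close>, with the
  same \<open>C\<close> for every regularisation \<open>s\<close>. With \<open>\<rho> = r\<^sup>2\<close> the derivative bound says that the
  function of the distance \<open>r\<close> has slope \<open>O(r^(1-n))\<close>, as a fundamental solution has. The radius
  \<open>\<rho> = 1/24\<close> of the support keeps \<open>y\<close> so close to \<open>x\<close> that \<open>wt\<close> is comparable at both points.\<close>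

definition profile :: "nat \<Rightarrow> real \<Rightarrow> (real \<Rightarrow> real) \<Rightarrow> bool" where
  "profile n C \<phi> \<longleftrightarrow> continuous_on {0..} \<phi> \<and> (\<forall>t\<ge>0. 0 \<le> \<phi> t) \<and> (\<forall>t\<ge>1/24. \<phi> t = 0) \<and>
     (\<exists>\<phi>'. \<forall>r>0. (\<phi> has_real_derivative \<phi>' (r\<^sup>2)) (at (r\<^sup>2)) \<and> \<bar>\<phi>' (r\<^sup>2)\<bar> \<le> C / r ^ n)"

text \<open>The mean value theorem in \<open>r\<close>; the slope bound is decreasing in \<open>r\<close>, so the smaller radius
  controls it.\<close>

lemma profile_lipschitz_ordered:
  assumes \<phi>: "profile n C \<phi>" and n: "n \<ge> 1" and r: "0 < r" "r \<le> r'"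
  shows "\<bar>\<phi> (r\<^sup>2) - \<phi> (r'\<^sup>2)\<bar> \<le> 2 * C * (r' - r) / r ^ (n - 1)"
proof (cases "r = r'")
  case False
  then have lt: "r < r'" using r by simp
  obtain \<phi>' where d: "\<And>r. r > 0 \<Longrightarrow> (\<phi> has_real_derivative \<phi>' (r\<^sup>2)) (at (r\<^sup>2))"
    and b: "\<And>r. r > 0 \<Longrightarrow> \<bar>\<phi>' (r\<^sup>2)\<bar> \<le> C / r ^ n"
    using \<phi> unfolding profile_def by blast
  have C: "0 \<le> C" using b[of 1] by simp
  have "\<exists>z. r < z \<and> z < r' \<and> \<phi> (r'\<^sup>2) - \<phi> (r\<^sup>2) = (r' - r) * (\<phi>' (z\<^sup>2) * (2 * z))"
  proof (rule MVT2[OF lt])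
    fix z assume "r \<le> z"
    then have "((\<lambda>z. \<phi> (z\<^sup>2)) has_real_derivative \<phi>' (z\<^sup>2) * (2 * z)) (at z)"
      using r by (intro DERIV_chain2[where f=\<phi> and g="\<lambda>z. z\<^sup>2", OF d]) (auto intro!: derivative_eq_intros)
    then show "((\<lambda>z. \<phi> (z\<^sup>2)) has_real_derivative \<phi>' (z\<^sup>2) * (2 * z)) (at z)" .
  qed
  then obtain z where z: "r < z" "\<phi> (r'\<^sup>2) - \<phi> (r\<^sup>2) = (r' - r) * (\<phi>' (z\<^sup>2) * (2 * z))" by blast
  obtain m where m: "n = Suc m" using n by (cases n) auto
  have "\<bar>\<phi>' (z\<^sup>2)\<bar> * (2 * z) \<le> C / z ^ n * (2 * z)"
    using b[of z] z r by (intro mult_right_mono) auto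
  also have "\<dots> = 2 * C / z ^ m" using z r by (simp add: m field_simps)
  also have "\<dots> \<le> 2 * C / r ^ m"
    using z r C by (intro divide_left_mono power_mono mult_pos_pos) auto
  finally have "(r' - r) * (\<bar>\<phi>' (z\<^sup>2)\<bar> * (2 * z)) \<le> (r' - r) * (2 * C / r ^ m)"
    using lt by (intro mult_left_mono) auto
  moreover have "\<bar>\<phi> (r\<^sup>2) - \<phi> (r'\<^sup>2)\<bar> = (r' - r) * (\<bar>\<phi>' (z\<^sup>2)\<bar> * (2 * z))"
    using z lt r by (subst abs_minus_commute) (simp add: abs_mult)
  ultimately show ?thesis by (simp add: m field_simps)
qed simp

lemma profile_const_nonneg: "profile n C \<phi> \<Longrightarrow> 0 \<le> C"
  unfolding profile_def by (metis abs_ge_zero div_by_1 order_trans power_one zero_less_one)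

lemma profile_lipschitz:
  assumes \<phi>: "profile n C \<phi>" and n: "n \<ge> 1" and r: "0 < r" "0 < r'"
  shows "\<bar>\<phi> (r\<^sup>2) - \<phi> (r'\<^sup>2)\<bar> \<le> 2 * C * \<bar>r - r'\<bar> * (1 / r ^ (n - 1) + 1 / r' ^ (n - 1))"
proof -
  have C: "0 \<le> C" using \<phi> profile_const_nonneg by blast
  show ?thesis
  proof (cases "r \<le> r'")
    case True
    then have "\<bar>\<phi> (r\<^sup>2) - \<phi> (r'\<^sup>2)\<bar> \<le> 2 * C * \<bar>r - r'\<bar> * (1 / r ^ (n - 1))"
      using profile_lipschitz_ordered[OF \<phi> n r(1), of r'] by simp
    also have "\<dots> \<le> 2 * C * \<bar>r - r'\<bar> * (1 / r ^ (n - 1) + 1 / r' ^ (n - 1))"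
      using C r by (intro mult_left_mono) auto
    finally show ?thesis .
  next
    case False
    then have "\<bar>\<phi> (r\<^sup>2) - \<phi> (r'\<^sup>2)\<bar> \<le> 2 * C * \<bar>r - r'\<bar> * (1 / r' ^ (n - 1))"
      using profile_lipschitz_ordered[OF \<phi> n r(2), of r] by (simp add: abs_minus_commute)
    also have "\<dots> \<le> 2 * C * \<bar>r - r'\<bar> * (1 / r ^ (n - 1) + 1 / r' ^ (n - 1))"
      using C r by (intro mult_left_mono) auto
    finally show ?thesis .
  qed
qed

text \<open>Comparison with \<open>r = 1\<close>, where the profile vanishes. For a fundamental solution the power
  \<open>n - 2\<close> would do, but \<open>n - 1\<close> is what the differences need anyway.\<close>

lemma profile_le:
  assumes \<phi>: "profile n C \<phi>" and n: "n \<ge> 1" and r: "0 < r"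
  shows "\<phi> (r\<^sup>2) \<le> 2 * C / r ^ (n - 1)"
proof (cases "r \<le> 1")
  case True
  have "\<phi> (1\<^sup>2) = 0" using \<phi> by (simp add: profile_def)
  then have "\<phi> (r\<^sup>2) \<le> 2 * C * (1 - r) / r ^ (n - 1)"
    using profile_lipschitz_ordered[OF \<phi> n r True] by (simp add: abs_if split: if_splits)
  also have "\<dots> \<le> 2 * C / r ^ (n - 1)"
    using r profile_const_nonneg[OF \<phi>] by (intro divide_right_mono) (auto simp: algebra_simps)
  finally show ?thesis .
next
  case False
  then have "1 \<le> r\<^sup>2" by (simp add: one_le_power)
  then have "\<phi> (r\<^sup>2) = 0" using \<phi> by (auto simp: profile_def)
  then show ?thesis using r profile_const_nonneg[OF \<phi>] by simp
qed

text \<open>At the kink, \<open>max 0 z ^ (k+2) = max 0 z ^ (k+1) \<cdot> z\<close> with a continuous first factor, which is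
  Caratheodory's form of the derivative.\<close>

lemma DERIV_max_power:
  "((\<lambda>z :: real. max 0 z ^ Suc (Suc k)) has_real_derivative real (k + 2) * max 0 z ^ Suc k) (at z)"
proof (cases z "0 :: real" rule: linorder_cases)
  case less
  have "((\<lambda>_ :: real. 0 :: real) has_real_derivative 0) (at z)" by simp
  then have "((\<lambda>z :: real. max 0 z ^ Suc (Suc k)) has_real_derivative 0) (at z)"
    by (rule has_field_derivative_transform_within_open[of _ _ _ "{..<0}"]) (use less in auto)
  then show ?thesis using less by simp
next
  case equal
  have "isCont (\<lambda>z :: real. max 0 z ^ Suc k) 0" by (intro continuous_intros)
  then show ?thesis
    unfolding CARAT_DERIV
    by (intro exI[of _ "\<lambda>z. max 0 z ^ Suc k"]) (auto simp: equal max_def)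
next
  case greater
  have "((\<lambda>z :: real. z ^ Suc (Suc k)) has_real_derivative real (k + 2) * z ^ Suc k) (at z)"
    using DERIV_pow[of "Suc (Suc k)" z] by simp
  then have "((\<lambda>z :: real. max 0 z ^ Suc (Suc k)) has_real_derivative real (k + 2) * z ^ Suc k) (at z)"
    by (rule has_field_derivative_transform_within_open[of _ _ _ "{0<..}"]) (use greater in auto)
  then show ?thesis using greater by simp
qed

definition cutoff :: "real \<Rightarrow> real" where "cutoff t = max 0 (1 - 24 * t)"

lemma DERIV_cutoff_power:
  "((\<lambda>t. cutoff t ^ Suc (Suc k)) has_real_derivative - 24 * (real (k + 2) * cutoff t ^ Suc k)) (at t)"
proof -
  have "((\<lambda>t. 1 - 24 * t) has_real_derivative - 24) (at t)"
    by (auto intro!: derivative_eq_intros)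
  from DERIV_chain2[OF DERIV_max_power this] show ?thesis
    by (simp add: cutoff_def mult.commute)
qed

lemma cutoff_bounds: "0 \<le> cutoff t" "0 \<le> t \<Longrightarrow> cutoff t \<le> 1" "1/24 \<le> t \<Longrightarrow> cutoff t = 0"
  by (auto simp: cutoff_def)

text \<open>Minus the derivative of the potential. For \<open>s = 0\<close> and without the cutoff it is
  \<open>(\<rho>(1+\<rho>))^(-n/2)\<close>, the slope of the fundamental solution of \<open>4\<rho>(1+\<rho>) e'' + 2n(1+2\<rho>) e' = 0\<close>. The
  cube of the cutoff makes the potential twice continuously differentiable.\<close>

definition flux :: "nat \<Rightarrow> real \<Rightarrow> real \<Rightarrow> real" where
  "flux n s t = cutoff t ^ 3 * (t * (1 + t) + s) powr (- real n / 2)"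

text \<open>The part of \<open>\<Delta>\<^sub>h e\<close> that comes from differentiating the cutoff; \<open>288 = 4 \<cdot> 3 \<cdot> 24\<close>.\<close>

definition outer_kernel :: "nat \<Rightarrow> real \<Rightarrow> real \<Rightarrow> real" where
  "outer_kernel n s t = 288 * cutoff t ^ 2 * (t * (1 + t)) * (t * (1 + t) + s) powr (- real n / 2)"

text \<open>The part of \<open>\<Delta>\<^sub>h e\<close> that is due to the regularisation \<open>s\<close>. Away from \<open>t = 0\<close> it is \<open>O(s)\<close>.\<close>

definition inner_kernel :: "nat \<Rightarrow> real \<Rightarrow> real \<Rightarrow> real" where
  "inner_kernel n s t = 2 * real n * cutoff t ^ 3 * (1 + 2 * t) * s * (t * (1 + t) + s) powr (- real n / 2 - 1)"

lemma reg_pos: "0 < s \<Longrightarrow> - s / 2 \<le> t \<Longrightarrow> 0 < t * (1 + t) + (s :: real)"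
proof -
  assume a: "0 < s" "- s / 2 \<le> t"
  have "0 < t + s" using a by simp
  then show ?thesis using zero_le_square[of t] by (simp add: algebra_simps del: zero_le_square)
qed

lemma DERIV_reg_powr:
  assumes "0 < s" "- s / 2 \<le> t"
  shows "((\<lambda>t. (t * (1 + t) + s) powr a) has_real_derivative
    a * (1 + 2 * t) * (t * (1 + t) + s) powr (a - 1)) (at t)"
proof -
  have "((\<lambda>t. t * (1 + t) + s) has_real_derivative 1 + 2 * t) (at t)"
    by (auto intro!: derivative_eq_intros)
  from DERIV_fun_powr[OF this reg_pos[OF assms], of a] show ?thesis
    by (simp add: mult_ac)
qed

lemma DERIV_flux:
  assumes "0 < s" "- s / 2 \<le> t"
  shows "(flux n s has_real_derivative
    - 72 * cutoff t ^ 2 * (t * (1 + t) + s) powr (- real n / 2)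
    - cutoff t ^ 3 * (real n / 2 * (1 + 2 * t) * (t * (1 + t) + s) powr (- real n / 2 - 1))) (at t)"
proof -
  have "((\<lambda>t. cutoff t ^ Suc (Suc 1)) has_real_derivative - 24 * (real (1 + 2) * cutoff t ^ Suc 1)) (at t)"
    by (rule DERIV_cutoff_power)
  from DERIV_mult[OF this DERIV_reg_powr[OF assms, of "- real n / 2"]] show ?thesis
    by (simp add: flux_def[abs_def] numeral_eq_Suc algebra_simps)
qed

lemma reg_powr_le:
  assumes "0 < s" "0 < r"
  shows "(r\<^sup>2 * (1 + r\<^sup>2) + s) powr (- real n / 2) \<le> 1 / r ^ n"
proof -
  have "(r\<^sup>2 * (1 + r\<^sup>2) + s) powr (- real n / 2) \<le> (r\<^sup>2) powr (- real n / 2)"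
    using assms by (intro powr_mono2') (auto simp: algebra_simps)
  also have "(r\<^sup>2) powr (- real n / 2) = r powr (- real n)"
    using assms by (simp add: powr_powr flip: powr_numeral)
  also have "\<dots> = 1 / r ^ n" using assms by (simp add: powr_minus_divide powr_realpow)
  finally show ?thesis .
qed

text \<open>The lower bound holds on an interval just above \<open>[1/2048, 1/96]\<close>, so that the potential,
  an integral of the flux, is bounded below on \<open>[1/2048, 1/96]\<close>.\<close>

lemma flux_bounds:
  assumes s: "0 < s" "s \<le> 1"
  shows "0 \<le> t \<Longrightarrow> 0 \<le> flux n s t"
    and "0 < r \<Longrightarrow> flux n s (r\<^sup>2) \<le> 1 / r ^ n"
    and "1/96 \<le> t \<Longrightarrow> t \<le> 1/48 \<Longrightarrow> 2 powr (- real n / 2) / 8 \<le> flux n s t"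
    and "1/24 \<le> t \<Longrightarrow> flux n s t = 0"
proof -
  show "0 \<le> flux n s t" if "0 \<le> t" using that cutoff_bounds(1)[of t] by (simp add: flux_def)
  show "flux n s (r\<^sup>2) \<le> 1 / r ^ n" if "0 < r"
  proof -
    have "cutoff (r\<^sup>2) ^ 3 \<le> 1" by (intro power_le_one cutoff_bounds) auto
    then have "flux n s (r\<^sup>2) \<le> 1 * (r\<^sup>2 * (1 + r\<^sup>2) + s) powr (- real n / 2)"
      unfolding flux_def by (intro mult_right_mono) auto
    then show ?thesis using reg_powr_le[OF s(1) that, of n] by linarith
  qed
  show "2 powr (- real n / 2) / 8 \<le> flux n s t" if t: "1/96 \<le> t" "t \<le> 1/48"
  proof -
    have "t * t \<le> 1 / 48 * (1 / 48)" using t by (intro mult_mono) auto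
    then have "t * (1 + t) + s \<le> 2" "0 < t * (1 + t) + s"
      using t s by (auto simp: algebra_simps intro: add_pos_nonneg)
    then have "2 powr (- real n / 2) \<le> (t * (1 + t) + s) powr (- real n / 2)"
      by (intro powr_mono2') auto
    moreover have "(1/2) ^ 3 \<le> cutoff t ^ 3"
      using t by (intro power_mono) (auto simp: cutoff_def)
    ultimately have "(1/2) ^ 3 * 2 powr (- real n / 2) \<le> flux n s t"
      unfolding flux_def by (intro mult_mono) (auto simp: cutoff_bounds)
    then show ?thesis by (simp add: power3_eq_cube)
  qed
  show "flux n s t = 0" if "1/24 \<le> t" using that by (simp add: flux_def cutoff_bounds)
qed


lemma DERIV_outer_kernel:
  assumes "0 < s" "0 \<le> t"
  shows "(outer_kernel n s has_real_derivative
    288 * ((- 48 * cutoff t * (t * (1 + t)) + cutoff t ^ 2 * (1 + 2 * t)) * (t * (1 + t) + s) powr (- real n / 2)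
     - cutoff t ^ 2 * (t * (1 + t)) * (real n / 2 * (1 + 2 * t) * (t * (1 + t) + s) powr (- real n / 2 - 1)))) (at t)"
proof -
  have "((\<lambda>t. cutoff t ^ Suc (Suc 0)) has_real_derivative - 24 * (real (0 + 2) * cutoff t ^ Suc 0)) (at t)"
    by (rule DERIV_cutoff_power)
  moreover have "((\<lambda>t. t * (1 + t)) has_real_derivative 1 + 2 * t) (at t)"
    by (auto intro!: derivative_eq_intros)
  ultimately have "((\<lambda>t. cutoff t ^ Suc (Suc 0) * (t * (1 + t))) has_real_derivative
    - 24 * (real (0 + 2) * cutoff t ^ Suc 0) * (t * (1 + t)) + (1 + 2 * t) * cutoff t ^ Suc (Suc 0)) (at t)"
    by (rule DERIV_mult)
  from DERIV_cmult[OF DERIV_mult[OF this DERIV_reg_powr[of s t "- real n / 2"]], of 288] assms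
  show ?thesis
    by (simp add: outer_kernel_def[abs_def] power2_eq_square algebra_simps)
qed

text \<open>Every term of the derivative is at most a constant times \<open>(t(1+t) + s)^(-n/2)\<close>, since one factor
  \<open>t(1+t)\<close> compensates for the additional negative power. The interval in the lower bound is the
  range of \<open>\<rho>\<close> on a ball used in \<open>hyp_integral_lower_bound\<close>.\<close>

lemma outer_kernel_profile:
  assumes s: "0 < s" "s \<le> 1"
  shows "profile n (288 * (50 + real n)) (outer_kernel n s)"
    and "1/2048 \<le> t \<Longrightarrow> t \<le> 1/96 \<Longrightarrow> 2 powr (- real n / 2) / 768 \<le> outer_kernel n s t"
proof -
  define D where "D t = 288 * ((- 48 * cutoff t * (t * (1 + t)) + cutoff t ^ 2 * (1 + 2 * t)) * (t * (1 + t) + s) powr (- real n / 2)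
     - cutoff t ^ 2 * (t * (1 + t)) * (real n / 2 * (1 + 2 * t) * (t * (1 + t) + s) powr (- real n / 2 - 1)))" for t
  have D: "(outer_kernel n s has_real_derivative D t) (at t)" if "0 \<le> t" for t
    unfolding D_def by (rule DERIV_outer_kernel[OF s(1) that])
  have D_le: "\<bar>D t\<bar> \<le> 288 * (50 + real n) * (t * (1 + t) + s) powr (- real n / 2)" if t: "0 \<le> t" for t
  proof (cases "t \<le> 1/24")
    case True
    define P Q Q1 c where d: "P = t * (1 + t)" "Q = (t * (1 + t) + s) powr (- real n / 2)"
      "Q1 = (t * (1 + t) + s) powr (- real n / 2 - 1)" "c = cutoff t"
    have P: "0 \<le> P" "P \<le> 1"
    proof -
      have "t * (1 + t) \<le> 1 / 24 * (1 + 1 / 24)" using t True by (intro mult_mono) auto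
      then show "0 \<le> P" "P \<le> 1" using t by (auto simp: d)
    qed
    have c: "0 \<le> c" "c \<le> 1" "0 \<le> c\<^sup>2" "c\<^sup>2 \<le> 1"
      using cutoff_bounds[of t] t by (auto simp: d power_le_one)
    have Q: "0 \<le> Q" "0 \<le> Q1" by (auto simp: d)
    have "(P + s) * Q1 = Q"
    proof -
      have "(P + s) powr 1 * (P + s) powr (- real n / 2 - 1) = (P + s) powr (- real n / 2)"
        by (subst powr_add[symmetric]) simp
      then show ?thesis using P s by (simp add: d)
    qed
    moreover have "0 \<le> s * Q1" using Q s by simp
    ultimately have PQ: "P * Q1 \<le> Q" by (simp only: distrib_right)
    have a1: "\<bar>- 48 * c * P\<bar> \<le> 48" using mult_mono[OF c(2) P(2)] c P by (simp add: abs_mult)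
    have a2: "\<bar>c\<^sup>2 * (1 + 2 * t)\<bar> \<le> 1 * 2" unfolding abs_mult using c t True by (intro mult_mono) auto
    have a3: "\<bar>c\<^sup>2 * P * (real n / 2 * (1 + 2 * t) * Q1)\<bar> \<le> real n * Q"
    proof -
      have "\<bar>c\<^sup>2 * P * (real n / 2 * (1 + 2 * t) * Q1)\<bar> = c\<^sup>2 * (real n * ((1 + 2 * t) / 2) * (P * Q1))"
        using P Q c t by (simp add: abs_mult)
      also have "\<dots> \<le> 1 * (real n * 1 * Q)"
        using c t True PQ P Q by (intro mult_mono) auto
      finally show ?thesis by simp
    qed
    have "\<bar>(- 48 * c * P + c\<^sup>2 * (1 + 2 * t)) * Q\<bar> \<le> 50 * Q"
      unfolding abs_mult using a1 a2 Q by (intro mult_mono) auto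
    with a3 have "\<bar>(- 48 * c * P + c\<^sup>2 * (1 + 2 * t)) * Q - c\<^sup>2 * P * (real n / 2 * (1 + 2 * t) * Q1)\<bar> \<le> (50 + real n) * Q"
      by (simp only: distrib_right)
    moreover have "D t = 288 * ((- 48 * c * P + c\<^sup>2 * (1 + 2 * t)) * Q - c\<^sup>2 * P * (real n / 2 * (1 + 2 * t) * Q1))"
      by (simp only: D_def d)
    ultimately have "\<bar>D t\<bar> \<le> 288 * ((50 + real n) * Q)"
      by (simp only: abs_mult) simp
    then show ?thesis by (simp only: d mult.assoc)
  next
    case False
    then have "D t = 0" by (simp add: D_def cutoff_bounds)
    then show ?thesis by simp
  qed
  show "profile n (288 * (50 + real n)) (outer_kernel n s)"
    unfolding profile_def
  proof (intro conjI exI allI impI)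
    show "continuous_on {0..} (outer_kernel n s)"
      by (rule DERIV_continuous_on[where D=D]) (auto intro: has_field_derivative_at_within D)
    show "0 \<le> outer_kernel n s t" if "0 \<le> t" for t
      using that cutoff_bounds(1)[of t] by (simp add: outer_kernel_def)
    show "outer_kernel n s t = 0" if "1/24 \<le> t" for t
      using that by (simp add: outer_kernel_def cutoff_bounds)
    fix r :: real assume r: "0 < r"
    show "(outer_kernel n s has_real_derivative D (r\<^sup>2)) (at (r\<^sup>2))" by (rule D) simp
    have "\<bar>D (r\<^sup>2)\<bar> \<le> 288 * (50 + real n) * (1 / r ^ n)"
      by (rule order_trans[OF D_le mult_left_mono[OF reg_powr_le[OF s(1) r]]]) auto
    then show "\<bar>D (r\<^sup>2)\<bar> \<le> 288 * (50 + real n) / r ^ n" by simp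
  qed
  show "2 powr (- real n / 2) / 768 \<le> outer_kernel n s t" if t: "1/2048 \<le> t" "t \<le> 1/96"
  proof -
    have "t * t \<le> 1 / 96 * (1 / 96)" using t by (intro mult_mono) auto
    then have "t * (1 + t) + s \<le> 2" "0 < t * (1 + t) + s"
      using t s by (auto simp: algebra_simps intro: add_pos_nonneg)
    then have "2 powr (- real n / 2) \<le> (t * (1 + t) + s) powr (- real n / 2)"
      by (intro powr_mono2') auto
    moreover have "(1/2) ^ 2 \<le> cutoff t ^ 2" using t by (intro power_mono) (auto simp: cutoff_def)
    moreover have "1/2048 * 1 \<le> t * (1 + t)" using t by (intro mult_mono) auto
    ultimately have "288 * (1/2) ^ 2 * (1/2048) * 2 powr (- real n / 2) \<le> outer_kernel n s t"
      unfolding outer_kernel_def using t by (intro mult_mono) auto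
    moreover have "2 powr (- real n / 2) / 768 \<le> 288 * (1/2) ^ 2 * (1/2048) * 2 powr (- real n / 2)"
      by (simp add: power2_eq_square)
    ultimately show ?thesis by linarith
  qed
qed

text \<open>The potential is obtained by integrating the flux from \<open>t\<close> to \<open>1/24\<close>.\<close>

lemma potential_profile:
  assumes s: "0 < s" "s \<le> 1"
  obtains e where "\<And>t. 0 \<le> t \<Longrightarrow> (e has_real_derivative - flux n s t) (at t)"
    and "profile n (288 * (50 + real n)) e"
    and "\<And>t. 1/2048 \<le> t \<Longrightarrow> t \<le> 1/96 \<Longrightarrow> 2 powr (- real n / 2) / 768 \<le> e t"
proof -
  have cont: "continuous_on {- s / 2..b} (flux n s)" for b
    by (rule DERIV_continuous_on, rule has_field_derivative_at_within, rule DERIV_flux[OF s(1)]) auto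
  \<comment> \<open>The base point \<open>-s/2\<close> makes \<open>0\<close> an interior point, so that the derivative
    at \<open>t = 0\<close> is two-sided; \<open>t(1+t) + s\<close> is still positive there.\<close>
  define I where "I t = integral {- s / 2..t} (flux n s)" for t
  define e where "e t = I (1/24) - I t" for t
  have dI: "(I has_real_derivative flux n s t) (at t)" if t: "0 \<le> t" for t
  proof -
    have "(I has_real_derivative flux n s t) (at t within {- s / 2..t + 1})"
      unfolding I_def[abs_def] by (rule integral_has_real_derivative[OF cont]) (use t s in auto)
    moreover have "at t within {- s / 2..t + 1} = at t"
      using t s by (intro at_within_interior) auto
    ultimately show ?thesis by simp
  qed
  have de: "(e has_real_derivative - flux n s t) (at t)" if t: "0 \<le> t" for t
    unfolding e_def[abs_def] using dI[OF t] by (auto intro!: derivative_eq_intros)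
  have dec: "e t' \<le> e t - (t' - t) * c" if "0 \<le> t" "t \<le> t'" "\<And>z. t \<le> z \<Longrightarrow> z \<le> t' \<Longrightarrow> c \<le> flux n s z" for t t' c
  proof (cases "t = t'")
    case False
    then have lt: "t < t'" using that by simp
    have "\<exists>z. t < z \<and> z < t' \<and> e t' - e t = (t' - t) * (- flux n s z)"
      by (rule MVT2[OF lt]) (rule de, use that(1) in linarith)
    then obtain z where z: "t < z" "z < t'" "e t' - e t = (t' - t) * (- flux n s z)" by blast
    have "(t' - t) * c \<le> (t' - t) * flux n s z"
      using that(3)[of z] z lt by (intro mult_left_mono) auto
    moreover have "e t' - e t = - ((t' - t) * flux n s z)" using z(3) by simp
    ultimately show ?thesis by linarith
  qed simp
  have mono: "e t' \<le> e t" if "0 \<le> t" "t \<le> t'" for t t'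
    using dec[OF that, of 0] flux_bounds(1)[OF s] that by simp
  have zero: "e t = 0" if "1/24 \<le> t" for t
  proof (cases "t = 1/24")
    case False
    then have lt: "1/24 < t" using that by simp
    have "\<exists>z. 1/24 < z \<and> z < t \<and> e t - e (1/24) = (t - 1/24) * (- flux n s z)"
      by (rule MVT2[OF lt]) (rule de, linarith)
    then obtain z where "1/24 < z" "e t - e (1/24) = (t - 1/24) * (- flux n s z)" by blast
    then show ?thesis using flux_bounds(4)[OF s, of z n] by (simp add: e_def)
  next
    case True
    then show ?thesis unfolding e_def by (simp only: diff_self)
  qed
  have nn: "0 \<le> e t" if "0 \<le> t" for t
    using mono[OF that, of "1/24"] zero[of "1/24"] zero[of t] by (cases "t \<le> 1/24") auto
  show ?thesis
  proof (rule that[of e])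
    show "(e has_real_derivative - flux n s t) (at t)" if "0 \<le> t" for t by (rule de[OF that])
    show "profile n (288 * (50 + real n)) e"
      unfolding profile_def
    proof (intro conjI exI allI impI)
      show "continuous_on {0..} e"
        by (rule DERIV_continuous_on[where D="\<lambda>t. - flux n s t"]) (auto intro: has_field_derivative_at_within de)
      fix r :: real assume r: "0 < r"
      show "(e has_real_derivative - flux n s (r\<^sup>2)) (at (r\<^sup>2))" by (rule de) simp
      have "\<bar>- flux n s (r\<^sup>2)\<bar> \<le> 1 / r ^ n"
        using flux_bounds(1)[OF s, of "r\<^sup>2" n] flux_bounds(2)[OF s r, of n] by simp
      also have "\<dots> \<le> 288 * (50 + real n) / r ^ n"
        using r by (intro divide_right_mono) auto
      finally show "\<bar>- flux n s (r\<^sup>2)\<bar> \<le> 288 * (50 + real n) / r ^ n" .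
    qed (use nn zero in auto)
    show "2 powr (- real n / 2) / 768 \<le> e t" if "1/2048 \<le> t" "t \<le> 1/96" for t
    proof -
      have "e (1/48) \<le> e (1/96) - (1/48 - 1/96) * (2 powr (- real n / 2) / 8)"
        by (rule dec) (use flux_bounds(3)[OF s] in auto)
      moreover have "0 \<le> e (1/48)" by (rule nn) simp
      moreover have "e (1/96) \<le> e t" by (rule mono) (use that in auto)
      ultimately show ?thesis by simp
    qed
  qed
qed

section \<open>Kernels at the hyperbolic scale\<close>

lemma wt_diff:
  assumes "x \<in> cball 0 1" "y \<in> cball 0 1"
  shows "\<bar>wt x - wt y\<bar> \<le> 2 * norm (x - y)"
proof -
  have "wt x - wt y = (norm y - norm x) * (norm x + norm y)"
    by (simp add: wt_def power2_eq_square algebra_simps)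
  then have "\<bar>wt x - wt y\<bar> = \<bar>norm x - norm y\<bar> * (norm x + norm y)"
    by (simp add: abs_mult abs_minus_commute)
  also have "\<dots> \<le> norm (x - y) * 2"
    using assms norm_triangle_ineq3[of x y] by (intro mult_mono) auto
  finally show ?thesis by simp
qed

lemma wt_le: "x \<in> cball 0 1 \<Longrightarrow> wt x \<le> 2 * (1 - norm x)"
  using mult_mono[of "1 - norm x" "1 - norm x" "1 + norm x" 2]
  by (simp add: wt_def power2_eq_square algebra_simps)

text \<open>The weight \<open>wt\<close> is 2-Lipschitz on the closed ball, by \<open>wt_diff\<close>.\<close>

lemma near_in_ball:
  assumes "x \<in> ball 0 1" "norm (y - x) \<le> wt x / 4"
  shows "y \<in> ball 0 1" "wt x / 2 \<le> wt y" "wt y \<le> 3 / 2 * wt x"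
proof -
  have "norm y \<le> norm x + norm (y - x)" by (metis add.commute diff_add_cancel norm_triangle_ineq)
  moreover have "0 < wt x" "wt x \<le> 2 * (1 - norm x)" using assms wt_pos wt_le[of x] by auto
  ultimately show y: "y \<in> ball 0 1" using assms by simp
  then have "\<bar>wt x - wt y\<bar> \<le> 2 * norm (y - x)"
    using wt_diff[of x y] assms by (simp add: norm_minus_commute)
  then show "wt x / 2 \<le> wt y" "wt y \<le> 3 / 2 * wt x" using assms by auto
qed

lemma sinh2_dist_nonneg: "x \<in> ball 0 1 \<Longrightarrow> y \<in> ball 0 1 \<Longrightarrow> 0 \<le> sinh2_dist x y"
  using wt_pos[of x] wt_pos[of y] by (simp add: sinh2_dist_def)

lemma continuous_on_sinh2_dist:
  assumes "x \<in> ball 0 1"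
  shows "continuous_on (ball 0 1) (sinh2_dist x)"
  unfolding sinh2_dist_def[abs_def]
  by (intro continuous_intros continuous_on_wt) (use wt_nonzero[OF assms] in \<open>auto dest: wt_nonzero\<close>)

text \<open>If \<open>|y-x| > wt x / 4\<close>, then \<open>wt y < 6 |y-x|\<close>, so that \<open>|y-x|\<^sup>2 \<le> wt x wt y / 24\<close> would fail. This
  fixes the constant \<open>1/24\<close>.\<close>

lemma sinh2_dist_le_imp_near:
  assumes x: "x \<in> ball 0 1" and y: "y \<in> ball 0 1" and r: "sinh2_dist x y \<le> 1/24"
  shows "norm (y - x) \<le> wt x / 4"
proof (rule ccontr)
  assume "\<not> ?thesis"
  then have lt: "wt x < 4 * norm (y - x)" by simp
  have p: "0 < wt x" "0 < wt y" using wt_pos x y by auto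
  have w: "wt y \<le> wt x + 2 * norm (y - x)"
    using wt_diff[of x y] x y by (simp add: norm_minus_commute)
  have "(norm (y - x))\<^sup>2 \<le> wt x * wt y / 24"
    using r p by (simp add: sinh2_dist_def divide_le_eq)
  also have "wt x * wt y < (4 * norm (y - x)) * (6 * norm (y - x))"
    using lt w p by (intro mult_strict_mono') auto
  finally show False by (simp add: power2_eq_square)
qed

text \<open>The factor \<open>wt y ^ (-n)\<close> is the density of the hyperbolic volume, so that integrals against
  this kernel are integrals of \<open>\<phi>(\<rho>)\<close> with respect to that volume.\<close>

definition hyp_kernel :: "(real \<Rightarrow> real) \<Rightarrow> real ^ 'n \<Rightarrow> real ^ 'n \<Rightarrow> real" where
  "hyp_kernel \<phi> x y = \<phi> (sinh2_dist x y) / wt y ^ CARD('n)"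

definition hyp_integral :: "(real \<Rightarrow> real) \<Rightarrow> real ^ 'n \<Rightarrow> (real ^ 'n \<Rightarrow> real) \<Rightarrow> real" where
  "hyp_integral \<phi> x F = integral\<^sup>L lborel (\<lambda>y. indicator (ball 0 1) y * (F y * hyp_kernel \<phi> x y))"

lemma hyp_kernel_eq_0:
  assumes "x \<in> ball 0 1" "\<And>t. 1/24 \<le> t \<Longrightarrow> \<phi> t = 0" "y \<in> ball 0 1 - cball x (wt x / 4)"
  shows "hyp_kernel \<phi> x y = 0"
proof -
  have "1/24 \<le> sinh2_dist x y"
    using sinh2_dist_le_imp_near[of x y] assms by (force simp: dist_norm norm_minus_commute)
  then show ?thesis using assms(2) by (simp add: hyp_kernel_def)
qed

lemma cball_near_subset: "x \<in> ball 0 1 \<Longrightarrow> cball x (wt x / 4) \<subseteq> ball 0 1"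
  using near_in_ball(1)[of x] by (auto simp: dist_norm norm_minus_commute)

lemma continuous_on_hyp_kernel:
  assumes "x \<in> ball 0 1" "continuous_on {0..} \<phi>"
  shows "continuous_on (ball 0 1) (hyp_kernel \<phi> x)"
  unfolding hyp_kernel_def[abs_def]
  by (intro continuous_intros continuous_on_wt continuous_on_compose2[OF assms(2) continuous_on_sinh2_dist])
    (use assms sinh2_dist_nonneg in \<open>auto dest: wt_nonzero\<close>)

lemma hyp_integral_integrable:
  fixes x :: "real ^ 'n"
  assumes x: "x \<in> ball 0 1" and \<phi>: "continuous_on {0..} \<phi>" "\<And>t. 1/24 \<le> t \<Longrightarrow> \<phi> t = 0"
    and F: "continuous_on (ball 0 1) F"
  shows "integrable lborel (\<lambda>y. indicator (ball 0 1) y * (F y * hyp_kernel \<phi> x y))"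
  by (rule integral_compact_continuous[of "cball x (wt x / 4)"])
    (use cball_near_subset[OF x] hyp_kernel_eq_0[OF x \<phi>(2)] in
      \<open>auto intro!: continuous_intros F continuous_on_hyp_kernel[OF x \<phi>(1)]\<close>)

text \<open>The ball of radius \<open>W/64\<close> about a point at distance \<open>3W/64\<close> from \<open>x\<close>, with \<open>W = wt x\<close>, lies in
  \<open>W/32 \<le> |y-x| \<le> W/16\<close>, where \<open>\<rho>\<close> is between \<open>1/2048\<close> and \<open>1/96\<close>. Its volume is a fixed
  multiple of \<open>W^n\<close>.\<close>

lemma hyp_integral_lower_bound:
  fixes x :: "real ^ 'n"
  assumes x: "x \<in> ball 0 1" and \<phi>: "profile (CARD('n)) C \<phi>"
    and c: "0 \<le> c" "\<And>t. 1/2048 \<le> t \<Longrightarrow> t \<le> 1/96 \<Longrightarrow> c \<le> \<phi> t"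
  shows "c * (unit_ball_vol (real CARD('n)) / 96 ^ CARD('n)) \<le> hyp_integral \<phi> x (\<lambda>_. 1)"
proof -
  define W where "W = wt x"
  have W: "0 < W" using wt_pos x by (simp add: W_def)
  define v where "v = axis (undefined :: 'n) (1 :: real)"
  have v: "norm v = 1" by (simp add: v_def norm_axis_1)
  define z where "z = x + (3 * W / 64) *\<^sub>R v"
  let ?n = "CARD('n)"
  have in_ball: "y \<in> ball 0 1 \<and> c / (3 / 2 * W) ^ ?n \<le> hyp_kernel \<phi> x y" if y: "y \<in> ball z (W / 64)" for y
  proof -
    have n1: "norm (z - x) = 3 * W / 64" using v W by (simp add: z_def)
    have n2: "norm (y - z) < W / 64" using y by (simp add: dist_norm norm_minus_commute)
    have n3: "norm (y - x) \<le> norm (y - z) + norm (z - x)"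
      using norm_triangle_ineq[of "y - z" "z - x"] by simp
    have n4: "norm (z - x) \<le> norm (y - z) + norm (y - x)"
      using norm_triangle_ineq[of "z - y" "y - x"] by (simp add: norm_minus_commute)
    have d: "W / 32 \<le> norm (y - x)" "norm (y - x) \<le> W / 16"
      using n1 n2 n3 n4 by auto
    have yb: "y \<in> ball 0 1" "W / 2 \<le> wt y" "wt y \<le> 3 / 2 * W"
      using near_in_ball[OF x, of y] d W by (auto simp: W_def)
    have wy: "0 < wt y" using yb W by simp
    have D: "(W / 32)\<^sup>2 \<le> (norm (y - x))\<^sup>2" "(norm (y - x))\<^sup>2 \<le> (W / 16)\<^sup>2"
      using d W by (auto intro: power_mono)
    have "1/2048 \<le> sinh2_dist x y"
    proof -
      have "1/2048 * (W * wt y) \<le> 1/2048 * (W * (2 * W))" using yb W by (intro mult_left_mono) auto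
      also have "\<dots> = (W / 32)\<^sup>2" by (simp add: power2_eq_square)
      also note D(1)
      finally show ?thesis using W wy by (simp add: sinh2_dist_def W_def[symmetric] le_divide_eq)
    qed
    moreover have "sinh2_dist x y \<le> 1/96"
    proof -
      have "(norm (y - x))\<^sup>2 \<le> 1/128 * (W * (W / 2))" using D(2) by (simp add: power2_eq_square)
      also have "\<dots> \<le> 1/96 * (W * wt y)" using yb W by (intro mult_mono) auto
      finally show ?thesis using W wy by (simp add: sinh2_dist_def W_def[symmetric] divide_le_eq)
    qed
    ultimately have "c \<le> \<phi> (sinh2_dist x y)" by (rule c(2))
    then have "c / (3 / 2 * W) ^ ?n \<le> \<phi> (sinh2_dist x y) / wt y ^ ?n"
      using c wy yb by (intro frac_le power_mono) auto
    then show ?thesis using yb by (simp add: hyp_kernel_def)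
  qed
  have prof: "continuous_on {0..} \<phi>" "\<And>t. 1/24 \<le> t \<Longrightarrow> \<phi> t = 0" "\<And>t. 0 \<le> t \<Longrightarrow> 0 \<le> \<phi> t"
    using \<phi> by (auto simp: profile_def)
  have nn: "0 \<le> hyp_kernel \<phi> x y" if "y \<in> ball 0 1" for y
    using prof(3)[OF sinh2_dist_nonneg[OF x that]] wt_pos[OF that] by (simp add: hyp_kernel_def)
  have "integrable lborel (indicator (ball z (W / 64)) :: real ^ 'n \<Rightarrow> real)"
    using emeasure_lborel_ball_finite by (intro integrable_real_indicator) auto
  then have i1: "integrable lborel (\<lambda>y :: real ^ 'n. c / (3 / 2 * W) ^ ?n * indicator (ball z (W / 64)) y)"
    by (rule integrable_mult_right)
  have i2: "integrable lborel (\<lambda>y. indicator (ball 0 1) y * (1 * hyp_kernel \<phi> x y))"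
    by (rule hyp_integral_integrable[OF x prof(1,2)]) auto
  have "integral\<^sup>L lborel (\<lambda>y :: real ^ 'n. c / (3 / 2 * W) ^ ?n * indicator (ball z (W / 64)) y) \<le> hyp_integral \<phi> x (\<lambda>_. 1)"
    unfolding hyp_integral_def
  proof (rule integral_mono[OF i1 i2])
    fix y
    show "c / (3 / 2 * W) ^ ?n * indicator (ball z (W / 64)) y \<le> indicator (ball 0 1) y * (1 * hyp_kernel \<phi> x y)"
      using in_ball[of y] nn[of y] by (cases "y \<in> ball z (W / 64)") (auto simp: indicator_def)
  qed
  moreover have "integral\<^sup>L lborel (\<lambda>y :: real ^ 'n. c / (3 / 2 * W) ^ ?n * indicator (ball z (W / 64)) y)
     = c / (3 / 2 * W) ^ ?n * (unit_ball_vol (real ?n) * (W / 64) ^ ?n)"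
    using W by (simp add: content_ball)
  moreover have "\<dots> = c * (unit_ball_vol (real ?n) / 96 ^ ?n)"
  proof -
    have "(W / 64) ^ ?n = (3 / 2 * W) ^ ?n / 96 ^ ?n"
      unfolding power_divide[symmetric] by simp
    then show ?thesis using W by simp
  qed
  ultimately show ?thesis by (simp only:)
qed

text \<open>With \<open>r\<^sup>2 = \<rho>\<close> one has \<open>1/r \<le> 2 wt x / |y-x|\<close> on the support.\<close>

lemma hyp_kernel_le:
  fixes x y :: "real ^ 'n"
  assumes x: "x \<in> ball 0 1" and y: "y \<in> ball 0 1" "y \<noteq> x" and \<phi>: "profile (CARD('n)) C \<phi>"
  shows "\<bar>hyp_kernel \<phi> x y\<bar> \<le> 2 * C * 4 ^ CARD('n) / wt x ^ CARD('n) *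
     (indicator (cball x (wt x)) y * (wt x / norm (y - x)) ^ (CARD('n) - 1))"
proof (cases "y \<in> cball x (wt x / 4)")
  case False
  then have "hyp_kernel \<phi> x y = 0"
    using hyp_kernel_eq_0[OF x, of \<phi> y] \<phi> y by (auto simp: profile_def)
  then show ?thesis using profile_const_nonneg[OF \<phi>] wt_pos[OF x] by simp
next
  case True
  define n where "n = CARD('n)"
  have n: "n \<ge> 1" by (simp add: n_def Suc_leI)
  define W d where "W = wt x" and "d = norm (y - x)"
  have W: "0 < W" using wt_pos x by (simp add: W_def)
  have d: "0 < d" using y by (simp add: d_def)
  have wy: "W / 2 \<le> wt y" "wt y \<le> 3 / 2 * W"
    using near_in_ball[OF x, of y] True by (auto simp: W_def dist_norm norm_minus_commute)
  have C: "0 \<le> C" using profile_const_nonneg[OF \<phi>] .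
  define r where "r = d / sqrt (W * wt y)"
  have s: "0 < sqrt (W * wt y)" using W wy by simp
  have r: "0 < r" using d s by (simp add: r_def)
  have rho: "sinh2_dist x y = r\<^sup>2" using W wy by (simp add: r_def sinh2_dist_def power_divide d_def W_def)
  have sW: "sqrt (W * wt y) \<le> 2 * W"
  proof (rule real_le_lsqrt)
    have "W * wt y \<le> W * (4 * W)" using W wy by (intro mult_left_mono) auto
    then show "W * wt y \<le> (2 * W)\<^sup>2" by (simp add: power2_eq_square)
  qed (use W wy in auto)
  have "\<phi> (sinh2_dist x y) \<le> 2 * C / r ^ (n - 1)"
    unfolding rho by (rule profile_le[OF \<phi>[folded n_def] n r])
  also have "\<dots> = 2 * C * (1 / r) ^ (n - 1)" by (simp add: power_divide)
  also have "\<dots> \<le> 2 * C * (2 * (W / d)) ^ (n - 1)"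
  proof (intro mult_left_mono power_mono)
    have "1 / r = sqrt (W * wt y) / d" by (simp add: r_def)
    also have "\<dots> \<le> 2 * W / d" using sW d by (intro divide_right_mono) auto
    finally show "1 / r \<le> 2 * (W / d)" by simp
  qed (use C r in auto)
  also have "\<dots> \<le> 2 * C * (2 ^ n * (W / d) ^ (n - 1))"
    unfolding power_mult_distrib[of 2] using C W d
    by (intro mult_left_mono mult_right_mono power_increasing) auto
  finally have ph: "\<phi> (sinh2_dist x y) \<le> 2 * C * (2 ^ n * (W / d) ^ (n - 1))" .
  have "0 \<le> \<phi> (sinh2_dist x y)" using \<phi> sinh2_dist_nonneg[OF x y(1)] by (simp add: profile_def)
  then have "\<bar>hyp_kernel \<phi> x y\<bar> = \<phi> (sinh2_dist x y) / wt y ^ n"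
    using W wy by (simp add: hyp_kernel_def n_def)
  also have "\<dots> \<le> (2 * C * (2 ^ n * (W / d) ^ (n - 1))) / (W / 2) ^ n"
    using ph W wy C d by (intro frac_le power_mono) auto
  also have "\<dots> = 2 * C * 4 ^ n / W ^ n * (W / d) ^ (n - 1)"
    using W by (simp add: power_divide field_simps flip: power_mult_distrib)
  finally show ?thesis using True W by (simp add: n_def W_def d_def)
qed

section \<open>Differences of kernels at nearby points\<close>

text \<open>The functions \<open>r = sqrt \<rho>\<close> for \<open>x\<close> and for \<open>x'\<close> differ by at most \<open>6 |x-x'| / wt x\<close> on the union of
  the supports. The second claim locates that union and controls the weight there.\<close>

lemma hyp_kernel_diff_le:
  fixes x x' y :: "real ^ 'n"
  assumes x: "x \<in> ball 0 1" and x': "x' \<in> ball 0 1" and near: "norm (x - x') \<le> wt x / 16"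
    and y: "y \<in> ball 0 1" "y \<noteq> x" "y \<noteq> x'" and \<phi>: "profile (CARD('n)) C \<phi>"
  shows "\<bar>hyp_kernel \<phi> x y - hyp_kernel \<phi> x' y\<bar> \<le> 12 * C * 8 ^ CARD('n) * (norm (x - x') / wt x) / wt x ^ CARD('n) *
     (indicator (cball x (wt x)) y * (wt x / norm (y - x)) ^ (CARD('n) - 1)
      + indicator (cball x' (wt x)) y * (wt x / norm (y - x')) ^ (CARD('n) - 1))" (is ?le)
    and "hyp_kernel \<phi> x y \<noteq> hyp_kernel \<phi> x' y \<Longrightarrow> norm (y - x) \<le> wt x \<and> wt y \<le> 2 * wt x"
proof -
  define n where "n = CARD('n)"
  have n: "n \<ge> 1" by (simp add: n_def Suc_leI)
  define W W' w \<delta> where "W = wt x" and "W' = wt x'" and "w = wt y" and "\<delta> = norm (x - x')"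
  define d d' where "d = norm (y - x)" and "d' = norm (y - x')"
  have W: "0 < W" "0 < W'" "0 < w" using wt_pos x x' y by (auto simp: W_def W'_def w_def)
  have d: "0 < d" "0 < d'" "0 \<le> \<delta>" using y by (auto simp: d_def d'_def \<delta>_def)
  have dd: "\<bar>d - d'\<bar> \<le> \<delta>"
    using norm_triangle_ineq3[of "y - x" "y - x'"]
    by (simp add: d_def d'_def \<delta>_def norm_minus_commute)
  have WW: "\<bar>W - W'\<bar> \<le> 2 * \<delta>" using wt_diff[of x x'] x x' by (simp add: W_def W'_def \<delta>_def)
  have \<delta>: "\<delta> \<le> W / 16" using near by (simp add: \<delta>_def W_def)
  have W': "7 / 8 * W \<le> W'" "W' \<le> 9 / 8 * W" using WW \<delta> by (auto simp: abs_le_iff)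
  have C: "0 \<le> C" using profile_const_nonneg[OF \<phi>] .
  have prof: "\<And>t. 1/24 \<le> t \<Longrightarrow> \<phi> t = 0" using \<phi> by (simp add: profile_def)
  have support: "d \<le> W \<and> d' \<le> W \<and> 7 / 16 * W \<le> w \<and> w \<le> 2 * W" if ne: "hyp_kernel \<phi> x y \<noteq> hyp_kernel \<phi> x' y"
  proof -
    have "hyp_kernel \<phi> x y \<noteq> 0 \<or> hyp_kernel \<phi> x' y \<noteq> 0" using ne by auto
    then show ?thesis
    proof
      assume "hyp_kernel \<phi> x y \<noteq> 0"
      then have "y \<in> cball x (wt x / 4)" using hyp_kernel_eq_0[where \<phi>=\<phi> and y=y, OF x prof] y by auto
      then have "d \<le> W / 4" by (simp add: d_def W_def dist_norm norm_minus_commute)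
      moreover have "W / 2 \<le> w" "w \<le> 3 / 2 * W"
        using near_in_ball[OF x, of y] calculation by (auto simp: d_def W_def w_def)
      ultimately show ?thesis using dd \<delta> W by (auto simp: abs_le_iff)
    next
      assume "hyp_kernel \<phi> x' y \<noteq> 0"
      then have "y \<in> cball x' (wt x' / 4)" using hyp_kernel_eq_0[where \<phi>=\<phi> and y=y, OF x' prof] y by auto
      then have "d' \<le> W' / 4" by (simp add: d'_def W'_def dist_norm norm_minus_commute)
      moreover have "W' / 2 \<le> w" "w \<le> 3 / 2 * W'"
        using near_in_ball[OF x', of y] calculation by (auto simp: d'_def W'_def w_def)
      ultimately show ?thesis using dd \<delta> W W' by (auto simp: abs_le_iff)
    qed
  qed
  show "norm (y - x) \<le> wt x \<and> wt y \<le> 2 * wt x" if "hyp_kernel \<phi> x y \<noteq> hyp_kernel \<phi> x' y"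
    using support[OF that] by (simp add: d_def W_def w_def)
  show ?le
  proof (cases "hyp_kernel \<phi> x y = hyp_kernel \<phi> x' y")
    case True
    then show ?thesis using C W by (auto simp: W_def[symmetric] intro!: mult_nonneg_nonneg add_nonneg_nonneg)
  next
    case False
    note S = support[OF False]
    \<comment> \<open>With \<open>r = d/(ac)\<close> and \<open>r' = d'/(bc)\<close> the change of \<open>d\<close> and the change of
      the weight under the root are estimated separately.\<close>
    define a b c where "a = sqrt W" and "b = sqrt W'" and "c = sqrt w"
    have p: "0 < a" "0 < b" "0 < c" using W by (auto simp: a_def b_def c_def)
    have sq: "a * a = W" "b * b = W'" "c * c = w" using W by (auto simp: a_def b_def c_def)
    define r r' where "r = d / (a * c)" and "r' = d' / (b * c)"
    have r: "0 < r" "0 < r'" using p d by (auto simp: r_def r'_def)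
    have rho: "sinh2_dist x y = r\<^sup>2" "sinh2_dist x' y = r'\<^sup>2"
      by (simp_all add: r_def r'_def sinh2_dist_def power_divide power_mult_distrib power2_eq_square
          d_def[symmetric] d'_def[symmetric] W_def[symmetric] W'_def[symmetric] w_def[symmetric]
          sq[symmetric] mult_ac)
    have ac: "W / 2 \<le> a * c" "W / 2 \<le> b * c" "a * c \<le> 2 * W" "b * c \<le> 2 * W"
    proof -
      have m: "a * c = sqrt (W * w)" "b * c = sqrt (W' * w)"
        by (simp_all add: a_def b_def c_def real_sqrt_mult)
      have "(W / 2)\<^sup>2 = W * (W / 4)" by (simp add: power2_eq_square)
      also have "\<dots> \<le> W * w" using S W by (intro mult_left_mono) auto
      finally show "W / 2 \<le> a * c" unfolding m by (rule real_le_rsqrt)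
      have "(W / 2)\<^sup>2 \<le> (7 / 8 * W) * (7 / 16 * W)" using W by (simp add: power2_eq_square)
      also have "\<dots> \<le> W' * w" using S W W' by (intro mult_mono) auto
      finally show "W / 2 \<le> b * c" unfolding m by (rule real_le_rsqrt)
      have "W * w \<le> W * (4 * W)" using S W by (intro mult_left_mono) auto
      then show "a * c \<le> 2 * W" unfolding m using W
        by (intro real_le_lsqrt) (auto simp: power2_eq_square)
      have "W' * w \<le> (2 * W) * (2 * W)" using S W W' by (intro mult_mono) auto
      then show "b * c \<le> 2 * W" unfolding m using W
        by (intro real_le_lsqrt) (auto simp: power2_eq_square)
    qed
    have rr: "\<bar>r - r'\<bar> \<le> 6 * (\<delta> / W)"
    proof -
      have e1: "r - r' = (d - d') / (a * c) + d' * (b - a) / (a * b * c)"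
        using p by (simp add: r_def r'_def field_simps)
      have e2: "\<bar>(d - d') / (a * c)\<bar> \<le> \<delta> / (W / 2)"
        unfolding abs_divide using dd ac p W d by (intro frac_le) (auto simp: abs_mult)
      have e3: "\<bar>d' * (b - a) / (a * b * c)\<bar> \<le> 2 * \<delta> / (W / 2)"
      proof -
        have "(b - a) * (b + a) = W' - W" using sq by (simp add: algebra_simps)
        then have "\<bar>b - a\<bar> * (b + a) \<le> 2 * \<delta>"
          using WW p by (metis abs_minus_commute abs_mult abs_of_pos add_pos_pos)
        moreover have "\<bar>b - a\<bar> * a \<le> \<bar>b - a\<bar> * (b + a)" using p by (intro mult_left_mono) auto
        ultimately have ba: "\<bar>b - a\<bar> * a \<le> 2 * \<delta>" by linarith
        have "\<bar>d' * (b - a) / (a * b * c)\<bar> = d' * \<bar>b - a\<bar> / (a * (b * c))"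
          using p d by (simp add: abs_mult)
        also have "\<dots> \<le> (a * a) * \<bar>b - a\<bar> / (a * (b * c))"
          using S p sq by (intro divide_right_mono mult_right_mono) auto
        also have "\<dots> = (\<bar>b - a\<bar> * a) / (b * c)" using p by (simp add: field_simps)
        also have "\<dots> \<le> 2 * \<delta> / (W / 2)" using ba ac W d by (intro frac_le) auto
        finally show ?thesis .
      qed
      have "\<bar>r - r'\<bar> \<le> \<delta> / (W / 2) + 2 * \<delta> / (W / 2)"
        unfolding e1 by (rule order_trans[OF abs_triangle_ineq add_mono[OF e2 e3]])
      also have "\<dots> = 6 * (\<delta> / W)" by simp
      finally show ?thesis .
    qed
    have inv: "(1 / r) ^ (n - 1) \<le> 2 ^ n * (W / d) ^ (n - 1)" "(1 / r') ^ (n - 1) \<le> 2 ^ n * (W / d') ^ (n - 1)"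
    proof -
      have gen: "(1 / (e / q)) ^ (n - 1) \<le> 2 ^ n * (W / e) ^ (n - 1)" if "0 < e" "0 < q" "q \<le> 2 * W" for e q
      proof -
        have "(1 / (e / q)) ^ (n - 1) \<le> (2 * (W / e)) ^ (n - 1)"
          using that W by (intro power_mono) (auto simp: divide_right_mono)
        also have "\<dots> \<le> 2 ^ n * (W / e) ^ (n - 1)"
          unfolding power_mult_distrib[of 2] using that W
          by (intro mult_right_mono power_increasing) auto
        finally show ?thesis .
      qed
      show "(1 / r) ^ (n - 1) \<le> 2 ^ n * (W / d) ^ (n - 1)" "(1 / r') ^ (n - 1) \<le> 2 ^ n * (W / d') ^ (n - 1)"
        unfolding r_def r'_def using p d ac by - (rule gen; simp)+
    qed
    let ?S = "(W / d) ^ (n - 1) + (W / d') ^ (n - 1)"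
    have S0: "0 \<le> ?S" using W d by simp
    have "\<bar>\<phi> (r\<^sup>2) - \<phi> (r'\<^sup>2)\<bar> \<le> 2 * C * \<bar>r - r'\<bar> * (1 / r ^ (n - 1) + 1 / r' ^ (n - 1))"
      by (rule profile_lipschitz[OF \<phi>[folded n_def] n r])
    also have "\<dots> \<le> 2 * C * (6 * (\<delta> / W)) * (2 ^ n * ?S)"
      using inv rr C r W d by (intro mult_mono) (auto simp: power_divide distrib_left)
    also have "\<dots> = 12 * C * 2 ^ n * (\<delta> / W) * ?S" by simp
    finally have P: "\<bar>\<phi> (r\<^sup>2) - \<phi> (r'\<^sup>2)\<bar> \<le> 12 * C * 2 ^ n * (\<delta> / W) * ?S" .
    have "\<bar>hyp_kernel \<phi> x y - hyp_kernel \<phi> x' y\<bar> = \<bar>\<phi> (r\<^sup>2) - \<phi> (r'\<^sup>2)\<bar> / w ^ n"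
      using W by (simp add: hyp_kernel_def rho w_def n_def diff_divide_distrib[symmetric] abs_divide)
    also have "\<dots> \<le> 12 * C * 2 ^ n * (\<delta> / W) * ?S / (W / 4) ^ n"
      using P S W C d S0 by (intro frac_le power_mono) auto
    also have "\<dots> = 12 * C * (2 ^ n * 4 ^ n) * (\<delta> / W) / W ^ n * ?S"
      using W by (simp only: power_divide) simp
    also have "(2 :: real) ^ n * 4 ^ n = 8 ^ n" by (simp flip: power_mult_distrib)
    finally show ?thesis
      using S by (simp add: n_def W_def d_def d'_def \<delta>_def dist_norm norm_minus_commute)
  qed
qed

text \<open>The hypothesis on \<open>F\<close> is only required near \<open>x\<close>, on a region that contains the support of the
  kernel. It is used with \<open>h = 1\<close> for oscillations and with the \<open>L^p\<close> density of \<open>\<Delta>\<^sub>h u\<close>.\<close>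

lemma hyp_integral_le:
  fixes x :: "real ^ 'n"
  assumes x: "x \<in> ball 0 1" and \<phi>: "profile (CARD('n)) C \<phi>" and F: "continuous_on (ball 0 1) F"
    and Q: "0 \<le> Q" "\<And>y. y \<in> ball 0 1 \<Longrightarrow> norm (y - x) \<le> wt x \<Longrightarrow> wt y \<le> 2 * wt x \<Longrightarrow> \<bar>F y\<bar> \<le> Q * \<bar>h y\<bar>"
    and hR: "riesz_le h x (wt x) D"
  shows "\<bar>hyp_integral \<phi> x F\<bar> \<le> 2 * C * 4 ^ CARD('n) / wt x ^ CARD('n) * Q * D"
proof -
  let ?n = "CARD('n)"
  note h = hR[unfolded riesz_le_def, THEN conjunct1] hR[unfolded riesz_le_def, THEN conjunct2]
  let ?R = "\<lambda>y. indicator (cball x (wt x)) y * (\<bar>h y\<bar> * (wt x / norm (y - x)) ^ (?n - 1))"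
  let ?K = "2 * C * 4 ^ ?n / wt x ^ ?n"
  have W: "0 < wt x" using wt_pos x by blast
  have K: "0 \<le> ?K" using profile_const_nonneg[OF \<phi>] W by simp
  have prof: "continuous_on {0..} \<phi>" "\<And>t. 1/24 \<le> t \<Longrightarrow> \<phi> t = 0" using \<phi> by (auto simp: profile_def)
  have int: "integrable lborel (\<lambda>y. indicator (ball 0 1) y * (F y * hyp_kernel \<phi> x y))"
    by (rule hyp_integral_integrable[OF x prof F])
  have le: "\<bar>indicator (ball 0 1) y * (F y * hyp_kernel \<phi> x y)\<bar> \<le> ?K * Q * ?R y" if "y \<noteq> x" for y
  proof (cases "y \<in> ball 0 1 \<and> hyp_kernel \<phi> x y \<noteq> 0")
    case True
    then have "y \<in> cball x (wt x / 4)" using hyp_kernel_eq_0[where \<phi>=\<phi> and y=y, OF x prof(2)] by auto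
    then have n4: "norm (y - x) \<le> wt x / 4" by (simp add: dist_norm norm_minus_commute)
    then have "\<bar>F y\<bar> \<le> Q * \<bar>h y\<bar>"
      using near_in_ball[OF x n4] W by (intro Q) auto
    then have "\<bar>F y\<bar> * \<bar>hyp_kernel \<phi> x y\<bar> \<le> (Q * \<bar>h y\<bar>) * (?K * (indicator (cball x (wt x)) y * (wt x / norm (y - x)) ^ (?n - 1)))"
      using True that Q by (intro mult_mono hyp_kernel_le[OF x _ _ \<phi>]) auto
    then show ?thesis using True by (simp add: abs_mult mult_ac)
  next
    case False
    have "0 \<le> ?K * Q * ?R y" using K Q W by (intro mult_nonneg_nonneg) auto
    then show ?thesis using False by auto
  qed
  have "\<bar>hyp_integral \<phi> x F\<bar> \<le> integral\<^sup>L lborel (\<lambda>y. \<bar>indicator (ball 0 1) y * (F y * hyp_kernel \<phi> x y)\<bar>)"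
    unfolding hyp_integral_def using integral_norm_bound[of lborel "\<lambda>y. indicator (ball 0 1) y * (F y * hyp_kernel \<phi> x y)"] by simp
  also have "\<dots> \<le> integral\<^sup>L lborel (\<lambda>y. ?K * Q * ?R y)"
  proof (rule integral_mono_AE)
    show "integrable lborel (\<lambda>y. ?K * Q * ?R y)" by (rule integrable_mult_right[OF h(1)])
    show "AE y in lborel. \<bar>indicator (ball 0 1) y * (F y * hyp_kernel \<phi> x y)\<bar> \<le> ?K * Q * ?R y"
      using AE_lborel_singleton[of x] by eventually_elim (rule le)
  qed (rule integrable_abs[OF int])
  also have "\<dots> = ?K * Q * integral\<^sup>L lborel ?R" by simp
  also have "\<dots> \<le> ?K * Q * D" by (rule mult_left_mono[OF h(2) mult_nonneg_nonneg[OF K Q(1)]])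
  finally show ?thesis .
qed

lemma hyp_integral_diff_le:
  fixes x x' :: "real ^ 'n"
  assumes x: "x \<in> ball 0 1" and x': "x' \<in> ball 0 1" and near: "norm (x - x') \<le> wt x / 16"
    and \<phi>: "profile (CARD('n)) C \<phi>" and F: "continuous_on (ball 0 1) F"
    and Q: "0 \<le> Q" "\<And>y. y \<in> ball 0 1 \<Longrightarrow> norm (y - x) \<le> wt x \<Longrightarrow> wt y \<le> 2 * wt x \<Longrightarrow> \<bar>F y\<bar> \<le> Q * \<bar>h y\<bar>"
    and hR: "\<And>z. riesz_le h z (wt x) D"
  shows "\<bar>hyp_integral \<phi> x F - hyp_integral \<phi> x' F\<bar> \<le> 24 * C * 8 ^ CARD('n) * (norm (x - x') / wt x) / wt x ^ CARD('n) * Q * D"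
proof -
  let ?n = "CARD('n)"
  note h = hR[unfolded riesz_le_def, THEN conjunct1] hR[unfolded riesz_le_def, THEN conjunct2]
  let ?R = "\<lambda>z y. indicator (cball z (wt x)) y * (\<bar>h y\<bar> * (wt x / norm (y - z)) ^ (?n - 1))"
  let ?K = "12 * C * 8 ^ ?n * (norm (x - x') / wt x) / wt x ^ ?n"
  let ?f = "\<lambda>y. indicator (ball 0 1) y * (F y * hyp_kernel \<phi> x y) - indicator (ball 0 1) y * (F y * hyp_kernel \<phi> x' y)"
  have W: "0 < wt x" using wt_pos x by blast
  have K: "0 \<le> ?K" using profile_const_nonneg[OF \<phi>] W by simp
  have prof: "continuous_on {0..} \<phi>" "\<And>t. 1/24 \<le> t \<Longrightarrow> \<phi> t = 0" using \<phi> by (auto simp: profile_def)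
  note I = hyp_integral_integrable[OF x prof F] hyp_integral_integrable[OF x' prof F]
  have int: "integrable lborel ?f" by (rule Bochner_Integration.integrable_diff[OF I])
  have le: "\<bar>?f y\<bar> \<le> ?K * Q * (?R x y + ?R x' y)" if "y \<noteq> x" "y \<noteq> x'" for y
  proof (cases "y \<in> ball 0 1 \<and> hyp_kernel \<phi> x y \<noteq> hyp_kernel \<phi> x' y")
    case True
    then have yb: "y \<in> ball 0 1" and ne: "hyp_kernel \<phi> x y \<noteq> hyp_kernel \<phi> x' y" by auto
    have "\<bar>F y\<bar> \<le> Q * \<bar>h y\<bar>"
      using hyp_kernel_diff_le(2)[OF x x' near yb that \<phi> ne] yb by (intro Q) auto
    then have "\<bar>F y\<bar> * \<bar>hyp_kernel \<phi> x y - hyp_kernel \<phi> x' y\<bar> \<le> (Q * \<bar>h y\<bar>) *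
      (?K * (indicator (cball x (wt x)) y * (wt x / norm (y - x)) ^ (?n - 1)
      + indicator (cball x' (wt x)) y * (wt x / norm (y - x')) ^ (?n - 1)))"
      using Q by (intro mult_mono hyp_kernel_diff_le(1)[OF x x' near yb that \<phi>]) auto
    also have "\<dots> = ?K * Q * (?R x y + ?R x' y)" by (simp only: algebra_simps)
    finally show ?thesis using yb by (simp add: abs_mult[symmetric] algebra_simps)
  next
    case False
    have "0 \<le> ?K * Q * (?R x y + ?R x' y)"
      using K Q W by (intro mult_nonneg_nonneg add_nonneg_nonneg) auto
    then show ?thesis using False by auto
  qed
  have "hyp_integral \<phi> x F - hyp_integral \<phi> x' F = integral\<^sup>L lborel ?f"
    unfolding hyp_integral_def by (rule Bochner_Integration.integral_diff[OF I, symmetric])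
  then have "\<bar>hyp_integral \<phi> x F - hyp_integral \<phi> x' F\<bar> \<le> integral\<^sup>L lborel (\<lambda>y. \<bar>?f y\<bar>)"
    using integral_norm_bound[of lborel ?f] by simp
  also have "\<dots> \<le> integral\<^sup>L lborel (\<lambda>y. ?K * Q * (?R x y + ?R x' y))"
  proof (rule integral_mono_AE)
    show "integrable lborel (\<lambda>y. ?K * Q * (?R x y + ?R x' y))"
      by (intro integrable_mult_right Bochner_Integration.integrable_add h(1))
    show "AE y in lborel. \<bar>?f y\<bar> \<le> ?K * Q * (?R x y + ?R x' y)"
      using AE_lborel_singleton[of x] AE_lborel_singleton[of x'] by eventually_elim (rule le)
  qed (rule integrable_abs[OF int])
  also have "\<dots> = ?K * Q * (integral\<^sup>L lborel (?R x) + integral\<^sup>L lborel (?R x'))"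
    using h(1) by simp
  also have "\<dots> \<le> ?K * Q * (D + D)" by (rule mult_left_mono[OF add_mono[OF h(2) h(2)] mult_nonneg_nonneg[OF K Q(1)]])
  also have "\<dots> = 24 * C * 8 ^ ?n * (norm (x - x') / wt x) / wt x ^ ?n * Q * D" by simp
  finally show ?thesis .
qed

section \<open>The regularised mean value formula\<close>

lemma continuous_on_hyp_laplacian:
  assumes "C2_on S u"
  shows "continuous_on S (hyp_laplacian u)"
  unfolding hyp_laplacian_def[abs_def] laplacian_def
  using assms unfolding C2_on_def C1_on_def
  by (intro continuous_intros) auto

lemma hyp_laplacian_linear:
  fixes u v :: "real ^ 'n \<Rightarrow> real"
  assumes "open S" "C2_on S u" "C2_on S v"
  shows "C2_on S (\<lambda>y. a * u y + b * v y + c)"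
    and "y \<in> S \<Longrightarrow> hyp_laplacian (\<lambda>y. a * u y + b * v y + c) y = a * hyp_laplacian u y + b * hyp_laplacian v y"
proof -
  note hu = C2_on_has_hessian_on[OF assms(2)] and hv = C2_on_has_hessian_on[OF assms(3)]
  note h = has_hessian_on_add[OF has_hessian_on_add[OF
        has_hessian_on_mult[OF has_hessian_on_const hu] has_hessian_on_mult[OF has_hessian_on_const hv]]
      has_hessian_on_const, of a b c]
  show "C2_on S (\<lambda>y. a * u y + b * v y + c)" by (rule has_hessian_on_C2_on[OF h assms(1)])
  assume y: "y \<in> S"
  show "hyp_laplacian (\<lambda>y. a * u y + b * v y + c) y = a * hyp_laplacian u y + b * hyp_laplacian v y"
  proof -
    let ?U = "\<lambda>i. partial_deriv i u y" and ?V = "\<lambda>i. partial_deriv i v y"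
    let ?U' = "\<lambda>i. partial_deriv i (partial_deriv i u) y" and ?V' = "\<lambda>i. partial_deriv i (partial_deriv i v) y"
    have "hyp_laplacian (\<lambda>y. a * u y + b * v y + c) y
       = (1 - (norm y)\<^sup>2)\<^sup>2 * (\<Sum>i\<in>UNIV. a * ?U' i + b * ?V' i)
       + 2 * (real CARD('n) - 2) * (1 - (norm y)\<^sup>2) * (\<Sum>i\<in>UNIV. y $ i * (a * ?U i + b * ?V i))"
      using has_hessian_on_hyp_laplacian[OF h assms(1) y] by simp
    also have "(\<Sum>i\<in>UNIV. a * ?U' i + b * ?V' i) = a * sum ?U' UNIV + b * sum ?V' UNIV"
      by (simp only: sum.distrib sum_distrib_left)
    also have "(\<Sum>i\<in>UNIV. y $ i * (a * ?U i + b * ?V i))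
       = a * (\<Sum>i\<in>UNIV. y $ i * ?U i) + b * (\<Sum>i\<in>UNIV. y $ i * ?V i)"
      unfolding sum_distrib_left sum.distrib[symmetric] by (intro sum.cong refl) (simp add: algebra_simps)
    finally show ?thesis unfolding hyp_laplacian_def laplacian_def by (simp add: algebra_simps)
  qed
qed

lemma C2_on_const: "C2_on S (\<lambda>_. c :: real)" if "open S"
  by (rule has_hessian_on_C2_on[OF has_hessian_on_const that])

lemma hyp_laplacian_const: "hyp_laplacian (\<lambda>_. c) y = 0"
  using has_hessian_on_hyp_laplacian[OF has_hessian_on_const[of UNIV]] by simp

lemma inner_kernel_props:
  assumes s: "0 < s"
  shows "continuous_on {0..} (inner_kernel n s)" "0 \<le> t \<Longrightarrow> 0 \<le> inner_kernel n s t"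
    "1/24 \<le> t \<Longrightarrow> inner_kernel n s t = 0"
proof -
  show "continuous_on {0..} (inner_kernel n s)"
    unfolding inner_kernel_def[abs_def] cutoff_def[abs_def]
    using reg_pos[OF s] s by (intro continuous_intros) (force simp: less_le)+
  show "0 \<le> t \<Longrightarrow> 0 \<le> inner_kernel n s t"
    using s cutoff_bounds(1)[of t] by (simp add: inner_kernel_def)
  show "1/24 \<le> t \<Longrightarrow> inner_kernel n s t = 0" by (simp add: inner_kernel_def cutoff_bounds)
qed

text \<open>Green's identity with the potential \<open>v = e(\<rho>(x, \<cdot>))\<close>. The equation
  \<open>4\<rho>(1+\<rho>) e'' + 2n(1+2\<rho>) e' = k - k'\<close> for the outer kernel \<open>k\<close> and the inner kernel \<open>k'\<close> follows by
  writing \<open>(P+s)^(-n/2) = (P+s) (P+s)^(-n/2-1)\<close> with \<open>P = \<rho>(1+\<rho>)\<close>: the terms with \<open>P\<close> cancel.\<close>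

lemma mean_value_formula:
  fixes u :: "real ^ 'n \<Rightarrow> real"
  assumes card: "CARD('n) \<ge> 3" and u: "C2_on (ball 0 1) u" and x: "x \<in> ball 0 1"
    and s: "0 < s" "s \<le> 1"
    and e: "\<And>t. 0 \<le> t \<Longrightarrow> (e has_real_derivative - flux CARD('n) s t) (at t)"
      "\<And>t. 1/24 \<le> t \<Longrightarrow> e t = 0"
  shows "hyp_integral (outer_kernel CARD('n) s) x u - hyp_integral (inner_kernel CARD('n) s) x u = hyp_integral e x (hyp_laplacian u)"
proof -
  let ?n = "CARD('n)" and ?B = "ball 0 1 :: (real ^ 'n) set"
  define e'' where "e'' t = 72 * cutoff t ^ 2 * (t * (1 + t) + s) powr (- real ?n / 2)
    + cutoff t ^ 3 * (real ?n / 2 * (1 + 2 * t) * (t * (1 + t) + s) powr (- real ?n / 2 - 1))" for t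
  have e': "((\<lambda>t. - flux ?n s t) has_real_derivative e'' t) (at t)" if "0 \<le> t" for t
    using DERIV_minus[OF DERIV_flux[OF s(1), of t ?n]] that s by (simp add: e''_def add.commute)
  have e''c: "continuous_on {0..} e''"
    unfolding e''_def[abs_def] cutoff_def[abs_def]
    using reg_pos[OF s(1)] s by (intro continuous_intros) (force simp: less_le)+
  define v where "v y = e (sinh2_dist x y)" for y
  have v: "C2_on ?B v" unfolding v_def[abs_def] by (rule hyp_laplacian_radial(1)[OF x e(1) e' e''c])
  have Lv: "hyp_laplacian v y = outer_kernel ?n s (sinh2_dist x y) - inner_kernel ?n s (sinh2_dist x y)"
    if y: "y \<in> ?B" for y
  proof -
    define t where "t = sinh2_dist x y"
    have t: "0 \<le> t" using sinh2_dist_nonneg[OF x y] by (simp add: t_def)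
    define P where "P = t * (1 + t)"
    define Q1 where "Q1 = (P + s) powr (- real ?n / 2 - 1)"
    have "0 \<le> P" using t by (simp add: P_def)
    then have Q: "(P + s) powr (- real ?n / 2) = (P + s) * Q1"
      using s by (simp add: Q1_def powr_mult_base)
    have "hyp_laplacian v y = 4 * P * e'' t + 2 * real ?n * (1 + 2 * t) * - flux ?n s t"
      unfolding v_def[abs_def] P_def t_def by (rule hyp_laplacian_radial(2)[OF x e(1) e' e''c y])
    also have "\<dots> = outer_kernel ?n s t - inner_kernel ?n s t"
      unfolding e''_def flux_def outer_kernel_def inner_kernel_def P_def[symmetric] Q
      unfolding Q1_def[symmetric]
      by (simp add: algebra_simps)
    finally show ?thesis by (simp add: t_def)
  qed
  have prof: "continuous_on {0..} (outer_kernel ?n s)" "\<And>t. 1/24 \<le> t \<Longrightarrow> outer_kernel ?n s t = 0"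
    using outer_kernel_profile(1)[OF s, of ?n] by (auto simp: profile_def)
  have ec: "continuous_on {0..} e"
    by (rule DERIV_continuous_on[where D="\<lambda>t. - flux ?n s t"]) (auto intro: has_field_derivative_at_within e)
  have uc: "continuous_on ?B u"
    using C2_on_has_hessian_on[OF u] has_gradient_on_continuous by (auto simp: has_hessian_on_def)
  note I1 = hyp_integral_integrable[OF x prof uc]
  note I2 = hyp_integral_integrable[OF x inner_kernel_props(1,3)[OF s(1)] uc, of ?n]
  note I3 = hyp_integral_integrable[OF x ec e(2) continuous_on_hyp_laplacian[OF u]]
  have "integral\<^sup>L lborel (\<lambda>y. indicator ?B y *
      ((u y * hyp_laplacian v y - v y * hyp_laplacian u y) / wt y ^ ?n)) = 0"
  proof (rule green_identity[OF card u v, of "cball x (wt x / 4)"])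
    fix y assume y: "y \<in> ?B - cball x (wt x / 4)"
    then have "1/24 \<le> sinh2_dist x y"
      using sinh2_dist_le_imp_near[OF x, of y] by (force simp: dist_norm norm_minus_commute)
    then show "v y = 0" by (simp add: v_def e(2))
  qed (use cball_near_subset[OF x] in auto)
  also have "(\<lambda>y. indicator ?B y * ((u y * hyp_laplacian v y - v y * hyp_laplacian u y) / wt y ^ ?n))
     = (\<lambda>y. indicator ?B y * (u y * hyp_kernel (outer_kernel ?n s) x y) - indicator ?B y * (u y * hyp_kernel (inner_kernel ?n s) x y)
          - indicator ?B y * (hyp_laplacian u y * hyp_kernel e x y))"
  proof
    fix y
    show "indicator ?B y * ((u y * hyp_laplacian v y - v y * hyp_laplacian u y) / wt y ^ ?n)
     = indicator ?B y * (u y * hyp_kernel (outer_kernel ?n s) x y) - indicator ?B y * (u y * hyp_kernel (inner_kernel ?n s) x y)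
          - indicator ?B y * (hyp_laplacian u y * hyp_kernel e x y)"
      by (cases "y \<in> ?B") (simp_all add: Lv hyp_kernel_def v_def diff_divide_distrib right_diff_distrib)
  qed
  finally show ?thesis
    using I1 I2 I3 by (simp add: hyp_integral_def)
qed

lemma hyp_integral_linear:
  assumes "x \<in> ball 0 1" "continuous_on {0..} \<phi>" "\<And>t. 1/24 \<le> t \<Longrightarrow> \<phi> t = 0"
    and "continuous_on (ball 0 1) F" "continuous_on (ball 0 1) G"
  shows "hyp_integral \<phi> x (\<lambda>y. a * F y + b * G y) = a * hyp_integral \<phi> x F + b * hyp_integral \<phi> x G"
proof -
  note I = hyp_integral_integrable[OF assms(1-4)] hyp_integral_integrable[OF assms(1-3,5)]
  have "hyp_integral \<phi> x (\<lambda>y. a * F y + b * G y) = integral\<^sup>L lborel (\<lambda>y.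
     a * (indicator (ball 0 1) y * (F y * hyp_kernel \<phi> x y)) + b * (indicator (ball 0 1) y * (G y * hyp_kernel \<phi> x y)))"
    unfolding hyp_integral_def by (intro Bochner_Integration.integral_cong) (auto simp: algebra_simps)
  also have "\<dots> = a * hyp_integral \<phi> x F + b * hyp_integral \<phi> x G"
    unfolding hyp_integral_def using I by (subst Bochner_Integration.integral_add) auto
  finally show ?thesis .
qed

lemma hyp_integral_mono:
  assumes x: "x \<in> ball 0 1" and \<phi>: "continuous_on {0..} \<phi>" "\<And>t. 1/24 \<le> t \<Longrightarrow> \<phi> t = 0" "\<And>t. 0 \<le> t \<Longrightarrow> 0 \<le> \<phi> t"
    and F: "continuous_on (ball 0 1) F" and G: "continuous_on (ball 0 1) G"
    and le: "\<And>y. y \<in> ball 0 1 \<Longrightarrow> norm (y - x) \<le> wt x / 4 \<Longrightarrow> F y \<le> G y"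
  shows "hyp_integral \<phi> x F \<le> hyp_integral \<phi> x G"
  unfolding hyp_integral_def
proof (rule integral_mono[OF hyp_integral_integrable[OF x \<phi>(1,2) F] hyp_integral_integrable[OF x \<phi>(1,2) G]])
  fix y
  show "indicator (ball 0 1) y * (F y * hyp_kernel \<phi> x y) \<le> indicator (ball 0 1) y * (G y * hyp_kernel \<phi> x y)"
  proof (cases "y \<in> ball 0 1 \<and> hyp_kernel \<phi> x y \<noteq> 0")
    case True
    then have "y \<in> cball x (wt x / 4)" using hyp_kernel_eq_0[where \<phi>=\<phi> and y=y, OF x \<phi>(2)] by auto
    then have "F y \<le> G y" using True by (intro le) (auto simp: dist_norm norm_minus_commute)
    moreover have "0 \<le> hyp_kernel \<phi> x y"
      using True wt_pos[of y] \<phi>(3)[OF sinh2_dist_nonneg[OF x, of y]] by (simp add: hyp_kernel_def)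
    ultimately show ?thesis by (simp add: mult_left_mono mult_right_mono)
  qed auto
qed

lemma outer_mass_bounded:
  obtains A where "0 \<le> A" and "\<And>(x :: real ^ 'n) s. x \<in> ball 0 1 \<Longrightarrow> 0 < s \<Longrightarrow> s \<le> 1 \<Longrightarrow>
     \<bar>hyp_integral (outer_kernel CARD('n) s) x (\<lambda>_. 1)\<bar> \<le> A"
proof -
  obtain C1 where C1: "0 \<le> C1" and R: "\<And>(x :: real ^ 'n) W. 0 < W \<Longrightarrow> riesz_le (\<lambda>_. 1) x W (C1 * W ^ CARD('n))" using riesz_potential_bounded[where 'n='n] by blast
  let ?C = "288 * (50 + real CARD('n))"
  show ?thesis
  proof (rule that[of "2 * ?C * 4 ^ CARD('n) * C1"])
    fix x :: "real ^ 'n" and s :: real assume x: "x \<in> ball 0 1" and s: "0 < s" "s \<le> 1"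
    have W: "0 < wt x" using wt_pos x by blast
    have "\<bar>hyp_integral (outer_kernel CARD('n) s) x (\<lambda>_. 1)\<bar> \<le> 2 * ?C * 4 ^ CARD('n) / wt x ^ CARD('n) * 1 * (C1 * wt x ^ CARD('n))"
      by (rule hyp_integral_le[OF x outer_kernel_profile(1)[OF s], where h="\<lambda>_. 1"]) (use R[OF W] in auto)
    then show "\<bar>hyp_integral (outer_kernel CARD('n) s) x (\<lambda>_. 1)\<bar> \<le> 2 * ?C * 4 ^ CARD('n) * C1"
      using W by simp
  qed (use C1 in simp)
qed

text \<open>The mean value formula for the constant 1 shows that the inner kernel has the same mass as
  the outer one, which is bounded in \<open>s\<close>. Outside a neighbourhood of \<open>x\<close>, where \<open>F\<close> is small, the
  inner kernel is \<open>O(s)\<close>.\<close>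

lemma inner_kernel_limit:
  fixes x :: "real ^ 'n"
  assumes card: "CARD('n) \<ge> 3" and x: "x \<in> ball 0 1" and F: "continuous_on (ball 0 1) F" and Fx: "F x = 0"
  shows "((\<lambda>s. hyp_integral (inner_kernel CARD('n) s) x F) \<longlongrightarrow> 0) (at_right 0)"
proof (rule tendstoI)
  fix \<epsilon> :: real assume \<epsilon>: "0 < \<epsilon>"
  let ?n = "CARD('n)" and ?B = "ball 0 1 :: (real ^ 'n) set" and ?K = "cball x (wt x / 4)"
  define W where "W = wt x"
  have W: "0 < W" using wt_pos x by (simp add: W_def)
  obtain A where A: "0 \<le> A" "\<And>s. 0 < s \<Longrightarrow> s \<le> 1 \<Longrightarrow> \<bar>hyp_integral (outer_kernel ?n s) x (\<lambda>_. 1)\<bar> \<le> A"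
    using outer_mass_bounded[where 'n='n] x by metis
  have mass: "hyp_integral (inner_kernel ?n s) x (\<lambda>_. 1) \<le> A" if s: "0 < s" "s \<le> 1" for s
  proof -
    obtain e where e: "\<And>t. 0 \<le> t \<Longrightarrow> (e has_real_derivative - flux ?n s t) (at t)"
      and p: "profile ?n (288 * (50 + real ?n)) e" using potential_profile[OF s] by blast
    have "hyp_integral (outer_kernel ?n s) x (\<lambda>_. 1) - hyp_integral (inner_kernel ?n s) x (\<lambda>_. 1)
       = hyp_integral e x (hyp_laplacian (\<lambda>_. 1))"
      by (rule mean_value_formula[OF card C2_on_const x s e]) (use p in \<open>auto simp: profile_def\<close>)
    also have "\<dots> = 0" by (simp add: hyp_integral_def hyp_laplacian_const)
    finally show ?thesis using A(2)[OF s] by simp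
  qed
  define \<epsilon>' where "\<epsilon>' = \<epsilon> / (2 * (A + 1))"
  have \<epsilon>': "0 < \<epsilon>'" "\<epsilon>' * A < \<epsilon> / 2" using \<epsilon> A by (auto simp: \<epsilon>'_def field_simps)
  have "isCont F x" using F x by (simp add: continuous_on_eq_continuous_at)
  then obtain \<delta> where \<delta>: "0 < \<delta>" "\<And>y. norm (y - x) < \<delta> \<Longrightarrow> \<bar>F y\<bar> < \<epsilon>'"
    using \<epsilon>' Fx unfolding continuous_at_eps_delta dist_norm by (metis diff_zero real_norm_def)
  have "compact (F ` ?K)"
    using F cball_near_subset[OF x] by (intro compact_continuous_image) (auto intro: continuous_on_subset)
  then have "bounded (F ` ?K)" by (rule compact_imp_bounded)
  then obtain M where "\<forall>z\<in>F ` ?K. norm z \<le> M" unfolding bounded_iff ..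
  then have M: "\<bar>F y\<bar> \<le> M" if "y \<in> ?K" for y using that by auto
  have M0: "0 \<le> M" using M[of x] W by (auto simp: W_def)
  define \<rho> where "\<rho> = \<delta>\<^sup>2 / (W * (3 / 2 * W))"
  have \<rho>: "0 < \<rho>" using \<delta> W by (simp add: \<rho>_def)
  define L where "L = M * (4 * real ?n * \<rho> powr (- real ?n / 2 - 1) / (W / 2) ^ ?n)"
  have L: "0 \<le> L" using M0 W by (simp add: L_def)
  define V where "V = measure lborel ?K"
  have far: "inner_kernel ?n s t \<le> 4 * real ?n * s * \<rho> powr (- real ?n / 2 - 1)"
    if "0 < s" "\<rho> \<le> t" for s t
  proof (cases "t \<le> 1/24")
    case True
    have t: "0 \<le> t" using that \<rho> by simp
    have "\<rho> \<le> t * (1 + t) + s" using that mult_nonneg_nonneg[OF t t] by (simp only: distrib_left)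
    then have "(t * (1 + t) + s) powr (- real ?n / 2 - 1) \<le> \<rho> powr (- real ?n / 2 - 1)"
      using \<rho> by (intro powr_mono2') auto
    moreover have "cutoff t ^ 3 \<le> 1" using cutoff_bounds[of t] t by (intro power_le_one) auto
    ultimately have "inner_kernel ?n s t \<le> 2 * real ?n * 1 * 2 * s * \<rho> powr (- real ?n / 2 - 1)"
      unfolding inner_kernel_def using that t True cutoff_bounds(1)[of t] by (intro mult_mono) auto
    then show ?thesis by simp
  next
    case False
    then show ?thesis using inner_kernel_props(3)[OF that(1), of t] that by simp
  qed
  have bound: "\<bar>hyp_integral (inner_kernel ?n s) x F\<bar> \<le> \<epsilon>' * A + s * (L * V)" if s: "0 < s" "s \<le> 1" for s
  proof -
    let ?k = "hyp_kernel (inner_kernel ?n s) x"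
    note ik = inner_kernel_props[where n="?n", OF s(1)]
    have knn: "0 \<le> ?k y" if "y \<in> ?B" for y
      using ik(2)[OF sinh2_dist_nonneg[OF x that]] wt_pos[OF that] by (simp add: hyp_kernel_def)
    note IF = hyp_integral_integrable[OF x ik(1,3) F]
    have I1: "integrable lborel (\<lambda>y. indicator ?B y * (1 * ?k y))"
      by (rule hyp_integral_integrable[OF x ik(1,3)]) auto
    have I2: "integrable lborel (\<lambda>y. s * L * indicator ?K y)"
      using emeasure_lborel_cball_finite by (intro integrable_mult_right integrable_real_indicator) auto
    have "\<bar>hyp_integral (inner_kernel ?n s) x F\<bar> \<le> integral\<^sup>L lborel (\<lambda>y. \<bar>indicator ?B y * (F y * ?k y)\<bar>)"
      unfolding hyp_integral_def using integral_norm_bound[of lborel "\<lambda>y. indicator ?B y * (F y * ?k y)"] by simp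
    also have "\<dots> \<le> integral\<^sup>L lborel (\<lambda>y. \<epsilon>' * (indicator ?B y * (1 * ?k y)) + s * L * indicator ?K y)"
    proof (rule integral_mono)
      show "integrable lborel (\<lambda>y. \<epsilon>' * (indicator ?B y * (1 * ?k y)) + s * L * indicator ?K y)"
        by (intro Bochner_Integration.integrable_add integrable_mult_right I1 I2)
      fix y
      show "\<bar>indicator ?B y * (F y * ?k y)\<bar> \<le> \<epsilon>' * (indicator ?B y * (1 * ?k y)) + s * L * indicator ?K y"
      proof (cases "y \<in> ?B \<and> ?k y \<noteq> 0")
        case True
        then have yK: "y \<in> ?K" using hyp_kernel_eq_0[where \<phi>="inner_kernel ?n s" and y=y, OF x ik(3)] by auto
        then have near: "norm (y - x) \<le> wt x / 4" by (simp add: dist_norm norm_minus_commute)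
        have wy: "W / 2 \<le> wt y" "wt y \<le> 3 / 2 * W" using near_in_ball[OF x near] by (auto simp: W_def)
        show ?thesis
        proof (cases "norm (y - x) < \<delta>")
          case near: True
          have "\<bar>F y\<bar> * ?k y \<le> \<epsilon>' * ?k y"
            using \<delta>(2)[OF near] knn[of y] True by (intro mult_right_mono) auto
          moreover have "0 \<le> s * L" using s L by simp
          ultimately have "\<bar>F y\<bar> * ?k y \<le> \<epsilon>' * ?k y + s * L" by linarith
          then show ?thesis using True knn[of y] yK by (simp add: abs_mult)
        next
          case False
          then have "\<delta>\<^sup>2 \<le> (norm (y - x))\<^sup>2" using \<delta> by (intro power_mono) auto
          then have "\<rho> \<le> sinh2_dist x y"
            unfolding \<rho>_def sinh2_dist_def W_def[symmetric] using W wy by (intro frac_le mult_left_mono) auto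
          then have "?k y \<le> (4 * real ?n * s * \<rho> powr (- real ?n / 2 - 1)) / (W / 2) ^ ?n"
            unfolding hyp_kernel_def using far[OF s(1), of "sinh2_dist x y"] wy W s by (intro frac_le power_mono) auto
          then have "\<bar>F y\<bar> * ?k y \<le> M * ((4 * real ?n * s * \<rho> powr (- real ?n / 2 - 1)) / (W / 2) ^ ?n)"
            using M[OF yK] M0 knn[of y] True by (intro mult_mono) auto
          also have "\<dots> = s * L" by (simp add: L_def)
          finally have "\<bar>F y\<bar> * ?k y \<le> s * L" .
          moreover have "0 \<le> \<epsilon>' * ?k y" using \<epsilon>' knn[of y] True by simp
          ultimately have "\<bar>F y\<bar> * ?k y \<le> \<epsilon>' * ?k y + s * L" by linarith
          then show ?thesis using True knn[of y] yK by (simp add: abs_mult)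
        qed
      next
        case False
        have "0 \<le> s * L * indicator ?K y" using s L by simp
        then show ?thesis using False by auto
      qed
    qed (rule integrable_abs[OF IF])
    also have "\<dots> = \<epsilon>' * hyp_integral (inner_kernel ?n s) x (\<lambda>_. 1) + s * (L * V)"
      using I1 I2 by (simp add: hyp_integral_def V_def)
    also have "\<dots> \<le> \<epsilon>' * A + s * (L * V)" using mass[OF s] \<epsilon>' by simp
    finally show ?thesis .
  qed
  have "((\<lambda>s. s * (L * V)) \<longlongrightarrow> 0 * (L * V)) (at_right 0)" by (intro tendsto_intros)
  then have "\<forall>\<^sub>F s in at_right 0. s * (L * V) < \<epsilon> / 2"
    using \<epsilon> by (intro order_tendstoD(2)) auto
  moreover have "\<forall>\<^sub>F s in at_right 0. s \<in> {0<..<1 :: real}"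
    by (rule eventually_at_right_real) simp
  ultimately show "\<forall>\<^sub>F s in at_right 0. dist (hyp_integral (inner_kernel ?n s) x F) 0 < \<epsilon>"
  proof eventually_elim
    case (elim s)
    then show ?case using bound[of s] \<epsilon>' by simp
  qed
qed

section \<open>Barriers and the maximum principle\<close>

text \<open>\<open>\<Delta>\<^sub>h w^\<alpha> = - \<alpha> (4 (1-w) (n-1-\<alpha>) + 2 n w) w^\<alpha>\<close>, and the bracket is a convex combination of
  \<open>4 (n-1-\<alpha>)\<close> and \<open>2 n\<close>, both at least 4 when \<open>n \<ge> 3\<close> and \<open>\<alpha> \<le> 1\<close>.\<close>

lemma hyp_laplacian_wt_powr:
  fixes \<alpha> :: real
  assumes card: "CARD('n) \<ge> 3" and \<alpha>: "0 < \<alpha>" "\<alpha> \<le> 1"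
  shows "C2_on (ball 0 1) (\<lambda>y :: real ^ 'n. wt y powr \<alpha>)"
    and "y \<in> ball 0 1 \<Longrightarrow> hyp_laplacian (\<lambda>y :: real ^ 'n. wt y powr \<alpha>) y \<le> - 4 * \<alpha> * wt y powr \<alpha>"
proof -
  let ?B = "ball 0 1 :: (real ^ 'n) set"
  have hess: "has_hessian_on ?B (\<lambda>y. wt y powr \<alpha>) (\<lambda>i y. \<alpha> * wt y powr (\<alpha> - 1) * (- 2 * y $ i))
     (\<lambda>i j y. \<alpha> * wt y powr (\<alpha> - 1) * (if i = j then - 2 else 0)
        + (- 2 * y $ i) * (\<alpha> * ((\<alpha> - 1) * wt y powr (\<alpha> - 2)) * (- 2 * y $ j)))"
  proof (rule has_hessian_on_compose[OF has_hessian_on_wt])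
    fix y :: "real ^ 'n" assume "y \<in> ?B"
    then have p: "0 < wt y" by (rule wt_pos)
    show "((\<lambda>t. t powr \<alpha>) has_real_derivative \<alpha> * wt y powr (\<alpha> - 1)) (at (wt y))"
      using has_real_derivative_powr[OF p] .
    have "((\<lambda>t. t powr (\<alpha> - 1)) has_real_derivative (\<alpha> - 1) * wt y powr (\<alpha> - 1 - 1)) (at (wt y))"
      using has_real_derivative_powr[OF p] .
    from DERIV_cmult[OF this, of \<alpha>]
    show "((\<lambda>t. \<alpha> * t powr (\<alpha> - 1)) has_real_derivative \<alpha> * ((\<alpha> - 1) * wt y powr (\<alpha> - 2))) (at (wt y))"
      by simp
  next
    show "continuous_on ?B (\<lambda>y. \<alpha> * ((\<alpha> - 1) * wt y powr (\<alpha> - 2)))"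
      by (intro continuous_intros continuous_on_wt) (auto dest: wt_nonzero)
  qed
  show "C2_on ?B (\<lambda>y. wt y powr \<alpha>)" using has_hessian_on_C2_on[OF hess] by simp
  assume y: "y \<in> ?B"
  define w where "w = wt y"
  have w: "0 < w" "w \<le> 1" using wt_pos[OF y] wt_le_1 by (auto simp: w_def)
  have N: "(norm y)\<^sup>2 = 1 - w" by (simp add: w_def wt_def)
  define p1 p2 where "p1 = \<alpha> * w powr (\<alpha> - 1)" and "p2 = \<alpha> * ((\<alpha> - 1) * w powr (\<alpha> - 2))"
  have wp: "w * p1 = \<alpha> * w powr \<alpha>" "w\<^sup>2 * p2 = \<alpha> * (\<alpha> - 1) * w powr \<alpha>"
    using w by (auto simp: p1_def p2_def powr_diff powr_numeral power2_eq_square)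
  have H: "p1 * (if i = i then - 2 else 0) + (- 2 * y $ i) * (p2 * (- 2 * y $ i))
      = 4 * p2 * (y $ i)\<^sup>2 + 0 * (y $ i * (y $ i - y $ i)) + 0 * (y $ i - y $ i)\<^sup>2 + - 2 * p1" for i
    by (simp add: power2_eq_square)
  have G: "y $ i * (p1 * (- 2 * y $ i))
      = (- 2 * p1) * (y $ i)\<^sup>2 + 0 * (y $ i * (y $ i - y $ i)) + 0 * (y $ i - y $ i)\<^sup>2 + 0" for i
    by (simp add: power2_eq_square)
  let ?n = "real CARD('n)"
  have "hyp_laplacian (\<lambda>y. wt y powr \<alpha>) y
      = w\<^sup>2 * (\<Sum>i\<in>UNIV. p1 * (if i = i then - 2 else 0) + (- 2 * y $ i) * (p2 * (- 2 * y $ i)))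
       + 2 * (?n - 2) * w * (\<Sum>i\<in>UNIV. y $ i * (p1 * (- 2 * y $ i)))"
    using has_hessian_on_hyp_laplacian[OF hess open_ball y]
    unfolding wt_def[of y, symmetric] w_def[symmetric] p1_def[symmetric] p2_def[symmetric] .
  also have "\<dots> = w\<^sup>2 * (4 * p2 * (1 - w) + ?n * (- 2 * p1)) + 2 * (?n - 2) * w * (- 2 * p1 * (1 - w))"
    unfolding H G unfolding sum_quadratic N by simp
  also have "\<dots> = 4 * (1 - w) * (w\<^sup>2 * p2) - 2 * ?n * w * (w * p1) - 4 * (?n - 2) * (1 - w) * (w * p1)"
    by (simp add: power2_eq_square algebra_simps)
  also have "\<dots> = - \<alpha> * (4 * ((1 - w) * (?n - 1 - \<alpha>)) + 2 * (?n * w)) * w powr \<alpha>"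
    unfolding wp by (simp add: algebra_simps)
  also have "\<dots> \<le> - \<alpha> * 4 * w powr \<alpha>"
  proof (intro mult_right_mono)
    have f1: "(1 - w) * 1 \<le> (1 - w) * (?n - 1 - \<alpha>)" using w card \<alpha> by (intro mult_left_mono) auto
    have f2: "3 * w \<le> ?n * w" using w card by (intro mult_right_mono) auto
    have "4 * ((1 - w) * 1) + 2 * (3 * w) \<le> 4 * ((1 - w) * (?n - 1 - \<alpha>)) + 2 * (?n * w)"
      by (rule add_mono[OF mult_left_mono[OF f1] mult_left_mono[OF f2]]) simp_all
    then have "4 \<le> 4 * ((1 - w) * (?n - 1 - \<alpha>)) + 2 * (?n * w)"
      by (rule order_trans[rotated]) (use w in simp)
    then have "\<alpha> * 4 \<le> \<alpha> * (4 * ((1 - w) * (?n - 1 - \<alpha>)) + 2 * (?n * w))"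
      using \<alpha> by (intro mult_left_mono) auto
    then show "- \<alpha> * (4 * ((1 - w) * (?n - 1 - \<alpha>)) + 2 * (?n * w)) \<le> - \<alpha> * 4" by simp
  qed simp
  finally show "hyp_laplacian (\<lambda>y. wt y powr \<alpha>) y \<le> - 4 * \<alpha> * wt y powr \<alpha>" by (simp add: w_def)
qed

text \<open>\<open>|y-\<xi>|^\<alpha>\<close> is not superharmonic, but with \<open>q = |y-\<xi>|\<^sup>2\<close> its Laplacian
  \<open>\<alpha>\<^sup>2 w\<^sup>2 q^(\<alpha>/2-1) + \<alpha> (n-2) w q^(\<alpha>/2)\<close> is \<open>O(w^\<alpha>)\<close>, because \<open>w\<^sup>2 \<le> 4 q\<close>; a multiple of \<open>w^\<alpha>\<close>
  compensates for it.\<close>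

lemma hyp_laplacian_dist_powr:
  fixes \<alpha> :: real and \<xi> :: "real ^ 'n"
  assumes card: "CARD('n) \<ge> 3" and \<alpha>: "0 < \<alpha>" "\<alpha> \<le> 1" and \<xi>: "\<xi> \<in> sphere 0 1"
  shows "C2_on (ball 0 1) (\<lambda>y. ((norm (y - \<xi>))\<^sup>2) powr (\<alpha> / 2))"
    and "y \<in> ball 0 1 \<Longrightarrow> hyp_laplacian (\<lambda>y. ((norm (y - \<xi>))\<^sup>2) powr (\<alpha> / 2)) y
      \<le> 4 * \<alpha> * real CARD('n) * wt y powr \<alpha>"
proof -
  let ?B = "ball 0 1 :: (real ^ 'n) set" and ?q = "\<lambda>y. (norm (y - \<xi>))\<^sup>2"
  define a where "a = \<alpha> / 2"
  have q0: "0 < ?q y" if "y \<in> ?B" for y using that \<xi> by auto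
  have hess: "has_hessian_on ?B (\<lambda>y. ?q y powr a) (\<lambda>i y. a * ?q y powr (a - 1) * (2 * (y $ i - \<xi> $ i)))
     (\<lambda>i j y. a * ?q y powr (a - 1) * (if i = j then 2 else 0)
        + (2 * (y $ i - \<xi> $ i)) * (a * ((a - 1) * ?q y powr (a - 2)) * (2 * (y $ j - \<xi> $ j))))"
  proof (rule has_hessian_on_compose[OF has_hessian_on_sqdist])
    fix y :: "real ^ 'n" assume "y \<in> ?B"
    then have p: "0 < ?q y" by (rule q0)
    show "((\<lambda>t. t powr a) has_real_derivative a * ?q y powr (a - 1)) (at (?q y))"
      using has_real_derivative_powr[OF p] .
    have "((\<lambda>t. t powr (a - 1)) has_real_derivative (a - 1) * ?q y powr (a - 1 - 1)) (at (?q y))"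
      using has_real_derivative_powr[OF p] .
    from DERIV_cmult[OF this, of a]
    show "((\<lambda>t. a * t powr (a - 1)) has_real_derivative a * ((a - 1) * ?q y powr (a - 2))) (at (?q y))"
      by simp
  next
    show "continuous_on ?B (\<lambda>y. a * ((a - 1) * ?q y powr (a - 2)))"
      using \<xi> by (intro continuous_intros) auto
  qed
  show "C2_on ?B (\<lambda>y. ?q y powr (\<alpha> / 2))" using has_hessian_on_C2_on[OF hess] by (simp add: a_def)
  assume y: "y \<in> ?B"
  define w q where "w = wt y" and "q = ?q y"
  have w: "0 < w" "w \<le> 1" using wt_pos[OF y] wt_le_1 by (auto simp: w_def)
  have q: "0 < q" using q0[OF y] by (simp add: q_def)
  have N: "(norm y)\<^sup>2 = 1 - w" "(norm \<xi>)\<^sup>2 = 1" using \<xi> by (auto simp: w_def wt_def)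
  have wq: "w \<le> 2 * norm (y - \<xi>)"
  proof -
    have "1 - norm y \<le> norm (y - \<xi>)" using norm_triangle_ineq2[of \<xi> y] \<xi> by (simp add: norm_minus_commute)
    then show ?thesis using wt_le[of y] y by (simp add: w_def)
  qed
  have w2: "w\<^sup>2 \<le> 4 * q"
    using power_mono[OF wq, of 2] w by (simp add: q_def power_mult_distrib)
  have q4: "q \<le> 4"
  proof -
    have "norm (y - \<xi>) \<le> 2" using norm_triangle_ineq4[of y \<xi>] y \<xi> by auto
    then show ?thesis using power_mono[of "norm (y - \<xi>)" 2 2] by (simp add: q_def)
  qed
  define p1 p2 where "p1 = a * q powr (a - 1)" and "p2 = a * ((a - 1) * q powr (a - 2))"
  have qp: "q * p2 = (a - 1) * p1" "q * p1 = a * q powr a"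
    using q by (auto simp: p1_def p2_def powr_diff powr_numeral power2_eq_square)
  have H: "p1 * (if i = i then 2 else 0) + (2 * (y $ i - \<xi> $ i)) * (p2 * (2 * (y $ i - \<xi> $ i)))
      = 0 * (y $ i)\<^sup>2 + 0 * (y $ i * (y $ i - \<xi> $ i)) + 4 * p2 * (y $ i - \<xi> $ i)\<^sup>2 + 2 * p1" for i
    by (simp add: power2_eq_square algebra_simps)
  have G: "y $ i * (p1 * (2 * (y $ i - \<xi> $ i)))
      = 0 * (y $ i)\<^sup>2 + (2 * p1) * (y $ i * (y $ i - \<xi> $ i)) + 0 * (y $ i - \<xi> $ i)\<^sup>2 + 0" for i
    by simp
  let ?n = "real CARD('n)"
  have "hyp_laplacian (\<lambda>y. ?q y powr a) y
      = w\<^sup>2 * (\<Sum>i\<in>UNIV. p1 * (if i = i then 2 else 0) + (2 * (y $ i - \<xi> $ i)) * (p2 * (2 * (y $ i - \<xi> $ i))))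
       + 2 * (?n - 2) * w * (\<Sum>i\<in>UNIV. y $ i * (p1 * (2 * (y $ i - \<xi> $ i))))"
    using has_hessian_on_hyp_laplacian[OF hess open_ball y]
    unfolding wt_def[of y, symmetric] w_def[symmetric] q_def[symmetric] p1_def[symmetric] p2_def[symmetric] .
  also have "\<dots> = w\<^sup>2 * (4 * p2 * q + ?n * (2 * p1)) + 2 * (?n - 2) * w * (2 * p1 * ((q + (1 - w) - 1) / 2))"
    unfolding H G unfolding sum_quadratic N q_def[symmetric] by simp
  also have "\<dots> = w\<^sup>2 * (4 * (q * p2) + 2 * ?n * p1) + 2 * (?n - 2) * (w * (q * p1) - w\<^sup>2 * p1)"
    by (simp add: power2_eq_square field_simps)
  also have "\<dots> = 4 * a * (w\<^sup>2 * p1) + 2 * (?n - 2) * (w * (q * p1))"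
    unfolding qp(1) by (simp add: power2_eq_square algebra_simps)
  also have "\<dots> \<le> 4 * a * (4 * a * w powr \<alpha>) + 2 * (?n - 2) * (4 * a * w powr \<alpha>)"
  proof (intro add_mono mult_left_mono)
    have "p1 \<le> a * (w\<^sup>2 / 4) powr (a - 1)"
      unfolding p1_def using w2 w \<alpha> q by (intro mult_left_mono powr_mono2') (auto simp: a_def)
    also have "(w\<^sup>2 / 4) powr (a - 1) = w powr (\<alpha> - 2) * 4 powr (1 - a)"
    proof -
      have "(w\<^sup>2) powr (a - 1) = w powr (\<alpha> - 2)"
        using w by (simp add: a_def powr_powr flip: powr_numeral)
      then show ?thesis using w by (simp add: powr_divide powr_diff)
    qed
    also have "a * (w powr (\<alpha> - 2) * 4 powr (1 - a)) \<le> a * (w powr (\<alpha> - 2) * 4 powr 1)"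
      using \<alpha> by (intro mult_left_mono powr_mono) (auto simp: a_def)
    finally have "w\<^sup>2 * p1 \<le> w\<^sup>2 * (a * (w powr (\<alpha> - 2) * 4))"
      by (intro mult_left_mono) auto
    also have "\<dots> = 4 * a * w powr \<alpha>" using w by (simp add: powr_diff powr_numeral)
    finally show "w\<^sup>2 * p1 \<le> 4 * a * w powr \<alpha>" .
    have "q powr a \<le> 4 powr a" using q q4 \<alpha> by (intro powr_mono2) (auto simp: a_def)
    also have "\<dots> \<le> 4 powr 1" using \<alpha> by (intro powr_mono) (auto simp: a_def)
    finally have "q powr a \<le> 4" by simp
    moreover have "w \<le> w powr \<alpha>" using powr_mono'[of \<alpha> 1 w] \<alpha> w by simp
    ultimately have "w * (a * q powr a) \<le> w powr \<alpha> * (a * 4)"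
      using w \<alpha> by (intro mult_mono) (auto simp: a_def)
    then show "w * (q * p1) \<le> 4 * a * w powr \<alpha>" unfolding qp(2) by (simp only: mult_ac)
  qed (use card \<alpha> in \<open>auto simp: a_def\<close>)
  also have "\<dots> = (4 * \<alpha>\<^sup>2 + 4 * \<alpha> * (?n - 2)) * w powr \<alpha>"
    by (simp add: a_def power2_eq_square algebra_simps)
  also have "\<dots> \<le> (4 * \<alpha> * ?n) * w powr \<alpha>"
  proof (intro mult_right_mono)
    have "\<alpha>\<^sup>2 \<le> \<alpha> * 1" unfolding power2_eq_square using \<alpha> by (intro mult_left_mono) auto
    then show "4 * \<alpha>\<^sup>2 + 4 * \<alpha> * (?n - 2) \<le> 4 * \<alpha> * ?n" using \<alpha> by (simp add: algebra_simps)
  qed simp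
  finally show "hyp_laplacian (\<lambda>y. ?q y powr (\<alpha> / 2)) y \<le> 4 * \<alpha> * ?n * wt y powr \<alpha>"
    by (simp add: w_def a_def)
qed

lemma weight_le_near:
  assumes "0 < \<alpha>" "\<alpha> \<le> 1" and y: "y \<in> ball 0 1" and le: "wt y \<le> 2 * wt x"
    and f: "f \<le> wt y powr (1 + \<alpha>) * c" and c: "0 \<le> (c :: real)"
  shows "f \<le> 4 * wt x powr (1 + \<alpha>) * c"
proof -
  have "wt y powr (1 + \<alpha>) \<le> (2 * wt x) powr (1 + \<alpha>)"
    using assms wt_pos[OF y] by (intro powr_mono2) auto
  also have "\<dots> = 2 powr (1 + \<alpha>) * wt x powr (1 + \<alpha>)"
    using le wt_pos[OF y] by (simp add: powr_mult)
  also have "\<dots> \<le> 2 powr 2 * wt x powr (1 + \<alpha>)"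
    using assms by (intro mult_right_mono powr_mono) auto
  finally have "wt y powr (1 + \<alpha>) * c \<le> 4 * wt x powr (1 + \<alpha>) * c"
    using c by (intro mult_right_mono) auto
  with f show ?thesis by linarith
qed

lemma powr_mult_power:
  fixes W \<alpha> :: real
  assumes "0 < W" "0 < n"
  shows "W powr (1 + \<alpha>) * W ^ (n - 1) = W powr \<alpha> * W ^ n"
  using assms by (cases n) (simp_all add: powr_add mult_ac)

text \<open>A maximum principle for a right-hand side that is positive only on average. At a maximum \<open>x\<close>
  the outer kernel sees \<open>v - v(x) \<le> 0\<close>, while \<open>\<integral> e \<Delta>\<^sub>h v\<close> is at least \<open>(N \<kappa> - E) w^\<alpha>\<close>, where \<open>\<kappa>\<close>
  comes from the lower bound for the mass of \<open>e\<close> and \<open>E\<close> from the potential estimate for \<open>h\<close>. The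
  inner kernel contributes nothing in the limit.\<close>

lemma no_interior_max:
  fixes h :: "real ^ 'n \<Rightarrow> real" and \<alpha> D :: real
  assumes card: "CARD('n) \<ge> 3" and \<alpha>: "0 < \<alpha>" "\<alpha> \<le> 1"
    and hD: "bounded_riesz_potential h D"
  obtains N0 where "\<And>v f N x. C2_on (ball 0 1) v \<Longrightarrow> continuous_on (ball 0 1) f \<Longrightarrow>
       (\<And>y. y \<in> ball 0 1 \<Longrightarrow> \<bar>f y\<bar> \<le> wt y powr (1 + \<alpha>) * \<bar>h y\<bar>) \<Longrightarrow>
       (\<And>y. y \<in> ball 0 1 \<Longrightarrow> N * wt y powr \<alpha> - \<bar>f y\<bar> \<le> hyp_laplacian v y) \<Longrightarrow> N0 < N \<Longrightarrow> 0 \<le> N \<Longrightarrow>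
       x \<in> ball 0 1 \<Longrightarrow> \<exists>y\<in>ball 0 1. v x < v y"
proof -
  let ?n = "CARD('n)" and ?B = "ball 0 1 :: (real ^ 'n) set"
  let ?C = "288 * (50 + real ?n)"
  define \<kappa> where "\<kappa> = (2 powr (- real ?n / 2) / 768) * (unit_ball_vol (real ?n) / 96 ^ ?n) / 2"
  have \<kappa>: "0 < \<kappa>" by (simp add: \<kappa>_def)
  note h = hD[unfolded bounded_riesz_potential_def, rule_format]
  define E where "E = 8 * ?C * 4 ^ ?n * D"
  show ?thesis
  proof (rule that[of "E / \<kappa>"], rule ccontr)
    fix v f :: "real ^ 'n \<Rightarrow> real" and N :: real and x :: "real ^ 'n"
    assume v: "C2_on ?B v" and f: "continuous_on ?B f"
      and fh: "\<And>y. y \<in> ?B \<Longrightarrow> \<bar>f y\<bar> \<le> wt y powr (1 + \<alpha>) * \<bar>h y\<bar>"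
      and Lv: "\<And>y. y \<in> ?B \<Longrightarrow> N * wt y powr \<alpha> - \<bar>f y\<bar> \<le> hyp_laplacian v y"
      and N: "E / \<kappa> < N" "0 \<le> N" and x: "x \<in> ?B" and "\<not> (\<exists>y\<in>?B. v x < v y)"
    then have max: "v y \<le> v x" if "y \<in> ?B" for y using that by force
    define W where "W = wt x"
    have W: "0 < W" "W \<le> 1" using wt_pos[OF x] wt_le_1 by (auto simp: W_def)
    have N': "0 < N * \<kappa> - E" using N \<kappa> by (simp add: divide_less_eq)
    define v0 where "v0 y = v y - v x" for y
    have v0: "C2_on ?B v0" and Lv0: "\<And>y. y \<in> ?B \<Longrightarrow> hyp_laplacian v0 y = hyp_laplacian v y"
      using hyp_laplacian_linear[OF open_ball v C2_on_const[OF open_ball], where a=1 and b=0 and c="- v x"]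
      by (auto simp: v0_def[abs_def])
    have cv0: "continuous_on ?B v0"
      using C2_on_has_hessian_on[OF v0] has_gradient_on_continuous by (auto simp: has_hessian_on_def)
    have cw: "continuous_on ?B (\<lambda>y. wt y powr \<alpha>)"
      by (intro continuous_intros continuous_on_wt) (auto dest: wt_nonzero)
    have key: "hyp_integral (inner_kernel ?n s) x v0 \<le> - ((N * \<kappa> - E) * W powr \<alpha>)" if s: "0 < s" "s \<le> 1" for s
    proof -
      obtain e where e: "\<And>t. 0 \<le> t \<Longrightarrow> (e has_real_derivative - flux ?n s t) (at t)"
        and p: "profile ?n ?C e"
        and low: "\<And>t. 1/2048 \<le> t \<Longrightarrow> t \<le> 1/96 \<Longrightarrow> 2 powr (- real ?n / 2) / 768 \<le> e t"
        using potential_profile[OF s] by blast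
      have prof: "continuous_on {0..} e" "\<And>t. 1/24 \<le> t \<Longrightarrow> e t = 0" "\<And>t. 0 \<le> t \<Longrightarrow> 0 \<le> e t"
        using p by (auto simp: profile_def)
      have oprof: "continuous_on {0..} (outer_kernel ?n s)" "\<And>t. 1/24 \<le> t \<Longrightarrow> outer_kernel ?n s t = 0"
        "\<And>t. 0 \<le> t \<Longrightarrow> 0 \<le> outer_kernel ?n s t"
        using outer_kernel_profile(1)[OF s, of ?n] by (auto simp: profile_def)
      have mv: "hyp_integral (outer_kernel ?n s) x v0 - hyp_integral (inner_kernel ?n s) x v0 = hyp_integral e x (hyp_laplacian v0)"
        by (rule mean_value_formula[OF card v0 x s e prof(2)])
      have "hyp_integral (outer_kernel ?n s) x v0 \<le> hyp_integral (outer_kernel ?n s) x (\<lambda>_. 0)"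
        by (rule hyp_integral_mono[OF x oprof cv0]) (use max in \<open>auto simp: v0_def\<close>)
      then have o: "hyp_integral (outer_kernel ?n s) x v0 \<le> 0" by (simp add: hyp_integral_def)
      have "hyp_integral e x (\<lambda>y. N * wt y powr \<alpha> + (- 1) * \<bar>f y\<bar>) \<le> hyp_integral e x (hyp_laplacian v0)"
        by (rule hyp_integral_mono[OF x prof _ continuous_on_hyp_laplacian[OF v0]])
          (use Lv Lv0 in \<open>auto intro!: continuous_intros f cw\<close>)
      also have "hyp_integral e x (\<lambda>y. N * wt y powr \<alpha> + (- 1) * \<bar>f y\<bar>)
          = N * hyp_integral e x (\<lambda>y. wt y powr \<alpha>) + (- 1) * hyp_integral e x (\<lambda>y. \<bar>f y\<bar>)"
        by (rule hyp_integral_linear[OF x prof(1,2) cw continuous_on_rabs[OF f]])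
      finally have a: "N * hyp_integral e x (\<lambda>y. wt y powr \<alpha>) - hyp_integral e x (\<lambda>y. \<bar>f y\<bar>) \<le> hyp_integral e x (hyp_laplacian v0)"
        by simp
      have "\<bar>hyp_integral e x (\<lambda>y. \<bar>f y\<bar>)\<bar> \<le> 2 * ?C * 4 ^ ?n / wt x ^ ?n * (4 * W powr (1 + \<alpha>)) * (D * wt x ^ (?n - 1))"
      proof (rule hyp_integral_le[OF x p, where h=h])
        fix y assume y: "y \<in> ?B" "wt y \<le> 2 * wt x"
        show "\<bar>\<bar>f y\<bar>\<bar> \<le> 4 * W powr (1 + \<alpha>) * \<bar>h y\<bar>"
          unfolding W_def using weight_le_near[OF \<alpha> y, of "\<bar>f y\<bar>" "\<bar>h y\<bar>"] fh[OF y(1)] by simp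
      qed (use h[OF W, of x] f in \<open>auto simp: W_def intro!: continuous_intros\<close>)
      also have "\<dots> = E * W powr \<alpha>"
      proof -
        have "2 * ?C * 4 ^ ?n / wt x ^ ?n * (4 * W powr (1 + \<alpha>)) * (D * wt x ^ (?n - 1))
            = E * (W powr (1 + \<alpha>) * W ^ (?n - 1)) / W ^ ?n"
          unfolding W_def[symmetric] E_def by simp
        also have "\<dots> = E * W powr \<alpha>" unfolding powr_mult_power[OF W(1) zero_less_card_finite] using W by simp
        finally show ?thesis .
      qed
      finally have b: "hyp_integral e x (\<lambda>y. \<bar>f y\<bar>) \<le> E * W powr \<alpha>" by simp
      have "2 * \<kappa> \<le> hyp_integral e x (\<lambda>_. 1)"
        using hyp_integral_lower_bound[OF x p _ low] by (simp add: \<kappa>_def mult.commute)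
      then have "W powr \<alpha> / 2 * (2 * \<kappa>) \<le> W powr \<alpha> / 2 * hyp_integral e x (\<lambda>_. 1)"
        by (intro mult_left_mono) auto
      also have "\<dots> = hyp_integral e x (\<lambda>_. (W powr \<alpha> / 2) * 1 + 0 * 1)"
        by (subst hyp_integral_linear[OF x prof(1,2)]) auto
      also have "\<dots> \<le> hyp_integral e x (\<lambda>y. wt y powr \<alpha>)"
      proof (rule hyp_integral_mono[OF x prof _ cw])
        fix y assume "norm (y - x) \<le> wt x / 4"
        then have "W / 2 \<le> wt y" using near_in_ball(2)[OF x] by (simp add: W_def)
        then have le: "(W / 2) powr \<alpha> \<le> wt y powr \<alpha>" using W \<alpha> by (intro powr_mono2) auto
        have "W powr \<alpha> / 2 powr 1 \<le> W powr \<alpha> / 2 powr \<alpha>"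
          using \<alpha> by (intro divide_left_mono powr_mono) auto
        also have "\<dots> = (W / 2) powr \<alpha>" using W by (simp add: powr_divide)
        finally show "W powr \<alpha> / 2 * 1 + 0 * 1 \<le> wt y powr \<alpha>" using le by simp
      qed auto
      finally have "N * (\<kappa> * W powr \<alpha>) \<le> N * hyp_integral e x (\<lambda>y. wt y powr \<alpha>)"
        using N by (intro mult_left_mono) (auto simp: mult.commute)
      then show ?thesis using mv o a b by (simp add: algebra_simps)
    qed
    have "((\<lambda>s. hyp_integral (inner_kernel ?n s) x v0) \<longlongrightarrow> 0) (at_right 0)"
      by (rule inner_kernel_limit[OF card x cv0]) (simp add: v0_def)
    moreover have "\<forall>\<^sub>F s in at_right 0. hyp_integral (inner_kernel ?n s) x v0 \<le> - ((N * \<kappa> - E) * W powr \<alpha>)"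
      using eventually_at_right_real[of 0 1] by (auto elim!: eventually_mono intro: key)
    ultimately have "0 \<le> - ((N * \<kappa> - E) * W powr \<alpha>)"
      by (rule tendsto_upperbound) simp
    moreover have "0 < (N * \<kappa> - E) * W powr \<alpha>" using N' W by simp
    ultimately show False by simp
  qed
qed

section \<open>Growth away from the boundary\<close>

lemma square_powr_half: "0 \<le> r \<Longrightarrow> (r\<^sup>2) powr (\<alpha> / 2) = r powr (\<alpha> :: real)"
  by (simp add: powr_powr flip: powr_numeral)

text \<open>The comparison function \<open>b = |y-\<xi>|^\<alpha> + (n+1) w^\<alpha>\<close> dominates \<open>|u - u(\<xi>)|\<close> up to a factor on the
  sphere, and \<open>w \<le> 2 |y-\<xi>|\<close> bounds it by a multiple of \<open>|y-\<xi>|^\<alpha>\<close> inside. The sign \<open>\<sigma>\<close> treats \<open>u\<close> and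
  \<open>-u\<close> at once.\<close>

lemma boundary_holder:
  fixes u h :: "real ^ 'n \<Rightarrow> real" and \<alpha> D M :: real
  assumes card: "CARD('n) \<ge> 3" and \<alpha>: "0 < \<alpha>" "\<alpha> \<le> 1"
    and h: "bounded_riesz_potential h D"
    and u: "C2_on (ball 0 1) u" "continuous_on (cball 0 1) u"
    and uh: "\<forall>y\<in>ball 0 1. \<bar>hyp_laplacian u y\<bar> \<le> wt y powr (1 + \<alpha>) * \<bar>h y\<bar>"
    and M: "\<forall>x\<in>sphere 0 1. \<forall>y\<in>sphere 0 1. \<bar>u x - u y\<bar> \<le> M * norm (x - y) powr \<alpha>"
  obtains K where "0 \<le> K" and
    "\<forall>x\<in>cball 0 1. \<forall>\<xi>\<in>sphere 0 1. \<bar>u x - u \<xi>\<bar> \<le> K * norm (x - \<xi>) powr \<alpha>"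
proof -
  let ?B = "ball 0 1 :: (real ^ 'n) set" and ?n = "real CARD('n)"
  note uh = uh[rule_format] and M = M[rule_format]
  obtain N0 where N0: "\<And>v f N x. C2_on ?B v \<Longrightarrow> continuous_on ?B f \<Longrightarrow>
       (\<And>y. y \<in> ?B \<Longrightarrow> \<bar>f y\<bar> \<le> wt y powr (1 + \<alpha>) * \<bar>h y\<bar>) \<Longrightarrow>
       (\<And>y. y \<in> ?B \<Longrightarrow> N * wt y powr \<alpha> - \<bar>f y\<bar> \<le> hyp_laplacian v y) \<Longrightarrow> N0 < N \<Longrightarrow> 0 \<le> N \<Longrightarrow>
       x \<in> ?B \<Longrightarrow> \<exists>y\<in>?B. v x < v y"
    by (rule no_interior_max[OF card \<alpha> h]) (erule that)
  define K where "K = max M (\<bar>N0\<bar> / (4 * \<alpha>) + 1)"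
  have K: "M \<le> K" "0 < K" "N0 < 4 * \<alpha> * K"
  proof -
    show "M \<le> K" by (simp add: K_def)
    have "0 \<le> \<bar>N0\<bar> / (4 * \<alpha>)" using \<alpha> by simp
    then show "0 < K" unfolding K_def by linarith
    have "\<bar>N0\<bar> / (4 * \<alpha>) < K" unfolding K_def by simp
    then show "N0 < 4 * \<alpha> * K" using \<alpha> by (simp add: divide_less_eq mult.commute)
  qed
  have one_sided: "\<sigma> * (u x - u \<xi>) \<le> K * (2 * ?n + 3) * norm (x - \<xi>) powr \<alpha>"
    if \<sigma>: "\<sigma> = 1 \<or> \<sigma> = -1" and x: "x \<in> cball 0 1" and \<xi>: "\<xi> \<in> sphere 0 1" for \<sigma> x \<xi>
  proof -
    define b where "b y = 1 * ((norm (y - \<xi>))\<^sup>2) powr (\<alpha> / 2) + (?n + 1) * wt y powr \<alpha> + 0" for y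
    note d = hyp_laplacian_dist_powr[OF card \<alpha> \<xi>] and w = hyp_laplacian_wt_powr[OF card \<alpha>]
    have b: "C2_on ?B b" unfolding b_def[abs_def] by (rule hyp_laplacian_linear(1)[OF open_ball d(1) w(1)])
    have Lb: "hyp_laplacian b y \<le> - 4 * \<alpha> * wt y powr \<alpha>" if y: "y \<in> ?B" for y
    proof -
      have "hyp_laplacian b y = 1 * hyp_laplacian (\<lambda>y. ((norm (y - \<xi>))\<^sup>2) powr (\<alpha> / 2)) y
        + (?n + 1) * hyp_laplacian (\<lambda>y. wt y powr \<alpha>) y"
        unfolding b_def[abs_def] by (rule hyp_laplacian_linear(2)[OF open_ball d(1) w(1) y])
      also have "\<dots> \<le> 1 * (4 * \<alpha> * ?n * wt y powr \<alpha>) + (?n + 1) * (- 4 * \<alpha> * wt y powr \<alpha>)"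
        by (intro add_mono mult_left_mono d(2) w(2) y) auto
      finally show ?thesis by (simp add: algebra_simps)
    qed
    define v where "v y = \<sigma> * u y + (- K) * b y + 0" for y
    have v: "C2_on ?B v" unfolding v_def[abs_def] by (rule hyp_laplacian_linear(1)[OF open_ball u(1) b])
    have Lv: "4 * \<alpha> * K * wt y powr \<alpha> - \<bar>hyp_laplacian u y\<bar> \<le> hyp_laplacian v y" if y: "y \<in> ?B" for y
    proof -
      have "hyp_laplacian v y = \<sigma> * hyp_laplacian u y + (- K) * hyp_laplacian b y"
        unfolding v_def[abs_def] by (rule hyp_laplacian_linear(2)[OF open_ball u(1) b y])
      moreover have "K * hyp_laplacian b y \<le> K * (- 4 * \<alpha> * wt y powr \<alpha>)"
        using Lb[OF y] K by (intro mult_left_mono) auto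
      ultimately show ?thesis using \<sigma> by (auto simp: algebra_simps)
    qed
    have cb: "continuous_on (cball 0 1) b"
      unfolding b_def[abs_def] using \<alpha>
      by (intro continuous_intros continuous_on_powr' continuous_on_wt)
        (auto simp: wt_def power_le_one)
    have cv: "continuous_on (cball 0 1) v"
      unfolding v_def[abs_def] by (intro continuous_intros u cb)
    obtain z where z: "z \<in> cball 0 1" "\<And>y. y \<in> cball 0 1 \<Longrightarrow> v y \<le> v z"
      using continuous_attains_sup[OF compact_cball _ cv] by auto
    have "z \<notin> ?B"
    proof
      assume "z \<in> ?B"
      then have "\<exists>y\<in>?B. v z < v y"
        by (intro N0[OF v continuous_on_hyp_laplacian[OF u(1)] uh Lv]) (use K \<alpha> in auto)
      then obtain y where "y \<in> ?B" "v z < v y" ..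
      then show False using z(2)[of y] by simp
    qed
    then have zs: "z \<in> sphere 0 1" using z by auto
    have bz: "b z = norm (z - \<xi>) powr \<alpha>"
    proof -
      have "((norm (z - \<xi>))\<^sup>2) powr (\<alpha> / 2) = norm (z - \<xi>) powr \<alpha>"
        by (rule square_powr_half) simp
      then show ?thesis using zs by (simp add: b_def wt_def)
    qed
    have "\<sigma> * (u z - u \<xi>) \<le> K * b z"
    proof -
      have "\<sigma> * (u z - u \<xi>) \<le> \<bar>u z - u \<xi>\<bar>" using \<sigma> by auto
      also have "\<dots> \<le> M * norm (z - \<xi>) powr \<alpha>" by (rule M[OF zs \<xi>])
      also have "\<dots> \<le> K * norm (z - \<xi>) powr \<alpha>" using K by (intro mult_right_mono) auto
      finally show ?thesis by (simp add: bz)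
    qed
    then have "\<sigma> * (u x - u \<xi>) \<le> K * b x"
      using z(2)[OF x] by (simp add: v_def algebra_simps)
    also have "K * b x \<le> K * ((2 * ?n + 3) * norm (x - \<xi>) powr \<alpha>)"
    proof (intro mult_left_mono)
      have e: "((norm (x - \<xi>))\<^sup>2) powr (\<alpha> / 2) = norm (x - \<xi>) powr \<alpha>"
        by (rule square_powr_half) simp
      have "1 - norm x \<le> norm (x - \<xi>)"
        using norm_triangle_ineq2[of \<xi> x] \<xi> by (simp add: norm_minus_commute)
      then have "wt x \<le> 2 * norm (x - \<xi>)" using wt_le[OF x] by simp
      moreover have "0 \<le> wt x" using x by (simp add: wt_def power_le_one)
      ultimately have "wt x powr \<alpha> \<le> (2 * norm (x - \<xi>)) powr \<alpha>" using \<alpha> by (intro powr_mono2) auto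
      also have "\<dots> = 2 powr \<alpha> * norm (x - \<xi>) powr \<alpha>" by (simp add: powr_mult)
      also have "\<dots> \<le> 2 powr 1 * norm (x - \<xi>) powr \<alpha>"
        using \<alpha> by (intro mult_right_mono powr_mono) auto
      finally have "(?n + 1) * wt x powr \<alpha> \<le> (?n + 1) * (2 * norm (x - \<xi>) powr \<alpha>)"
        by (intro mult_left_mono) auto
      then show "b x \<le> (2 * ?n + 3) * norm (x - \<xi>) powr \<alpha>"
        unfolding b_def e by (simp add: algebra_simps)
    qed (use K in auto)
    finally show ?thesis by (simp add: mult.assoc)
  qed
  show ?thesis
  proof (rule that[of "K * (2 * ?n + 3)"])
    show "0 \<le> K * (2 * ?n + 3)" using K by simp
    show "\<forall>x\<in>cball 0 1. \<forall>\<xi>\<in>sphere 0 1. \<bar>u x - u \<xi>\<bar> \<le> K * (2 * ?n + 3) * norm (x - \<xi>) powr \<alpha>"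
      using one_sided[of 1] one_sided[of "-1"] by (auto simp: abs_le_iff)
  qed
qed

section \<open>Interior estimate\<close>

lemma nearest_sphere_point:
  fixes x :: "real ^ 'n"
  assumes "x \<in> ball 0 1"
  obtains \<xi> where "\<xi> \<in> sphere 0 1" "norm (x - \<xi>) \<le> wt x"
proof -
  define v where "v = (if x = 0 then axis undefined 1 else x /\<^sub>R norm x)"
  have v: "norm v = 1" "x = norm x *\<^sub>R v" by (auto simp: v_def norm_axis_1)
  have "x - v = (norm x - 1) *\<^sub>R v" using v(2) by (simp add: algebra_simps)
  then have "norm (x - v) = 1 - norm x" using v(1) assms by simp
  also have "\<dots> \<le> (1 - norm x) * (1 + norm x)" using assms by (simp add: algebra_simps mult_left_le)
  also have "\<dots> = wt x" by (simp add: wt_def power2_eq_square algebra_simps)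
  finally show ?thesis using v that by auto
qed

text \<open>Both mean value formulas are applied to \<open>F = u - u(x)\<close>, which is \<open>O(w^\<alpha>)\<close> near \<open>x\<close>. At \<open>x'\<close> the
  inner kernel does not see \<open>F\<close> vanish; writing \<open>F = (u - u(x')) + (u(x') - u(x))\<close> isolates
  \<open>u(x') - u(x)\<close> times the mass of the kernel, which is bounded below by \<open>c0\<close>.\<close>

lemma interior_holder:
  fixes u h :: "real ^ 'n \<Rightarrow> real" and \<alpha> D K :: real
  assumes card: "CARD('n) \<ge> 3" and \<alpha>: "0 < \<alpha>" "\<alpha> \<le> 1"
    and h: "bounded_riesz_potential h D"
    and u: "C2_on (ball 0 1) u"
    and uh: "\<forall>y\<in>ball 0 1. \<bar>hyp_laplacian u y\<bar> \<le> wt y powr (1 + \<alpha>) * \<bar>h y\<bar>"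
    and K0: "0 \<le> K" "\<forall>x\<in>cball 0 1. \<forall>\<xi>\<in>sphere 0 1. \<bar>u x - u \<xi>\<bar> \<le> K * norm (x - \<xi>) powr \<alpha>"
  obtains C where "0 \<le> C" and
    "\<forall>x\<in>ball 0 1. \<forall>x'\<in>ball 0 1. norm (x - x') \<le> wt x / 16 \<longrightarrow>
       \<bar>u x - u x'\<bar> \<le> C * norm (x - x') powr \<alpha>"
proof -
  let ?B = "ball 0 1 :: (real ^ 'n) set" and ?n = "CARD('n)"
  let ?C = "288 * (50 + real ?n)"
  note K = K0(1) K0(2)[rule_format] and h = h[unfolded bounded_riesz_potential_def, rule_format]
    and uh = uh[rule_format]
  obtain C1 where C1: "0 \<le> C1" and R: "\<And>(x :: real ^ 'n) W. 0 < W \<Longrightarrow> riesz_le (\<lambda>_. 1) x W (C1 * W ^ ?n)" using riesz_potential_bounded[where 'n='n] by blast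
  have D: "0 \<le> D"
  proof -
    have "0 \<le> integral\<^sup>L lborel (\<lambda>y. indicator (cball (0 :: real ^ 'n) 1) y * (\<bar>h y\<bar> * (1 / norm (y - 0)) ^ (?n - 1)))"
      by (intro Bochner_Integration.integral_nonneg) auto
    also have "\<dots> \<le> D" using h[of 1 0] by (simp add: riesz_le_def)
    finally show ?thesis .
  qed
  define c0 where "c0 = (2 powr (- real ?n / 2) / 768) * (unit_ball_vol (real ?n) / 96 ^ ?n)"
  have c0: "0 < c0" by (simp add: c0_def)
  define E where "E = 24 * ?C * 8 ^ ?n * (3 * K * C1) + 24 * ?C * 8 ^ ?n * (4 * D)"
  have E: "0 \<le> E" using K C1 D by (simp add: E_def)
  have uc: "continuous_on ?B u"
    using C2_on_has_hessian_on[OF u] has_gradient_on_continuous by (auto simp: has_hessian_on_def)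
  note cL = continuous_on_hyp_laplacian[OF u]
  show ?thesis
  proof (rule that[of "E / c0"])
    show "0 \<le> E / c0" using E c0 by simp
    show "\<forall>x\<in>?B. \<forall>x'\<in>?B. norm (x - x') \<le> wt x / 16 \<longrightarrow> \<bar>u x - u x'\<bar> \<le> E / c0 * norm (x - x') powr \<alpha>"
    proof (intro ballI impI)
      fix x x' :: "real ^ 'n" assume x: "x \<in> ?B" and x': "x' \<in> ?B" and near: "norm (x - x') \<le> wt x / 16"
      define W \<delta> where "W = wt x" and "\<delta> = norm (x - x')"
      have W: "0 < W" "W \<le> 1" using wt_pos[OF x] wt_le_1 by (auto simp: W_def)
      have \<delta>: "0 \<le> \<delta>" "\<delta> \<le> W" using near W by (auto simp: \<delta>_def W_def)
      have osc: "\<bar>u y - u x\<bar> \<le> 3 * K * W powr \<alpha>" if y: "y \<in> ?B" "norm (y - x) \<le> W" for y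
      proof -
        obtain \<xi> where \<xi>: "\<xi> \<in> sphere 0 1" "norm (x - \<xi>) \<le> W"
          using nearest_sphere_point[OF x] by (auto simp: W_def)
        have "norm (y - \<xi>) \<le> 2 * W" using norm_triangle_ineq[of "y - x" "x - \<xi>"] y \<xi> by simp
        then have "norm (y - \<xi>) powr \<alpha> \<le> (2 * W) powr \<alpha>" using \<alpha> by (intro powr_mono2) auto
        also have "\<dots> = 2 powr \<alpha> * W powr \<alpha>" by (simp add: powr_mult)
        also have "\<dots> \<le> 2 powr 1 * W powr \<alpha>" using \<alpha> by (intro mult_right_mono powr_mono) auto
        finally have "\<bar>u y - u \<xi>\<bar> \<le> K * (2 * W powr \<alpha>)"
          using K(2)[of y \<xi>] y \<xi> by (intro order_trans[OF K(2)] mult_left_mono K) auto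
        moreover have "\<bar>u x - u \<xi>\<bar> \<le> K * W powr \<alpha>"
          using x \<xi> \<alpha> by (intro order_trans[OF K(2)] mult_left_mono K powr_mono2) auto
        ultimately show ?thesis by linarith
      qed
      define F F' where "F y = u y - u x" and "F' y = u y - u x'" for y
      have F: "C2_on ?B F" "continuous_on ?B F" "\<And>y. y \<in> ?B \<Longrightarrow> hyp_laplacian F y = hyp_laplacian u y"
        using hyp_laplacian_linear[OF open_ball u C2_on_const[OF open_ball], where a=1 and b=0 and c="- u x"]
        by (auto simp: F_def[abs_def] intro!: continuous_intros uc)
      have F': "continuous_on ?B F'" unfolding F'_def[abs_def] by (intro continuous_intros uc)
      have main: "\<bar>u x - u x'\<bar> * c0 \<le> E * (\<delta> / W) * W powr \<alpha>
          + (\<bar>hyp_integral (inner_kernel ?n s) x' F'\<bar> + \<bar>hyp_integral (inner_kernel ?n s) x F\<bar>)"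
        if s: "0 < s" "s \<le> 1" for s
      proof -
        obtain e where e: "\<And>t. 0 \<le> t \<Longrightarrow> (e has_real_derivative - flux ?n s t) (at t)"
          and p: "profile ?n ?C e" using potential_profile[OF s] by blast
        have e0: "\<And>t. 1/24 \<le> t \<Longrightarrow> e t = 0" using p by (simp add: profile_def)
        let ?O = "outer_kernel ?n s" and ?I = "inner_kernel ?n s"
        note op = outer_kernel_profile(1)[OF s, of ?n] outer_kernel_profile(2)[where n="?n", OF s]
        note ik = inner_kernel_props[where n="?n", OF s(1)]
        have Lcong: "hyp_integral e z (hyp_laplacian F) = hyp_integral e z (hyp_laplacian u)" for z
          unfolding hyp_integral_def by (intro Bochner_Integration.integral_cong) (auto simp: F(3) indicator_def)
        have mx: "hyp_integral ?O x F - hyp_integral ?I x F = hyp_integral e x (hyp_laplacian u)"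
          and mx': "hyp_integral ?O x' F - hyp_integral ?I x' F = hyp_integral e x' (hyp_laplacian u)"
          using mean_value_formula[OF card F(1) x s e e0] mean_value_formula[OF card F(1) x' s e e0]
          by (simp_all add: Lcong)
        have m1: "hyp_integral ?O x' (\<lambda>_. 1) = hyp_integral ?I x' (\<lambda>_. 1)"
          using mean_value_formula[OF card C2_on_const[OF open_ball] x' s e e0, of 1]
          by (simp add: hyp_laplacian_const hyp_integral_def)
        have "hyp_integral ?I x' F = hyp_integral ?I x' (\<lambda>y. 1 * F' y + (u x' - u x) * 1)"
          by (simp add: F_def[abs_def] F'_def)
        also have "\<dots> = 1 * hyp_integral ?I x' F' + (u x' - u x) * hyp_integral ?I x' (\<lambda>_. 1)"
          by (rule hyp_integral_linear[OF x' ik(1,3) F']) auto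
        finally have split: "hyp_integral ?I x' F = hyp_integral ?I x' F' + (u x' - u x) * hyp_integral ?O x' (\<lambda>_. 1)"
          by (simp add: m1)
        have low: "c0 \<le> hyp_integral ?O x' (\<lambda>_. 1)"
          using hyp_integral_lower_bound[OF x' op(1) _ op(2)] by (simp add: c0_def)
        have d1: "\<bar>hyp_integral ?O x F - hyp_integral ?O x' F\<bar> \<le> 24 * ?C * 8 ^ ?n * (\<delta> / W) / W ^ ?n * (3 * K * W powr \<alpha>) * (C1 * W ^ ?n)"
          unfolding \<delta>_def W_def
          by (rule hyp_integral_diff_le[OF x x' near op(1) F(2), where h="\<lambda>_. 1"])
            (use osc R[of W] K W in \<open>auto simp: F_def W_def\<close>)
        have d2: "\<bar>hyp_integral e x (hyp_laplacian u) - hyp_integral e x' (hyp_laplacian u)\<bar>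
            \<le> 24 * ?C * 8 ^ ?n * (\<delta> / W) / W ^ ?n * (4 * W powr (1 + \<alpha>)) * (D * W ^ (?n - 1))"
          unfolding \<delta>_def W_def
        proof (rule hyp_integral_diff_le[OF x x' near p cL, where h=h])
          fix y assume y: "y \<in> ?B" "wt y \<le> 2 * wt x"
          show "\<bar>hyp_laplacian u y\<bar> \<le> 4 * wt x powr (1 + \<alpha>) * \<bar>h y\<bar>"
            by (rule weight_le_near[OF \<alpha> y uh[OF y(1)]]) simp
        qed (use h W in \<open>auto simp: W_def\<close>)
        have e1: "24 * ?C * 8 ^ ?n * (\<delta> / W) / W ^ ?n * (3 * K * W powr \<alpha>) * (C1 * W ^ ?n)
           = 24 * ?C * 8 ^ ?n * (3 * K * C1) * (\<delta> / W) * W powr \<alpha>"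
          using W by simp
        have e2: "24 * ?C * 8 ^ ?n * (\<delta> / W) / W ^ ?n * (4 * W powr (1 + \<alpha>)) * (D * W ^ (?n - 1))
           = 24 * ?C * 8 ^ ?n * (4 * D) * (\<delta> / W) * W powr \<alpha>"
        proof -
          have "24 * ?C * 8 ^ ?n * (\<delta> / W) / W ^ ?n * (4 * W powr (1 + \<alpha>)) * (D * W ^ (?n - 1))
            = 24 * ?C * 8 ^ ?n * (4 * D) * (\<delta> / W) * (W powr (1 + \<alpha>) * W ^ (?n - 1)) / W ^ ?n"
            by simp
          also have "\<dots> = 24 * ?C * 8 ^ ?n * (4 * D) * (\<delta> / W) * W powr \<alpha>"
            unfolding powr_mult_power[OF W(1) zero_less_card_finite] using W by simp
          finally show ?thesis .
        qed
        have "\<bar>u x - u x'\<bar> * c0 \<le> \<bar>u x' - u x\<bar> * hyp_integral ?O x' (\<lambda>_. 1)"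
          using low c0 by (subst abs_minus_commute) (intro mult_left_mono, auto)
        also have "\<dots> = \<bar>(u x' - u x) * hyp_integral ?O x' (\<lambda>_. 1)\<bar>" using low c0 by (simp add: abs_mult)
        also have "(u x' - u x) * hyp_integral ?O x' (\<lambda>_. 1) = - (hyp_integral ?O x F - hyp_integral ?O x' F)
            + (hyp_integral e x (hyp_laplacian u) - hyp_integral e x' (hyp_laplacian u)) - hyp_integral ?I x' F' + hyp_integral ?I x F"
          using mx mx' split by linarith
        finally have "\<bar>u x - u x'\<bar> * c0 \<le> \<bar>hyp_integral ?O x F - hyp_integral ?O x' F\<bar>
            + \<bar>hyp_integral e x (hyp_laplacian u) - hyp_integral e x' (hyp_laplacian u)\<bar> + \<bar>hyp_integral ?I x' F'\<bar> + \<bar>hyp_integral ?I x F\<bar>"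
          by linarith
        moreover have "E * (\<delta> / W) * W powr \<alpha> = 24 * ?C * 8 ^ ?n * (3 * K * C1) * (\<delta> / W) * W powr \<alpha>
            + 24 * ?C * 8 ^ ?n * (4 * D) * (\<delta> / W) * W powr \<alpha>"
          unfolding E_def by (simp only: distrib_right)
        ultimately show ?thesis using d1 d2 unfolding e1 e2 by linarith
      qed
      have lim: "((\<lambda>s. E * (\<delta> / W) * W powr \<alpha>
          + (\<bar>hyp_integral (inner_kernel ?n s) x' F'\<bar> + \<bar>hyp_integral (inner_kernel ?n s) x F\<bar>))
         \<longlongrightarrow> E * (\<delta> / W) * W powr \<alpha> + (\<bar>0\<bar> + \<bar>0\<bar>)) (at_right 0)"
        by (intro tendsto_intros inner_kernel_limit card x x' F F') (auto simp: F_def F'_def)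
      have "\<forall>\<^sub>F s in at_right 0. \<bar>u x - u x'\<bar> * c0 \<le> E * (\<delta> / W) * W powr \<alpha>
          + (\<bar>hyp_integral (inner_kernel ?n s) x' F'\<bar> + \<bar>hyp_integral (inner_kernel ?n s) x F\<bar>)"
        using eventually_at_right_real[OF zero_less_one]
        by (rule eventually_mono) (rule main, simp_all)
      then have "\<bar>u x - u x'\<bar> * c0 \<le> E * (\<delta> / W) * W powr \<alpha> + (\<bar>0\<bar> + \<bar>0\<bar>)"
        by (rule tendsto_lowerbound[OF lim]) simp
      also have "\<dots> \<le> E * \<delta> powr \<alpha>"
      proof (cases "\<delta> = 0")
        case False
        then have "\<delta> / W \<le> (\<delta> / W) powr \<alpha>"
          using powr_mono'[of \<alpha> 1 "\<delta> / W"] \<delta> W \<alpha> by simp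
        then have "E * ((\<delta> / W) * W powr \<alpha>) \<le> E * ((\<delta> / W) powr \<alpha> * W powr \<alpha>)"
          using E by (intro mult_left_mono mult_right_mono) auto
        also have "(\<delta> / W) powr \<alpha> * W powr \<alpha> = \<delta> powr \<alpha>"
          using W \<delta> by (simp add: powr_divide)
        finally show ?thesis by (simp add: mult.assoc)
      qed (use \<alpha> in simp)
      finally show "\<bar>u x - u x'\<bar> \<le> E / c0 * norm (x - x') powr \<alpha>"
        using c0 by (simp add: \<delta>_def field_simps)
    qed
  qed
qed

text \<open>A point \<open>y\<close> with \<open>|x-y| > w(x)/16\<close> is compared with \<open>x\<close> through the boundary point nearest
  to \<open>x\<close>, which is at distance at most \<open>w(x) \<le> 16 |x-y|\<close>.\<close>

lemma scalar_holder:
  fixes u h :: "real ^ 'n \<Rightarrow> real" and \<alpha> p M :: real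
  assumes card: "CARD('n) \<ge> 3" and \<alpha>: "0 < \<alpha>" "\<alpha> \<le> 1"
    and h: "h \<in> borel_measurable borel" "integrable lborel (\<lambda>y. \<bar>h y\<bar> powr p)" and p: "p > real CARD('n)"
    and u: "C2_on (ball 0 1) u" "continuous_on (cball 0 1) u"
    and uh: "\<forall>y\<in>ball 0 1. \<bar>hyp_laplacian u y\<bar> \<le> wt y powr (1 + \<alpha>) * \<bar>h y\<bar>"
    and M: "\<forall>x\<in>sphere 0 1. \<forall>y\<in>sphere 0 1. \<bar>u x - u y\<bar> \<le> M * norm (x - y) powr \<alpha>"
  shows "holder_on \<alpha> (cball 0 1) u"
proof -
  have card2: "CARD('n) \<ge> 2" using card by simp
  obtain D where D: "bounded_riesz_potential h D"
    by (rule riesz_potential_Lp_bounded[OF h p card2]) (rule that)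
  obtain K where K0: "0 \<le> K"
    "\<forall>x\<in>cball 0 1. \<forall>\<xi>\<in>sphere 0 1. \<bar>u x - u \<xi>\<bar> \<le> K * norm (x - \<xi>) powr \<alpha>"
    by (rule boundary_holder[OF card \<alpha> D u uh M]) (rule that)
  obtain C where C0: "0 \<le> C" "\<forall>x\<in>ball 0 1. \<forall>x'\<in>ball 0 1. norm (x - x') \<le> wt x / 16 \<longrightarrow>
       \<bar>u x - u x'\<bar> \<le> C * norm (x - x') powr \<alpha>"
    by (rule interior_holder[OF card \<alpha> D u(1) uh K0]) (rule that)
  note K = K0(1) K0(2)[rule_format] and C = C0(1) C0(2)[rule_format]
  have "norm (u x - u y) \<le> (33 * K + C) * norm (x - y) powr \<alpha>"
    if x: "x \<in> cball 0 1" and y: "y \<in> cball 0 1" for x y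
  proof -
    let ?d = "norm (x - y)"
    have KC: "K * ?d powr \<alpha> \<le> (33 * K + C) * ?d powr \<alpha>" "C * ?d powr \<alpha> \<le> (33 * K + C) * ?d powr \<alpha>"
      "33 * K * ?d powr \<alpha> \<le> (33 * K + C) * ?d powr \<alpha>"
      using K(1) C(1) by (intro mult_right_mono; simp)+
    consider "x \<in> sphere 0 1" | "x \<in> ball 0 1" "?d \<le> wt x / 16" | "x \<in> ball 0 1" "wt x \<le> 16 * ?d"
      using x by (cases "norm x = 1"; cases "?d \<le> wt x / 16") auto
    then show ?thesis
    proof cases
      case 1
      have "\<bar>u y - u x\<bar> \<le> K * norm (y - x) powr \<alpha>" by (rule K(2)[OF y 1])
      then have "\<bar>u x - u y\<bar> \<le> K * ?d powr \<alpha>" 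
        by (subst abs_minus_commute, subst norm_minus_commute)
      then show ?thesis unfolding real_norm_def using KC(1) by (rule order_trans)
    next
      case 2
      then have "y \<in> ball 0 1" 
        using wt_pos[OF 2(1)] by (intro near_in_ball(1)[OF 2(1)], subst norm_minus_commute) linarith
      then have "\<bar>u x - u y\<bar> \<le> C * ?d powr \<alpha>" by (rule C(2)[OF 2(1) _ 2(2)])
      then show ?thesis unfolding real_norm_def using KC(2) by (rule order_trans)
    next
      case 3
      obtain \<xi> where \<xi>: "\<xi> \<in> sphere 0 1" "norm (x - \<xi>) \<le> wt x" using nearest_sphere_point[OF 3(1)] by blast
      have pw: "(c * ?d) powr \<alpha> \<le> c * ?d powr \<alpha>" if "1 \<le> c" for c
      proof -
        have "(c * ?d) powr \<alpha> = c powr \<alpha> * ?d powr \<alpha>" using that by (simp add: powr_mult)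
        also have "\<dots> \<le> c powr 1 * ?d powr \<alpha>" using that \<alpha> by (intro mult_right_mono powr_mono) auto
        finally show ?thesis using that by simp
      qed
      have "norm (x - \<xi>) powr \<alpha> \<le> (16 * ?d) powr \<alpha>" using \<xi> 3 \<alpha> by (intro powr_mono2) auto
      then have a: "norm (x - \<xi>) powr \<alpha> \<le> 16 * ?d powr \<alpha>" using pw[of 16] by simp
      have "norm (y - \<xi>) \<le> 17 * ?d"
        using norm_triangle_ineq[of "y - x" "x - \<xi>"] \<xi>(2) 3(2) by (simp add: norm_minus_commute[of y x])
      then have "norm (y - \<xi>) powr \<alpha> \<le> (17 * ?d) powr \<alpha>" using \<alpha> by (intro powr_mono2) auto
      then have b: "norm (y - \<xi>) powr \<alpha> \<le> 17 * ?d powr \<alpha>" using pw[of 17] by simp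
      have "\<bar>u x - u \<xi>\<bar> \<le> K * (16 * ?d powr \<alpha>)" "\<bar>u y - u \<xi>\<bar> \<le> K * (17 * ?d powr \<alpha>)"
        by (rule order_trans[OF K(2)[OF x \<xi>(1)] mult_left_mono[OF a K(1)]],
            rule order_trans[OF K(2)[OF y \<xi>(1)] mult_left_mono[OF b K(1)]])
      then have "\<bar>u x - u y\<bar> \<le> 33 * K * ?d powr \<alpha>" by linarith
      then show ?thesis unfolding real_norm_def using KC(3) by (rule order_trans)
    qed
  qed
  then show ?thesis unfolding holder_on_def by blast
qed

section \<open>Reduction to components\<close>

lemma partial_deriv_nth:
  fixes f :: "real ^ 'n \<Rightarrow> real ^ 'm"
  assumes "f differentiable (at x)"
  shows "(\<lambda>y. f y $ j) differentiable (at x)" "partial_deriv i (\<lambda>y. f y $ j) x = partial_deriv i f x $ j"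
proof -
  obtain D where D: "(f has_derivative D) (at x)" using assms by (auto simp: differentiable_def)
  then have D': "((\<lambda>y. f y $ j) has_derivative (\<lambda>h. D h $ j)) (at x)"
    by (rule bounded_linear.has_derivative[OF bounded_linear_vec_nth])
  then show "(\<lambda>y. f y $ j) differentiable (at x)" by (auto simp: differentiable_def)
  show "partial_deriv i (\<lambda>y. f y $ j) x = partial_deriv i f x $ j"
    by (simp add: partial_deriv_eq[OF D] partial_deriv_eq[OF D'])
qed

lemma C1_on_nth:
  fixes f :: "real ^ 'n \<Rightarrow> real ^ 'm"
  assumes "C1_on S f"
  shows "C1_on S (\<lambda>y. f y $ j)"
proof -
  have d: "f differentiable (at x)" if "x \<in> S" for x using assms that by (simp add: C1_on_def)
  have "continuous_on S (partial_deriv i (\<lambda>y. f y $ j))" for i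
  proof -
    have "continuous_on S (\<lambda>x. partial_deriv i f x $ j)"
      using assms by (intro continuous_intros) (simp add: C1_on_def)
    then show ?thesis
      by (rule continuous_on_eq) (simp add: partial_deriv_nth(2)[OF d])
  qed
  then show ?thesis using partial_deriv_nth(1)[OF d] by (simp add: C1_on_def)
qed

lemma C2_on_nth:
  fixes f :: "real ^ 'n \<Rightarrow> real ^ 'm"
  assumes "open S" "C2_on S f"
  shows "C2_on S (\<lambda>y. f y $ j)"
proof -
  have C1: "C1_on S f" "\<And>i. C1_on S (partial_deriv i f)" using assms by (auto simp: C2_on_def)
  have "C1_on S (partial_deriv i (\<lambda>y. f y $ j))" for i
  proof (rule C1_on_cong[OF assms(1) _ C1_on_nth[OF C1(2)]])
    fix y assume "y \<in> S"
    then show "partial_deriv i f y $ j = partial_deriv i (\<lambda>y. f y $ j) y"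
      using C1(1) by (subst partial_deriv_nth(2)) (auto simp: C1_on_def)
  qed
  then show ?thesis using C1_on_nth[OF C1(1)] by (simp add: C2_on_def)
qed

text \<open>Continuity in the ball makes the extension by zero Borel measurable, so that the rest of the
  proof can work with Lebesgue-Borel measure on the whole space.\<close>

lemma in_Lp_ball_measure_integrable:
  fixes g :: "real ^ 'n \<Rightarrow> 'b :: euclidean_space"
  assumes g: "in_Lp p ball_measure g" and c: "continuous_on (ball 0 1) g"
  shows "(\<lambda>y. indicator (ball 0 1) y * norm (g y)) \<in> borel_measurable borel"
    and "integrable lborel (\<lambda>y. \<bar>indicator (ball 0 1) y * norm (g y)\<bar> powr p)"
proof -
  let ?B = "ball 0 1 :: (real ^ 'n) set"
  let ?h = "\<lambda>y. indicator ?B y * norm (g y)"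
  have "(\<lambda>y. if y \<in> ?B then norm (g y) else 0) \<in> borel_measurable borel"
    by (rule borel_measurable_continuous_on_if) (auto intro!: continuous_intros c)
  moreover have "(\<lambda>y. if y \<in> ?B then norm (g y) else 0) = ?h" by (auto simp: indicator_def)
  ultimately show m: "?h \<in> borel_measurable borel" by simp
  then have mp: "(\<lambda>y. \<bar>?h y\<bar> powr p) \<in> borel_measurable borel" by measurable
  let ?f = "\<lambda>y. ennreal (norm (g y) powr p)"
  have i: "integrable ball_measure (\<lambda>y. norm (g y) powr p)" using g by (simp add: in_Lp_def)
  have em: "emeasure (lebesgue_on ?B) ?B = ennreal (measure lborel ?B)"
    using emeasure_lborel_ball_finite[of "0 :: real ^ 'n" 1]
    by (subst emeasure_restrict_space) (auto simp: emeasure_eq_ennreal_measure less_top)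
  have V: "0 < measure lborel ?B" by simp
  have fm: "?f \<in> borel_measurable (lebesgue_on ?B)"
  proof -
    have "(\<lambda>y. norm (g y) powr p) \<in> borel_measurable ball_measure" using i by simp
    then show ?thesis by (simp add: ball_measure_def)
  qed
  have "(\<integral>\<^sup>+y. ?f y \<partial>ball_measure) < \<infinity>" using i by (simp add: integrable_iff_bounded)
  moreover have "(\<integral>\<^sup>+y. ?f y \<partial>ball_measure) = (\<integral>\<^sup>+y. ?f y * indicator ?B y \<partial>lebesgue_on ?B) / ennreal (measure lborel ?B)"
    unfolding ball_measure_def using fm by (subst nn_integral_uniform_measure) (auto simp: em)
  ultimately have "(\<integral>\<^sup>+y. ?f y * indicator ?B y \<partial>lebesgue_on ?B) < \<infinity>"
    using V by (cases "(\<integral>\<^sup>+y. ?f y * indicator ?B y \<partial>lebesgue_on ?B) = \<infinity>")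
      (auto simp: ennreal_top_divide less_top)
  also have "(\<integral>\<^sup>+y. ?f y * indicator ?B y \<partial>lebesgue_on ?B) = (\<integral>\<^sup>+y. ?f y * indicator ?B y * indicator ?B y \<partial>lebesgue)"
    by (rule nn_integral_restrict_space) simp
  also have "\<dots> = (\<integral>\<^sup>+y. ennreal (\<bar>?h y\<bar> powr p) \<partial>lebesgue)"
    by (rule nn_integral_cong) (auto simp: indicator_def)
  also have "\<dots> = (\<integral>\<^sup>+y. ennreal (\<bar>?h y\<bar> powr p) \<partial>lborel)"
    by (rule nn_integral_completion)
  finally show "integrable lborel (\<lambda>y. \<bar>?h y\<bar> powr p)"
    using mp by (intro integrableI_nonneg) auto
qed

theorem theorem4p7:
  fixes u :: "real ^ 'n \<Rightarrow> real ^ 'n"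
    and \<alpha> M p :: real and x\<^sub>0 :: "real ^ 'n"
  assumes "CARD('n) \<ge> 3"
    and "0 < \<alpha>" and "\<alpha> \<le> 1"
    and "C2_on (ball 0 1) u" and "continuous_on (cball 0 1) u"
    and "x\<^sub>0 \<in> sphere 0 1"
    and "\<forall>x\<in>sphere 0 1. norm (u x - u x\<^sub>0) \<le> M * norm (x - x\<^sub>0) powr \<alpha>"
    and "p > real CARD('n)"
    and "in_Lp p ball_measure
           (\<lambda>y. (1 - (norm y)\<^sup>2) powr (- 1 - \<alpha>) *\<^sub>R vec_hyp_laplacian u y)"
    and "holder_on \<alpha> (sphere 0 1) u"
  shows "holder_on \<alpha> (cball 0 1) u"
proof -
  let ?B = "ball 0 1 :: (real ^ 'n) set"
  let ?g = "\<lambda>y. (1 - (norm y)\<^sup>2) powr (- 1 - \<alpha>) *\<^sub>R vec_hyp_laplacian u y"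
  define h where "h y = indicator ?B y * norm (?g y)" for y
  have C2: "C2_on ?B (\<lambda>y. u y $ j)" for j by (rule C2_on_nth[OF open_ball assms(4)])
  have "continuous_on ?B (vec_hyp_laplacian u)"
    unfolding vec_hyp_laplacian_def[abs_def]
    by (intro continuous_on_vec_lambda continuous_on_hyp_laplacian C2)
  moreover have "continuous_on ?B (\<lambda>y. wt y powr (- 1 - \<alpha>))"
    by (intro continuous_intros continuous_on_wt) (auto dest: wt_nonzero)
  ultimately have "continuous_on ?B ?g"
    unfolding wt_def by (intro continuous_on_scaleR)
  note h = in_Lp_ball_measure_integrable[OF assms(9) this, folded h_def]
  have bound: "\<bar>hyp_laplacian (\<lambda>y. u y $ j) y\<bar> \<le> wt y powr (1 + \<alpha>) * \<bar>h y\<bar>" if y: "y \<in> ?B" for j y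
  proof -
    have "\<bar>hyp_laplacian (\<lambda>y. u y $ j) y\<bar> \<le> norm (vec_hyp_laplacian u y)"
      using component_le_norm_cart[of "vec_hyp_laplacian u y" j] by (simp add: vec_hyp_laplacian_def)
    also have "\<dots> = wt y powr (1 + \<alpha>) * (wt y powr (- 1 - \<alpha>) * norm (vec_hyp_laplacian u y))"
      using wt_pos[OF y] by (simp add: powr_add[symmetric] flip: mult.assoc)
    also have "\<dots> = wt y powr (1 + \<alpha>) * \<bar>h y\<bar>" using y by (simp add: h_def wt_def)
    finally show ?thesis .
  qed
  obtain M' where M': "\<And>x y. x \<in> sphere 0 1 \<Longrightarrow> y \<in> sphere 0 1 \<Longrightarrow> norm (u x - u y) \<le> M' * norm (x - y) powr \<alpha>"
    using assms(10) unfolding holder_on_def by blast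
  have "holder_on \<alpha> (cball 0 1) (\<lambda>y. u y $ j)" for j
  proof (rule scalar_holder[OF assms(1-3) h assms(8) C2])
    show "continuous_on (cball 0 1) (\<lambda>y. u y $ j)" using assms(5) by (intro continuous_intros)
    show "\<forall>x\<in>sphere 0 1. \<forall>y\<in>sphere 0 1. \<bar>u x $ j - u y $ j\<bar> \<le> M' * norm (x - y) powr \<alpha>"
    proof (intro ballI)
      fix x y :: "real ^ 'n" assume "x \<in> sphere 0 1" "y \<in> sphere 0 1"
      then show "\<bar>u x $ j - u y $ j\<bar> \<le> M' * norm (x - y) powr \<alpha>"
        using component_le_norm_cart[of "u x - u y" j] M'[of x y] by simp
    qed
  qed (use bound in auto)
  then obtain C where C: "\<And>j x y. x \<in> cball 0 1 \<Longrightarrow> y \<in> cball 0 1 \<Longrightarrow>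
      \<bar>u x $ j - u y $ j\<bar> \<le> C j * norm (x - y) powr \<alpha>"
    unfolding holder_on_def real_norm_def by metis
  have "norm (u x - u y) \<le> (\<Sum>j\<in>UNIV. C j) * norm (x - y) powr \<alpha>"
    if "x \<in> cball 0 1" "y \<in> cball 0 1" for x y
  proof -
    have "norm (u x - u y) \<le> (\<Sum>j\<in>UNIV. \<bar>(u x - u y) $ j\<bar>)" by (rule norm_le_l1_cart)
    also have "\<dots> \<le> (\<Sum>j\<in>UNIV. C j * norm (x - y) powr \<alpha>)"
      using C[OF that] by (intro sum_mono) simp
    finally show ?thesis by (simp add: sum_distrib_right)
  qed
  then show ?thesis unfolding holder_on_def by blast
qed

end
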